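(* Let $k\ge2$. The decision problems for the Green relations $\le_{\mathcal J}$, $\equiv_{\mathcal D}$, $\le_{\mathcal R}$, $\le_{\mathcal L}$ of $\mathit{Inv}_{k,1}$ (given $\psi,\varphi\in\mathit{Inv}_{k,1}$, does the relation hold between $\psi$ and $\varphi$?) are in $\mathsf P$ when the inputs are given by words over a finite generating set of $\mathit{Inv}_{k,1}$.
   Context: Let $A=\{a_1,\dots,a_k\}$, $k\ge2$, and let $A^*$ be the set of all finite words over $A$ (including the empty word). A right ideal of $A^*$ is a subset $R$ with $RA^*=R$ (the empty set is allowed). Two right ideals are essentially equal iff every right ideal that has non-empty intersection with one also has non-empty intersection with the other. A right ideal homomorphism is a total surjective function $\varphi:R_1\to R_2$ between finitely generated right ideals of $A^*$ with $\varphi(rx)=\varphi(r)x$ for all $r\in R_1$, $x\in A^*$. Two such homomorphisms are essentially equal iff their domains are essentially equal and they agree on the intersection of their domains. Every right ideal homomorphism $\varphi$ has a unique maximal essentially equal extension $\max(\varphi)$ to a right ideal homomorphism. $\mathit{Inv}_{k,1}$ is the (inverse) monoid of all maximally extended bijective right ideal homomorphisms between (not necessarily essential) right ideals, with product $\psi\varphi=\max(\psi\circ\varphi)$ ($\circ$ is composition of partial functions, $\varphi$ applied first). It is finitely generated. Green's relations in a monoid $M$: $u\le_{\mathcal J}v$ iff $u=xvy$ for some $x,y\in M$; $u\le_{\mathcal L}v$ iff $u=xv$ for some $x\in M$; $u\le_{\mathcal R}v$ iff $u=vx$ for some $x\in M$; $\equiv_{\mathcal L},\equiv_{\mathcal R}$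 are the associated equivalences; $u\equiv_{\mathcal D}v$ iff there is $s\in M$ with $u\equiv_{\mathcal R}s\equiv_{\mathcal L}v$. *)

theory Defs
  imports Main "HOL-Library.Cardinality" "HOL-Algebra.Group"
    "HOL-Computational_Algebra.Polynomial"
begin

text \<open>The alphabet is the finite type \<open>'a\<close>, so that \<open>k = CARD('a)\<close> and
  the free monoid is the whole type \<open>'a list\<close>.\<close>

definition cone :: "'a list set \<Rightarrow> 'a list set" where
  "cone F = {f @ x | f x. f \<in> F}"

definition right_ideal :: "'a list set \<Rightarrow> bool" where
  "right_ideal R \<longleftrightarrow> cone R = R"

definition fg_right_ideal :: "'a list set \<Rightarrow> bool" where
  "fg_right_ideal R \<longleftrightarrow> (\<exists>F. finite F \<and> R = cone F)"

definition ess_equal :: "'a list set \<Rightarrow> 'a list set \<Rightarrow> bool" where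
  "ess_equal R S \<longleftrightarrow> (\<forall>I. right_ideal I \<longrightarrow> (I \<inter> R \<noteq> {} \<longleftrightarrow> I \<inter> S \<noteq> {}))"

text \<open>A surjective function \<open>R\<^sub>1 \<rightarrow> R\<^sub>2\<close> is represented by the partial function with domain
  \<open>R\<^sub>1\<close> and range \<open>R\<^sub>2\<close>.\<close>

type_synonym 'a pfun = "'a list \<Rightarrow> 'a list option"

definition ri_hom :: "'a pfun \<Rightarrow> bool" where
  "ri_hom \<phi> \<longleftrightarrow> fg_right_ideal (dom \<phi>) \<and> fg_right_ideal (ran \<phi>) \<and>
     (\<forall>r\<in>dom \<phi>. \<forall>x. \<phi> (r @ x) = Some (the (\<phi> r) @ x))"

definition ess_equal_hom :: "'a pfun \<Rightarrow> 'a pfun \<Rightarrow> bool" where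
  "ess_equal_hom \<phi> \<psi> \<longleftrightarrow>
     ess_equal (dom \<phi>) (dom \<psi>) \<and> (\<forall>x\<in>dom \<phi> \<inter> dom \<psi>. \<phi> x = \<psi> x)"

definition ess_extensions :: "'a pfun \<Rightarrow> 'a pfun set" where
  "ess_extensions \<phi> = {\<psi>. ri_hom \<psi> \<and> ess_equal_hom \<psi> \<phi> \<and> \<phi> \<subseteq>\<^sub>m \<psi>}"

definition max_ext :: "'a pfun \<Rightarrow> 'a pfun" where
  "max_ext \<phi> = (THE \<psi>. \<psi> \<in> ess_extensions \<phi> \<and>
     (\<forall>\<chi>\<in>ess_extensions \<phi>. \<psi> \<subseteq>\<^sub>m \<chi> \<longrightarrow> \<chi> = \<psi>))"

text \<open>The product applies the right factor first; \<open>Some\<close> is the identity of the free monoid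
  as a partial function.\<close>

definition Inv :: "'a::finite pfun monoid" where
  "Inv = \<lparr>carrier = {\<phi>. ri_hom \<phi> \<and> inj_on \<phi> (dom \<phi>) \<and> max_ext \<phi> = \<phi>},
          monoid.mult = (\<lambda>\<psi> \<phi>. max_ext (\<psi> \<circ>\<^sub>m \<phi>)),
          monoid.one = Some\<rparr>"

definition green_le_J :: "('m, 'b) monoid_scheme \<Rightarrow> 'm \<Rightarrow> 'm \<Rightarrow> bool" where
  "green_le_J M u v \<longleftrightarrow> (\<exists>x\<in>carrier M. \<exists>y\<in>carrier M. u = x \<otimes>\<^bsub>M\<^esub> v \<otimes>\<^bsub>M\<^esub> y)"

definition green_le_L :: "('m, 'b) monoid_scheme \<Rightarrow> 'm \<Rightarrow> 'm \<Rightarrow> bool" where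
  "green_le_L M u v \<longleftrightarrow> (\<exists>x\<in>carrier M. u = x \<otimes>\<^bsub>M\<^esub> v)"

definition green_le_R :: "('m, 'b) monoid_scheme \<Rightarrow> 'm \<Rightarrow> 'm \<Rightarrow> bool" where
  "green_le_R M u v \<longleftrightarrow> (\<exists>x\<in>carrier M. u = v \<otimes>\<^bsub>M\<^esub> x)"

definition green_L :: "('m, 'b) monoid_scheme \<Rightarrow> 'm \<Rightarrow> 'm \<Rightarrow> bool" where
  "green_L M u v \<longleftrightarrow> green_le_L M u v \<and> green_le_L M v u"

definition green_R :: "('m, 'b) monoid_scheme \<Rightarrow> 'm \<Rightarrow> 'm \<Rightarrow> bool" where
  "green_R M u v \<longleftrightarrow> green_le_R M u v \<and> green_le_R M v u"

definition green_D :: "('m, 'b) monoid_scheme \<Rightarrow> 'm \<Rightarrow> 'm \<Rightarrow> bool" where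
  "green_D M u v \<longleftrightarrow> (\<exists>s\<in>carrier M. green_R M u s \<and> green_L M s v)"

definition word_value :: "('m, 'b) monoid_scheme \<Rightarrow> 'm list \<Rightarrow> 'm" where
  "word_value M w = foldr (\<lambda>g h. g \<otimes>\<^bsub>M\<^esub> h) w \<one>\<^bsub>M\<^esub>"

text \<open>Generation as a monoid: inverses are not taken implicitly.\<close>

definition generates :: "('m, 'b) monoid_scheme \<Rightarrow> 'm set \<Rightarrow> bool" where
  "generates M \<Gamma> \<longleftrightarrow> \<Gamma> \<subseteq> carrier M \<and> carrier M = word_value M ` lists \<Gamma>"

text \<open>Deterministic Turing machines with finitely many two-way infinite tapes. States and tape
  symbols are initial segments of the natural numbers, and the symbol \<open>0\<close> is the blank.
  The transition function maps a state and the list of scanned symbols to a new state and, for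
  each tape, the symbol to write and the head move.\<close>

datatype move = MoveLeft | MoveNone | MoveRight

record tm =
  num_tapes :: nat
  num_symbols :: nat
  num_states :: nat
  init_state :: nat
  acc_state :: nat
  rej_state :: nat
  trans_fun :: "nat \<Rightarrow> nat list \<Rightarrow> nat \<times> (nat \<times> move) list"

definition wf_tm :: "tm \<Rightarrow> bool" where
  "wf_tm M \<longleftrightarrow> num_tapes M \<ge> 1 \<and> num_symbols M \<ge> 1 \<and>
     init_state M < num_states M \<and> acc_state M < num_states M \<and> rej_state M < num_states M \<and>
     acc_state M \<noteq> rej_state M \<and>
     (\<forall>q < num_states M. \<forall>ss. length ss = num_tapes M \<and> set ss \<subseteq> {..<num_symbols M} \<longrightarrow>
        (case trans_fun M q ss of (q', as) \<Rightarrow>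
           q' < num_states M \<and> length as = num_tapes M \<and> fst ` set as \<subseteq> {..<num_symbols M}))"

text \<open>A tape is its content together with the head position.\<close>

type_synonym tape = "(int \<Rightarrow> nat) \<times> int"
type_synonym config = "nat \<times> tape list"

definition tape_read :: "tape \<Rightarrow> nat" where
  "tape_read = (\<lambda>(c, p). c p)"

definition head_shift :: "move \<Rightarrow> int" where
  "head_shift m = (case m of MoveLeft \<Rightarrow> -1 | MoveNone \<Rightarrow> 0 | MoveRight \<Rightarrow> 1)"

definition tape_act :: "nat \<times> move \<Rightarrow> tape \<Rightarrow> tape" where
  "tape_act = (\<lambda>(s, m) (c, p). (c(p := s), p + head_shift m))"

definition tm_step :: "tm \<Rightarrow> config \<Rightarrow> config" where
  "tm_step M = (\<lambda>(q, ts).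
     if q = acc_state M \<or> q = rej_state M then (q, ts)
     else case trans_fun M q (map tape_read ts) of (q', as) \<Rightarrow> (q', map2 tape_act as ts))"

definition input_tape :: "nat list \<Rightarrow> tape" where
  "input_tape x = ((\<lambda>i. if 0 \<le> i \<and> i < int (length x) then x ! nat i else 0), 0)"

definition blank_tape :: tape where
  "blank_tape = ((\<lambda>_. 0), 0)"

definition init_config :: "tm \<Rightarrow> nat list \<Rightarrow> config" where
  "init_config M x = (init_state M, input_tape x # replicate (num_tapes M - 1) blank_tape)"

definition tm_state_after :: "tm \<Rightarrow> nat list \<Rightarrow> nat \<Rightarrow> nat" where
  "tm_state_after M x t = fst ((tm_step M ^^ t) (init_config M x))"

text \<open>The language \<open>L\<close> over the finite alphabet \<open>\<Sigma>\<close> is in P. Since \<open>\<Sigma>\<close> is finite, the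
  assignment \<open>code\<close> of non-blank tape symbols to its letters is immaterial.\<close>

definition in_P :: "'c set \<Rightarrow> 'c list set \<Rightarrow> bool" where
  "in_P \<Sigma> L \<longleftrightarrow> finite \<Sigma> \<and> L \<subseteq> lists \<Sigma> \<and>
     (\<exists>M (p :: nat poly) code. wf_tm M \<and>
        inj_on code \<Sigma> \<and> code ` \<Sigma> \<subseteq> {1..<num_symbols M} \<and>
        (\<forall>w\<in>lists \<Sigma>. \<exists>t \<le> poly p (length w).
           tm_state_after M (map code w) t = (if w \<in> L then acc_state M else rej_state M)))"

text \<open>The problem ``given words \<open>u\<close>, \<open>v\<close> over \<open>\<Gamma>\<close>, does \<open>rel\<close> hold between their values in
  \<open>M\<close>?'' as a language over \<open>\<Gamma>\<close> extended by a separator: the pair \<open>(u, v)\<close> is the string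
  \<open>u # v\<close>, with \<open>None\<close> in the role of the separator \<open>#\<close>.\<close>

definition word_pair :: "'m list \<Rightarrow> 'm list \<Rightarrow> 'm option list" where
  "word_pair u v = map Some u @ [None] @ map Some v"

definition word_problem_lang ::
    "('m, 'b) monoid_scheme \<Rightarrow> 'm set \<Rightarrow> ('m \<Rightarrow> 'm \<Rightarrow> bool) \<Rightarrow> 'm option list set" where
  "word_problem_lang M \<Gamma> rel =
     {word_pair u v | u v. u \<in> lists \<Gamma> \<and> v \<in> lists \<Gamma> \<and> rel (word_value M u) (word_value M v)}"

definition word_problem_in_P ::
    "('m, 'b) monoid_scheme \<Rightarrow> 'm set \<Rightarrow> ('m \<Rightarrow> 'm \<Rightarrow> bool) \<Rightarrow> bool" where
  "word_problem_in_P M \<Gamma> rel \<longleftrightarrow>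
     in_P (insert None (Some ` \<Gamma>)) (word_problem_lang M \<Gamma> rel)"

end

(* Up to essential equality a right ideal homomorphism is determined by its values on long words,
   and max_ext phi is defined on w exactly if, for some word v, phi (w x) = v x
   for all long x. Hence u <=_L v (u <=_R v) says that every long word in the domain
   (range) of u lies in that of v, u <=_J v that u is zero or v is not, and u is D-equivalent to v
   if both or none of them are zero and the prefix codes generating their domains have the same
   number of elements modulo k - 1: replacing c by the words ca changes this number by k - 1, and
   codes of equal size are matched by an element of the monoid.

   For a product of generators all this can be read off from polynomially many candidate words,
   the preimages of words of bounded length under the suffixes of the product; long words in the
   domain of the product have a candidate in the domain as a prefix. Applying a generator or its
   inverse replaces a prefix of bounded length, so candidates are computed in polynomial time.

   For the polynomial time bound, functions on words are computed by register programs whose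
   registers are stacks, each simulated by one tape; the class of polynomial-time functions is
   closed under recursion on a word with polynomially bounded values, and this suffices. *)

theory Submission
  imports Defs "HOL-Library.Sublist" "HOL-Number_Theory.Cong"
begin

text \<open>No maximal extension and no table of a product is formed when deciding: all criteria
  look only at long words, so a product in the monoid may be replaced by the plain composite of its
  factors. A candidate is named by a suffix and a short word, which leaves at most (length + 1)
  times a constant of them, and it is found by running the inverse of the suffix on the short word.
  This is why the generating set is closed under inverses first. Candidates outside the domain
  matter too: one without any extension in the domain certifies that the long words below it are
  outside, and a test of inclusion has to see such words. The zero forms a class of its own because
  an empty code offers no word to split, whereas a nonempty code can be enlarged in steps of k - 1.
  On the machine side the obstacle is the size of intermediate values: recursion stays polynomial
  only under an a priori length bound. Such bounds exist because each generator changes only a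
  prefix of bounded length, so words grow linearly, and because the codes are small enough to be
  counted in unary.\<close>

section \<open>Register programs and their simulation by Turing machines\<close>

text \<open>\<open>Put\<close> is the second half of the simulation of \<open>Push\<close>, which takes two machine steps.\<close>

datatype 'c com =
    Skip
  | Push nat 'c
  | Put nat 'c
  | Pop nat
  | Seq "'c com" "'c com"
  | Case nat "'c option \<Rightarrow> 'c com"
  | While nat "'c com"

type_synonym 'c store = "nat \<Rightarrow> 'c list"

definition top_of :: "'c list \<Rightarrow> 'c option" where
  "top_of xs = (case xs of [] \<Rightarrow> None | a # _ \<Rightarrow> Some a)"

lemma top_of_simps [simp]: "top_of [] = None" "top_of (a # xs) = Some a"
  by (simp_all add: top_of_def)

text \<open>The numbers are the exact numbers of machine steps of the simulation: two for
  \<open>Push\<close>, one for unfolding \<open>Seq\<close>, \<open>Case\<close> or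
  \<open>While\<close>. \<open>Put\<close> has no rule, since it occurs only in control states,
  between the two steps of a \<open>Push\<close>.\<close>

inductive run :: "'c com \<Rightarrow> 'c store \<Rightarrow> nat \<Rightarrow> 'c store \<Rightarrow> bool" where
  run_Skip: "run Skip s 1 s"
| run_Push: "run (Push v a) s 2 (s(v := a # s v))"
| run_Pop: "run (Pop v) s 1 (s(v := tl (s v)))"
| run_Seq: "run c s t s' \<Longrightarrow> run d s' t' s'' \<Longrightarrow> run (Seq c d) s (1 + t + t') s''"
| run_Case: "run (f (top_of (s v))) s t s' \<Longrightarrow> run (Case v f) s (1 + t) s'"
| run_While_empty: "s v = [] \<Longrightarrow> run (While v c) s 1 s"
| run_While: "s v \<noteq> [] \<Longrightarrow> run c s t s' \<Longrightarrow> run (While v c) s' t' s'' \<Longrightarrow>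
    run (While v c) s (1 + t + t') s''"

text \<open>\<open>m\<close> is the number of tapes. Branches of \<open>Case\<close> are constrained
  only on \<Sigma>, because \<open>f\<close> is a function on the whole type of symbols, which need
  not be finite.\<close>

primrec com_ok :: "'c set \<Rightarrow> nat \<Rightarrow> 'c com \<Rightarrow> bool" where
  "com_ok \<Sigma> m Skip = True"
| "com_ok \<Sigma> m (Push v a) = (v < m \<and> a \<in> \<Sigma>)"
| "com_ok \<Sigma> m (Put v a) = (v < m \<and> a \<in> \<Sigma>)"
| "com_ok \<Sigma> m (Pop v) = (v < m)"
| "com_ok \<Sigma> m (Seq c d) = (com_ok \<Sigma> m c \<and> com_ok \<Sigma> m d)"
| "com_ok \<Sigma> m (Case v f) = (v < m \<and> (\<forall>x. set_option x \<subseteq> \<Sigma> \<longrightarrow> com_ok \<Sigma> m (f x)))"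
| "com_ok \<Sigma> m (While v c) = (v < m \<and> com_ok \<Sigma> m c)"

lemma com_ok_mono: "com_ok \<Sigma> m c \<Longrightarrow> m \<le> m' \<Longrightarrow> com_ok \<Sigma> m' c"
  by (induction c) auto

definition valid :: "'c set \<Rightarrow> 'c store \<Rightarrow> bool" where
  "valid \<Sigma> s \<longleftrightarrow> (\<forall>v. set (s v) \<subseteq> \<Sigma>)"

lemma valid_top: "valid \<Sigma> s \<Longrightarrow> set_option (top_of (s v)) \<subseteq> \<Sigma>"
  unfolding valid_def top_of_def by (metis (no_types) list.exhaust list.set_intros(1) list.simps(4,5)
      empty_subsetI option.set(1,2) insert_subset subsetD)

lemma valid_upd: "valid \<Sigma> s \<Longrightarrow> set xs \<subseteq> \<Sigma> \<Longrightarrow> valid \<Sigma> (s(v := xs))"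
  by (auto simp: valid_def)

lemma run_valid: "run c s t s' \<Longrightarrow> com_ok \<Sigma> m c \<Longrightarrow> valid \<Sigma> s \<Longrightarrow> valid \<Sigma> s'"
proof (induction rule: run.induct)
  case (run_Pop v s)
  then have "set (tl (s v)) \<subseteq> \<Sigma>" unfolding valid_def by (metis list.set_sel(2) list.sel(2) subset_iff)
  then show ?case using run_Pop by (intro valid_upd)
next
  case (run_Push v a s)
  then have "set (a # s v) \<subseteq> \<Sigma>" unfolding valid_def by auto
  then show ?case using run_Push by (intro valid_upd)
next
  case (run_Case f s v t s')
  then show ?case using valid_top[of \<Sigma> s v] by auto
qed auto

text \<open>Time bounds space: a stack grows only by a push, which costs two steps. This later turns
  each running time into a bound on the length of the result.\<close>

lemma run_length: "run c s t s' \<Longrightarrow> length (s' v) \<le> length (s v) + t"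
  by (induction rule: run.induct) auto

text \<open>The control states of the machine simulating a program are the lists of commands that
  remain to be executed.\<close>

primrec conts :: "'c set \<Rightarrow> 'c com \<Rightarrow> 'c com list \<Rightarrow> 'c com list set" where
  "conts \<Sigma> Skip K = {Skip # K}"
| "conts \<Sigma> (Push v a) K = {Push v a # K, Put v a # K}"
| "conts \<Sigma> (Put v a) K = {Put v a # K}"
| "conts \<Sigma> (Pop v) K = {Pop v # K}"
| "conts \<Sigma> (Seq c d) K = insert (Seq c d # K) (conts \<Sigma> c (d # K) \<union> conts \<Sigma> d K)"
| "conts \<Sigma> (Case v f) K = insert (Case v f # K) (\<Union>x\<in>insert None (Some ` \<Sigma>). conts \<Sigma> (f x) K)"
| "conts \<Sigma> (While v c) K = insert (While v c # K) (conts \<Sigma> c (While v c # K))"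

text \<open>A loop body continues with the loop itself instead of an unfolding of it, and
  \<open>Case\<close> contributes branches only for \<open>None\<close> and the finitely many
  letters.\<close>

lemma finite_conts: "finite \<Sigma> \<Longrightarrow> finite (conts \<Sigma> c K)"
  by (induction c arbitrary: K) auto

lemma conts_self: "c # K \<in> conts \<Sigma> c K"
  by (cases c) auto

text \<open>A stack grows to the left of the tape; cells to the left of the head may contain garbage.\<close>

definition stack_tape :: "('c \<Rightarrow> nat) \<Rightarrow> 'c list \<Rightarrow> tape \<Rightarrow> bool" where
  "stack_tape code xs tp \<longleftrightarrow>
     (\<forall>i::nat. fst tp (snd tp + int i) = (if i < length xs then code (xs ! i) else 0))"

lemma tape_read_eq: "tape_read tp = fst tp (snd tp)"
  by (simp add: tape_read_def split: prod.split)

lemma tape_act_eq: "tape_act (a, m) tp = ((fst tp)(snd tp := a), snd tp + head_shift m)"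
  by (simp add: tape_act_def split: prod.split)

lemma stack_tape_read:
  "stack_tape code xs tp \<Longrightarrow> tape_read tp = (case xs of [] \<Rightarrow> 0 | a # _ \<Rightarrow> code a)"
  unfolding stack_tape_def tape_read_eq by (drule spec[of _ 0]) (auto split: list.split)

lemma tape_act_read [simp]: "tape_act (tape_read tp, MoveNone) tp = tp"
  by (simp add: tape_act_eq tape_read_eq head_shift_def)

text \<open>A transition writes before it moves. So one step goes left, rewriting the symbol it
  leaves, and a second one overwrites the garbage found there.\<close>

lemma stack_tape_push:
  assumes "stack_tape code xs tp"
  shows "stack_tape code (a # xs)
    (tape_act (code a, MoveNone) (tape_act (tape_read tp, MoveLeft) tp))"
  unfolding stack_tape_def
proof
  fix i :: nat
  show "fst (tape_act (code a, MoveNone) (tape_act (tape_read tp, MoveLeft) tp))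
        (snd (tape_act (code a, MoveNone) (tape_act (tape_read tp, MoveLeft) tp)) + int i) =
       (if i < length (a # xs) then code ((a # xs) ! i) else 0)"
    using assms by (cases i) (auto simp: stack_tape_def tape_act_eq tape_read_eq head_shift_def)
qed

lemma stack_tape_pop:
  assumes "stack_tape code (a # xs) tp"
  shows "stack_tape code xs (tape_act (tape_read tp, MoveRight) tp)"
  unfolding stack_tape_def
proof
  fix i :: nat
  show "fst (tape_act (tape_read tp, MoveRight) tp)
        (snd (tape_act (tape_read tp, MoveRight) tp) + int i) =
       (if i < length xs then code (xs ! i) else 0)"
    using spec[OF assms[unfolded stack_tape_def], of "Suc i"]
    by (auto simp: tape_act_eq tape_read_eq head_shift_def add_ac)
qed

section \<open>The machine that executes a program\<close>

locale simulation =
  fixes \<Sigma> :: "'c set" and code :: "'c \<Rightarrow> nat" and m :: nat and Q :: "'c com list set"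
    and index :: "'c com list \<Rightarrow> nat" and r :: nat and c0 :: "'c com"
  assumes fin: "finite \<Sigma>"
    and code: "bij_betw code \<Sigma> {1..card \<Sigma>}"
    and finQ: "finite Q"
    and index: "bij_betw index Q {..<card Q}"
    and ok0: "com_ok \<Sigma> m c0"
    and Q0: "insert [] (conts \<Sigma> c0 []) \<subseteq> Q"
    and r: "r < m"
begin

definition decode :: "nat \<Rightarrow> 'c option" where
  "decode n = (if n \<in> {1..card \<Sigma>} then Some (inv_into \<Sigma> code n) else None)"

text \<open>The default \<open>card Q + 1\<close> is the rejecting state. It keeps every transition
  inside the state set, as \<open>wf_tm\<close> quantifies over all states and not only over those
  met in a run.\<close>

definition state_of :: "'c com list \<Rightarrow> nat" where
  "state_of K = (if K \<in> Q then index K else card Q + 1)"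

definition noop :: "nat list \<Rightarrow> (nat \<times> move) list" where
  "noop ss = map (\<lambda>a. (a, MoveNone)) ss"

text \<open>Letters have codes from 1 on, so a scanned 0 means an empty stack; popping then leaves
  the head in place, in agreement with \<open>tl [] = []\<close>.\<close>

primrec control :: "'c com \<Rightarrow> 'c com list \<Rightarrow> nat list \<Rightarrow> nat \<times> (nat \<times> move) list" where
  "control Skip K ss = (state_of K, noop ss)"
| "control (Push v a) K ss = (state_of (Put v a # K), (noop ss)[v := (ss ! v, MoveLeft)])"
| "control (Put v a) K ss =
     (state_of K, (noop ss)[v := (if a \<in> \<Sigma> then code a else 0, MoveNone)])"
| "control (Pop v) K ss =
     (state_of K, (noop ss)[v := (ss ! v, if ss ! v = 0 then MoveNone else MoveRight)])"
| "control (Seq c d) K ss = (state_of (c # d # K), noop ss)"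
| "control (Case v f) K ss = (state_of (f (decode (ss ! v)) # K), noop ss)"
| "control (While v c) K ss =
     (state_of (if ss ! v = 0 then K else c # While v c # K), noop ss)"

text \<open>The empty control list marks the end of the program: one further step inspects register
  \<open>r\<close> and enters the accepting or the rejecting state.\<close>

definition trans :: "nat \<Rightarrow> nat list \<Rightarrow> nat \<times> (nat \<times> move) list" where
  "trans q ss = (if q < card Q then
      (case inv_into Q index q of
         [] \<Rightarrow> (if ss ! r = 0 then card Q + 1 else card Q, noop ss)
       | c # K \<Rightarrow> control c K ss)
     else (q, noop ss))"

definition machine :: tm where
  "machine = \<lparr>num_tapes = m, num_symbols = Suc (card \<Sigma>), num_states = card Q + 2,
     init_state = index [c0], acc_state = card Q, rej_state = card Q + 1, trans_fun = trans\<rparr>"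

lemma state_of_less: "state_of K < card Q + 2"
proof -
  have "K \<in> Q \<Longrightarrow> index K < card Q"
    using bij_betwE[OF index] by blast
  then show ?thesis by (fastforce simp: state_of_def)
qed

lemma set_noop: "fst ` set (noop ss) = set ss"
  by (force simp: noop_def)

lemma set_noop_update:
  assumes "set ss \<subseteq> A" "v < length ss \<Longrightarrow> x \<in> A"
  shows "fst ` set ((noop ss)[v := (x, d)]) \<subseteq> A"
proof (cases "v < length ss")
  case True
  then show ?thesis
    using assms set_update_subset_insert[of "noop ss" v "(x, d)"] set_noop[of ss] by force
next
  case False
  then have "(noop ss)[v := (x, d)] = noop ss" by (simp add: noop_def list_update_beyond)
  then show ?thesis using assms(1) set_noop[of ss] by simp
qed

lemma code_less: "a \<in> \<Sigma> \<Longrightarrow> 0 < code a \<and> code a < Suc (card \<Sigma>)"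
  using bij_betwE[OF code] by fastforce

lemma control_wf:
  assumes "set ss \<subseteq> {..<Suc (card \<Sigma>)}"
  shows "fst (control c K ss) < card Q + 2 \<and> length (snd (control c K ss)) = length ss \<and>
     fst ` set (snd (control c K ss)) \<subseteq> {..<Suc (card \<Sigma>)}"
proof -
  have 2: "v < length ss \<Longrightarrow> ss ! v \<in> {..<Suc (card \<Sigma>)}" for v
    using assms nth_mem by blast
  have 3: "length (noop ss) = length ss" by (simp add: noop_def)
  have 4: "(if a \<in> \<Sigma> then code a else 0) \<in> {..<Suc (card \<Sigma>)}" for a using code_less by auto
  note 5 = set_noop_update[OF assms 4] set_noop_update[OF assms 2]
  have 6: "fst ` set (noop ss) \<subseteq> {..<Suc (card \<Sigma>)}" using assms by (simp add: set_noop)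
  show ?thesis
    by (cases c) (simp_all only: control.simps fst_conv snd_conv state_of_less 3 5 6
        length_list_update simp_thms)
qed

lemma trans_wf:
  assumes "set ss \<subseteq> {..<Suc (card \<Sigma>)}" "q < card Q + 2"
  shows "fst (trans q ss) < card Q + 2 \<and> length (snd (trans q ss)) = length ss \<and>
     fst ` set (snd (trans q ss)) \<subseteq> {..<Suc (card \<Sigma>)}"
proof -
  have 1: "fst ` set (noop ss) \<subseteq> {..<Suc (card \<Sigma>)}" "length (noop ss) = length ss"
    using assms by (simp_all add: set_noop, simp add: noop_def)
  show ?thesis
    using 1 assms control_wf[OF assms(1)]
    by (cases "inv_into Q index q") (simp_all only: trans_def split: if_splits, auto)
qed

lemma index_in: "K \<in> Q \<Longrightarrow> index K < card Q"
  using bij_betwE[OF index] by blast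

lemma trans_index [simp]:
  assumes "K \<in> Q"
  shows "trans (index K) ss = (case K of
         [] \<Rightarrow> (if ss ! r = 0 then card Q + 1 else card Q, noop ss)
       | c # K \<Rightarrow> control c K ss)"
  using assms index_in[OF assms] inv_into_f_f[of index Q K] index
  by (simp add: trans_def bij_betw_def)

lemma wf_machine: "wf_tm machine"
proof -
  have "[c0] \<in> Q" using Q0 conts_self[of c0 "[]" \<Sigma>] by auto
  then have "index [c0] < card Q" by (rule index_in)
  moreover have "case trans q ss of (q', as) \<Rightarrow>
      q' < card Q + 2 \<and> length as = m \<and> fst ` set as \<subseteq> {..<Suc (card \<Sigma>)}"
    if "q < card Q + 2" "length ss = m \<and> set ss \<subseteq> {..<Suc (card \<Sigma>)}" for q ss
    using trans_wf[of ss q] that by (simp add: case_prod_beta)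
  ultimately show ?thesis
    using r unfolding wf_tm_def machine_def by simp
qed

definition rep :: "'c store \<Rightarrow> tape list \<Rightarrow> bool" where
  "rep s ts \<longleftrightarrow> length ts = m \<and> (\<forall>v<m. stack_tape code (s v) (ts ! v))"

definition reaches :: "nat \<Rightarrow> config \<Rightarrow> config \<Rightarrow> bool" where
  "reaches t C C' \<longleftrightarrow> (tm_step machine ^^ t) C = C'"

lemma reaches_0: "reaches 0 C C" by (simp add: reaches_def)

lemma reaches_trans: "reaches t C C' \<Longrightarrow> reaches t' C' C'' \<Longrightarrow> reaches (t + t') C C''"
  unfolding reaches_def by (subst add.commute) (auto simp: funpow_add)

lemma reaches_Suc: "tm_step machine C = C' \<Longrightarrow> reaches t C' C'' \<Longrightarrow> reaches (Suc t) C C''"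
  by (simp add: reaches_def funpow_Suc_right del: funpow.simps)

lemma read_rep:
  assumes "rep s ts" "v < m" "valid \<Sigma> s"
  shows "map tape_read ts ! v = (case top_of (s v) of None \<Rightarrow> 0 | Some a \<Rightarrow> code a)"
    and "decode (map tape_read ts ! v) = top_of (s v)"
    and "map tape_read ts ! v = 0 \<longleftrightarrow> s v = []"
proof -
  have 1: "map tape_read ts ! v = (case s v of [] \<Rightarrow> 0 | a # _ \<Rightarrow> code a)"
    using assms stack_tape_read[of code "s v" "ts ! v"] by (auto simp: rep_def)
  have in\<Sigma>: "s v = a # x \<Longrightarrow> a \<in> \<Sigma>" for a x using assms(3) unfolding valid_def
    by (metis list.set_intros(1) subsetD)
  show "map tape_read ts ! v = (case top_of (s v) of None \<Rightarrow> 0 | Some a \<Rightarrow> code a)"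
    using 1 by (simp split: list.splits)
  show "map tape_read ts ! v = 0 \<longleftrightarrow> s v = []"
    using 1 in\<Sigma> code_less by (fastforce split: list.splits)
  show "decode (map tape_read ts ! v) = top_of (s v)"
    using 1 in\<Sigma> code_less inv_into_f_f[of code \<Sigma>] code
    by (cases "s v") (auto simp: decode_def bij_betw_def)
qed

lemma step_noop:
  assumes "K \<in> Q" "K' \<in> Q" "trans (index K) (map tape_read ts) = (index K', noop (map tape_read ts))"
  shows "tm_step machine (index K, ts) = (index K', ts)"
proof -
  have "map2 tape_act (noop (map tape_read ts)) ts = ts"
    by (rule nth_equalityI) (simp_all add: noop_def)
  then show ?thesis using assms index_in[of K]
    by (simp add: tm_step_def machine_def)
qed

lemma step_one:
  assumes "K \<in> Q" "K' \<in> Q" "length ts = m" "v < m"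
    "trans (index K) (map tape_read ts) = (index K', (noop (map tape_read ts))[v := x])"
  shows "tm_step machine (index K, ts) = (index K', ts[v := tape_act x (ts ! v)])"
proof -
  have "map2 tape_act ((noop (map tape_read ts))[v := x]) ts = ts[v := tape_act x (ts ! v)]"
    using assms(3,4) by (intro nth_equalityI) (auto simp: noop_def nth_list_update)
  then show ?thesis using assms index_in[of K]
    by (simp add: tm_step_def machine_def)
qed

lemma rep_upd: "rep s ts \<Longrightarrow> stack_tape code xs tp \<Longrightarrow> rep (s(v := xs)) (ts[v := tp])"
  by (auto simp: rep_def nth_list_update)

text \<open>\<open>K\<close> is arbitrary because a subcommand runs in front of whatever remains to
  be done: \<open>d # K\<close> for the first half of \<open>Seq\<close>, the loop itself for a loop
  body. The inclusion in \<open>Q\<close> makes all control lists met on the way states of the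
  machine.\<close>

lemma simulate:
  assumes "run c s t s'"
  shows "com_ok \<Sigma> m c \<Longrightarrow> valid \<Sigma> s \<Longrightarrow> rep s ts \<Longrightarrow> insert K (conts \<Sigma> c K) \<subseteq> Q \<Longrightarrow>
    \<exists>ts'. reaches t (index (c # K), ts) (index K, ts') \<and> rep s' ts'"
  using assms
proof (induction arbitrary: ts K rule: run.induct)
  case (run_Skip s)
  have "reaches 1 (index (Skip # K), ts) (index K, ts)"
    unfolding One_nat_def using run_Skip
    by (intro reaches_Suc[OF step_noop reaches_0]) (auto simp: state_of_def)
  then show ?case using run_Skip by blast
next
  case (run_Push v a s)
  define ts1 where "ts1 = ts[v := tape_act (tape_read (ts ! v), MoveLeft) (ts ! v)]"
  define ts2 where "ts2 = ts1[v := tape_act (code a, MoveNone) (ts1 ! v)]"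
  have len: "length ts = m" "v < m" "length ts1 = m" "a \<in> \<Sigma>"
    using run_Push by (auto simp: rep_def ts1_def)
  have "reaches (Suc (Suc 0)) (index (Push v a # K), ts) (index K, ts2)"
  proof (intro reaches_Suc[OF _ reaches_Suc[OF _ reaches_0]])
    show "tm_step machine (index (Push v a # K), ts) = (index (Put v a # K), ts1)"
      using run_Push(4) len unfolding ts1_def by (intro step_one) (auto simp: state_of_def)
    show "tm_step machine (index (Put v a # K), ts1) = (index K, ts2)"
      using run_Push(4) len unfolding ts2_def by (intro step_one) (auto simp: state_of_def)
  qed
  moreover have "ts2 = ts[v := tape_act (code a, MoveNone)
      (tape_act (tape_read (ts ! v), MoveLeft) (ts ! v))]"
    using len by (simp add: ts1_def ts2_def)
  then have "rep (s(v := a # s v)) ts2"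
    using run_Push(3) len by (auto intro!: rep_upd stack_tape_push simp: rep_def)
  ultimately show ?case by (metis numeral_2_eq_2)
next
  case (run_Pop v s)
  have len: "length ts = m" "v < m" using run_Pop by (auto simp: rep_def)
  note rd = read_rep(3)[OF run_Pop(3) len(2) run_Pop(2)]
  define ts1 where "ts1 = ts[v := tape_act (tape_read (ts ! v),
    if map tape_read ts ! v = 0 then MoveNone else MoveRight) (ts ! v)]"
  have "reaches 1 (index (Pop v # K), ts) (index K, ts1)"
    unfolding One_nat_def using run_Pop(4) len unfolding ts1_def
    by (intro reaches_Suc[OF step_one reaches_0]) (auto simp: state_of_def)
  moreover have "rep (s(v := tl (s v))) ts1"
  proof (cases "s v")
    case Nil
    then have "ts1 = ts" "s(v := tl (s v)) = s"
      using rd len tape_act_read[of "ts ! v"] by (auto simp: ts1_def)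
    then show ?thesis using run_Pop by simp
  next
    case (Cons a x)
    then have "ts1 = ts[v := tape_act (tape_read (ts ! v), MoveRight) (ts ! v)]"
      using rd by (simp add: ts1_def)
    moreover have "stack_tape code (a # x) (ts ! v)" using run_Pop(3) len Cons by (auto simp: rep_def)
    ultimately show ?thesis using Cons run_Pop(3) by (auto intro!: rep_upd stack_tape_pop)
  qed
  ultimately show ?case by blast
next
  case (run_Seq c s t s' d t' s'')
  have v': "valid \<Sigma> s'" using run_valid[OF run_Seq(1)] run_Seq by auto
  have Q: "Seq c d # K \<in> Q" "c # d # K \<in> Q" "d # K \<in> Q"
    "insert (d # K) (conts \<Sigma> c (d # K)) \<subseteq> Q" "insert K (conts \<Sigma> d K) \<subseteq> Q"
    using run_Seq(8) conts_self[of c "d # K" \<Sigma>] conts_self[of d K \<Sigma>] by auto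
  obtain ts1 where 1: "reaches t (index (c # d # K), ts) (index (d # K), ts1)" "rep s' ts1"
    using run_Seq(3)[OF _ run_Seq(6,7) Q(4)] run_Seq(5) by auto
  obtain ts2 where 2: "reaches t' (index (d # K), ts1) (index K, ts2)" "rep s'' ts2"
    using run_Seq(4)[OF _ v' 1(2) Q(5)] run_Seq(5) by auto
  have "reaches (Suc (t + t')) (index (Seq c d # K), ts) (index K, ts2)"
    using Q by (intro reaches_Suc[OF step_noop reaches_trans[OF 1(1) 2(1)]])
      (auto simp: state_of_def)
  then show ?case using 2(2) by auto
next
  case (run_Case f s v t s')
  have len: "v < m" using run_Case by auto
  have x: "top_of (s v) \<in> insert None (Some ` \<Sigma>)" "set_option (top_of (s v)) \<subseteq> \<Sigma>"
    using valid_top[OF run_Case(4), of v] by (auto split: option.split, cases "top_of (s v)", auto)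
  have "conts \<Sigma> (f (top_of (s v))) K \<subseteq> conts \<Sigma> (Case v f) K"
    unfolding conts.simps using UN_upper[OF x(1), of "\<lambda>x. conts \<Sigma> (f x) K"] by blast
  then have Q: "Case v f # K \<in> Q" "insert K (conts \<Sigma> (f (top_of (s v))) K) \<subseteq> Q"
    "f (top_of (s v)) # K \<in> Q"
    using run_Case(6) conts_self[of "f (top_of (s v))" K \<Sigma>] conts_self[of "Case v f" K \<Sigma>]
    by blast+
  obtain ts1 where 1: "reaches t (index (f (top_of (s v)) # K), ts) (index K, ts1)" "rep s' ts1"
    using run_Case(2)[OF _ run_Case(4,5) Q(2)] run_Case(3) x by auto
  have "reaches (Suc t) (index (Case v f # K), ts) (index K, ts1)"
    using Q read_rep(2)[OF run_Case(5) len run_Case(4)]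
    by (intro reaches_Suc[OF step_noop 1(1)]) (auto simp: state_of_def)
  then show ?case using 1(2) by auto
next
  case (run_While_empty s v c)
  have "reaches 1 (index (While v c # K), ts) (index K, ts)"
    unfolding One_nat_def
    using run_While_empty read_rep(3)[OF run_While_empty(4) _ run_While_empty(3), of v]
    by (intro reaches_Suc[OF step_noop reaches_0]) (auto simp: state_of_def)
  then show ?case using run_While_empty by blast
next
  case (run_While s v c t s' t' s'')
  have v': "valid \<Sigma> s'" using run_valid[OF run_While(2)] run_While by auto
  let ?W = "While v c # K"
  have Q: "?W \<in> Q" "c # ?W \<in> Q" "insert ?W (conts \<Sigma> c ?W) \<subseteq> Q"
    using run_While(9) conts_self[of c ?W \<Sigma>] by auto
  obtain ts1 where 1: "reaches t (index (c # ?W), ts) (index ?W, ts1)" "rep s' ts1"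
    using run_While(4)[OF _ run_While(7,8) Q(3)] run_While(6) by auto
  obtain ts2 where 2: "reaches t' (index ?W, ts1) (index K, ts2)" "rep s'' ts2"
    using run_While(5)[OF run_While(6) v' 1(2) run_While(9)] by auto
  have "reaches (Suc (t + t')) (index ?W, ts) (index K, ts2)"
    using Q read_rep(3)[OF run_While(8) _ run_While(7), of v] run_While(1,6)
    by (intro reaches_Suc[OF step_noop reaches_trans[OF 1(1) 2(1)]])
      (auto simp: state_of_def)
  then show ?case using 2(2) by (intro exI[of _ ts2]) simp
qed

lemma decide:
  assumes "run c0 s t s'" "valid \<Sigma> s" "rep s ts" "init_config machine x = (index [c0], ts)"
  shows "tm_state_after machine x (Suc t) =
    (if s' r = [] then rej_state machine else acc_state machine)"
proof -
  obtain ts' where 1: "reaches t (index [c0], ts) (index [], ts')" "rep s' ts'"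
    using simulate[OF assms(1) ok0 assms(2,3) Q0] by auto
  have "valid \<Sigma> s'" using run_valid[OF assms(1) ok0 assms(2)] .
  note rd = read_rep(3)[OF 1(2) r this]
  have "[] \<in> Q" using Q0 by auto
  then have "fst (tm_step machine (index [], ts')) = (if s' r = [] then card Q + 1 else card Q)"
    using rd index_in[of "[]"] by (simp add: tm_step_def machine_def)
  then show ?thesis
    using 1(1) unfolding tm_state_after_def assms(4) reaches_def
    by (auto simp: machine_def[THEN arg_cong[where f = acc_state]]
        machine_def[THEN arg_cong[where f = rej_state]])
qed

end

text \<open>\<open>f\<close> embeds the input alphabet into the working alphabet, so the tape code
  of the inputs is \<open>code \<circ> f\<close>. The polynomial grows by 1 for the final test of
  register \<open>r\<close>.\<close>

theorem in_P_if_run: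
  assumes "finite \<Sigma>" "com_ok \<Sigma> m c" "r < m" "0 < m" "inj_on f A" "f ` A \<subseteq> \<Sigma>" "L \<subseteq> lists A"
    and run: "\<And>w. w \<in> lists A \<Longrightarrow>
      \<exists>t s'. t \<le> poly p (length w) \<and> run c ((\<lambda>_. [])(0 := map f w)) t s' \<and> (s' r \<noteq> [] \<longleftrightarrow> w \<in> L)"
  shows "in_P A L"
proof -
  obtain code where code: "bij_betw code \<Sigma> {1..card \<Sigma>}"
    using ex_bij_betw_finite_nat[OF assms(1)] finite_same_card_bij[of \<Sigma> "{1..card \<Sigma>}"] assms(1)
    by auto
  define Q where "Q = insert [] (conts \<Sigma> c [])"
  have "finite Q" using assms(1) by (simp add: Q_def finite_conts)
  then obtain index where index: "bij_betw index Q {..<card Q}"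
    using finite_same_card_bij[of Q "{..<card Q}"] by auto
  interpret simulation \<Sigma> code m Q index r c
    using assms code index \<open>finite Q\<close> by unfold_locales (auto simp: Q_def)
  have sub: "set (map f w) \<subseteq> \<Sigma>" if "w \<in> lists A" for w
    using that image_subset_iff[THEN iffD1, OF assms(6)] by auto
  have "\<exists>t\<le>poly (p + 1) (length w). tm_state_after machine (map (code \<circ> f) w) t =
     (if w \<in> L then acc_state machine else rej_state machine)" if w: "w \<in> lists A" for w
  proof -
    obtain t s' where t: "t \<le> poly p (length w)" "run c ((\<lambda>_. [])(0 := map f w)) t s'"
      "s' r \<noteq> [] \<longleftrightarrow> w \<in> L" using run[OF w] by auto
    let ?ts = "input_tape (map (code \<circ> f) w) # replicate (m - 1) blank_tape"
    have 1: "rep ((\<lambda>_. [])(0 := map f w)) ?ts"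
      using assms(4) by (auto simp: rep_def nth_Cons stack_tape_def input_tape_def blank_tape_def
          split: nat.split)
    have 2: "valid \<Sigma> ((\<lambda>_. [])(0 := map f w))" using sub[OF w] by (auto simp: valid_def)
    show ?thesis using decide[OF t(2) 2 1, of "map (code \<circ> f) w"] t(1,3)
      by (intro exI[of _ "Suc t"]) (auto simp: init_config_def machine_def)
  qed
  moreover have "inj_on (code \<circ> f) A"
    using code assms(5,6) by (meson bij_betw_imp_inj_on comp_inj_on inj_on_subset)
  moreover have "(code \<circ> f) ` A \<subseteq> {1..<num_symbols machine}"
  proof -
    have "code (f a) \<in> {1..<Suc (card \<Sigma>)}" if "a \<in> A" for a
      using code_less[of "f a"] assms(6) that by auto
    then show ?thesis by (auto simp: machine_def)
  qed
  moreover have "finite A" using assms(1,5,6) finite_imageD finite_subset by blast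
  ultimately show ?thesis unfolding in_P_def using wf_machine assms(7) by blast
qed

section \<open>Polynomial-time functions on words\<close>

lemma poly_nat_mono: "x \<le> y \<Longrightarrow> poly p x \<le> poly (p :: nat poly) y"
  by (induction p) (auto intro!: add_mono mult_mono)

definition runs :: "'c com \<Rightarrow> 'c store \<Rightarrow> nat \<Rightarrow> 'c store \<Rightarrow> bool" where
  "runs c s T s' \<longleftrightarrow> (\<exists>t\<le>T. run c s t s')"

lemma runsI: "run c s t s' \<Longrightarrow> t \<le> T \<Longrightarrow> runs c s T s'"
  by (auto simp: runs_def)

lemma runs_mono: "runs c s T s' \<Longrightarrow> T \<le> T' \<Longrightarrow> runs c s T' s'"
  by (meson order_trans runs_def)

lemma runs_Seq: "runs c s T s' \<Longrightarrow> runs d s' T' s'' \<Longrightarrow> runs (Seq c d) s (1 + T + T') s''"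
  unfolding runs_def using run_Seq by (metis add_mono add_le_mono le_refl)

lemma runs_Case: "runs (f (top_of (s v))) s T s' \<Longrightarrow> runs (Case v f) s (1 + T) s'"
  unfolding runs_def using run_Case[of f s v] by (metis add_left_mono)

lemma runs_While: "s v \<noteq> [] \<Longrightarrow> runs c s T s' \<Longrightarrow> runs (While v c) s' T' s'' \<Longrightarrow>
    runs (While v c) s (1 + T + T') s''"
  unfolding runs_def using run_While[of s v c] by (metis add_mono le_refl)

section \<open>Elementary loops on stacks\<close>

definition for_top :: "nat \<Rightarrow> ('c \<Rightarrow> 'c com) \<Rightarrow> 'c com" where
  "for_top v f = Case v (\<lambda>x. case x of None \<Rightarrow> Skip | Some a \<Rightarrow> Seq (Pop v) (f a))"

definition move_rev :: "nat \<Rightarrow> nat \<Rightarrow> 'c com" where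
  "move_rev v w = While v (for_top v (Push w))"

text \<open>A stack can be read only by destroying it. A copy is therefore made by moving the stack
  to a scratch register and from there to two registers at once, which restores both the order and
  the original.\<close>

definition move_rev2 :: "nat \<Rightarrow> nat \<Rightarrow> nat \<Rightarrow> 'c com" where
  "move_rev2 v w w' = While v (for_top v (\<lambda>a. Seq (Push w a) (Push w' a)))"

definition clear :: "nat \<Rightarrow> 'c com" where
  "clear v = While v (Pop v)"

lemma runs_for_top:
  "s v = a # x \<Longrightarrow> runs (f a) (s(v := x)) T s' \<Longrightarrow> runs (for_top v f) s (3 + T) s'"
proof -
  assume a: "s v = a # x" "runs (f a) (s(v := x)) T s'"
  have "runs (Pop v) s 1 (s(v := x))" using run_Pop[of v s] a(1) by (auto intro: runsI)
  from runs_Seq[OF this a(2)] have "runs (for_top v f) s (1 + (1 + 1 + T)) s'"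
    unfolding for_top_def by (intro runs_Case) (simp add: a(1))
  then show ?thesis by (rule runs_mono) simp
qed

text \<open>Each symbol costs 1 for the loop test, 3 for \<open>for_top\<close>
  (\<open>Case\<close>, \<open>Seq\<close>, \<open>Pop\<close>) and 2 for \<open>Push\<close>; the
  last test adds 1. With a second \<open>Push\<close> and its \<open>Seq\<close>, 6 becomes 9 in
  \<open>runs_move_rev2\<close>.\<close>

lemma runs_move_rev:
  "v \<noteq> w \<Longrightarrow> runs (move_rev v w) s (6 * length (s v) + 1) (s(v := [], w := rev (s v) @ s w))"
proof (induction "s v" arbitrary: s)
  case Nil
  then have e: "s(v := [], w := rev (s v) @ s w) = s" by (auto simp: fun_eq_iff)
  show ?case unfolding move_rev_def e using Nil by (intro runsI[OF run_While_empty]) auto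
next
  case (Cons a x)
  let ?s = "s(v := x, w := a # s w)"
  have "runs (Push w a) (s(v := x)) 2 ?s"
    using run_Push[of w a "s(v := x)"] Cons(3) by (auto intro: runsI)
  note 1 = runs_for_top[of s v a x "Push w", OF _ this]
  have "runs (move_rev v w) ?s (6 * length x + 1) (?s(v := [], w := rev (?s v) @ ?s w))"
    using Cons(1)[of ?s] Cons(3) by simp
  note 2 = runs_While[OF _ 1 this[unfolded move_rev_def]]
  have "?s(v := [], w := rev (?s v) @ ?s w) = s(v := [], w := rev (s v) @ s w)"
    using Cons(2,3) by (auto simp: fun_eq_iff simp flip: Cons(2))
  moreover have "1 + (3 + 2) + (6 * length x + 1) = 6 * length (s v) + 1"
    using Cons(2) by (simp flip: Cons(2))
  ultimately show ?case using 2 Cons(2) by (metis list.distinct(1) move_rev_def)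
qed

lemma runs_move_rev2:
  "v \<noteq> w \<Longrightarrow> v \<noteq> w' \<Longrightarrow> w \<noteq> w' \<Longrightarrow> runs (move_rev2 v w w') s (9 * length (s v) + 1)
    (s(v := [], w := rev (s v) @ s w, w' := rev (s v) @ s w'))"
proof (induction "s v" arbitrary: s)
  case Nil
  then have e: "s(v := [], w := rev (s v) @ s w, w' := rev (s v) @ s w') = s"
    by (auto simp: fun_eq_iff)
  show ?case unfolding move_rev2_def e using Nil by (intro runsI[OF run_While_empty]) auto
next
  case (Cons a x)
  let ?s1 = "s(v := x, w := a # s w)"
  let ?s = "s(v := x, w := a # s w, w' := a # s w')"
  have "runs (Push w a) (s(v := x)) 2 ?s1"
    using run_Push[of w a "s(v := x)"] Cons by (auto intro: runsI)
  moreover have "runs (Push w' a) ?s1 2 ?s"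
    using run_Push[of w' a ?s1] Cons by (auto intro: runsI)
  ultimately have "runs (Seq (Push w a) (Push w' a)) (s(v := x)) 5 ?s"
    using runs_Seq by fastforce
  note 1 = runs_for_top[of s v a x "\<lambda>a. Seq (Push w a) (Push w' a)", OF _ this]
  have "runs (move_rev2 v w w') ?s (9 * length x + 1)
      (?s(v := [], w := rev (?s v) @ ?s w, w' := rev (?s v) @ ?s w'))"
    using Cons(1)[of ?s] Cons(3-5) by simp
  note 2 = runs_While[OF _ 1 this[unfolded move_rev2_def]]
  have "?s(v := [], w := rev (?s v) @ ?s w, w' := rev (?s v) @ ?s w') =
      s(v := [], w := rev (s v) @ s w, w' := rev (s v) @ s w')"
    using Cons(2-5) by (auto simp: fun_eq_iff simp flip: Cons(2))
  moreover have "1 + (3 + 5) + (9 * length x + 1) = 9 * length (s v) + 1"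
    using Cons(2) by (simp flip: Cons(2))
  ultimately show ?case using 2 Cons(2) by (metis list.distinct(1) move_rev2_def)
qed

lemma runs_clear: "runs (clear v) s (2 * length (s v) + 1) (s(v := []))"
proof (induction "s v" arbitrary: s)
  case Nil
  then have e: "s(v := []) = s" by (auto simp: fun_eq_iff)
  show ?case unfolding clear_def e using Nil by (intro runsI[OF run_While_empty]) auto
next
  case (Cons a x)
  have "runs (Pop v) s 1 (s(v := x))" using run_Pop[of v s] by (auto simp flip: Cons(2) intro: runsI)
  moreover have "runs (While v (Pop v)) (s(v := x)) (2 * length x + 1) (s(v := []))"
    using Cons(1)[of "s(v := x)"] by (simp add: clear_def)
  ultimately have "runs (While v (Pop v)) s (1 + 1 + (2 * length x + 1)) (s(v := []))"
    by (rule runs_While[rotated]) (simp flip: Cons(2))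
  then show ?case by (simp add: clear_def flip: Cons(2))
qed

section \<open>Polynomial-time functions of several words\<close>

definition total_length :: "'c list list \<Rightarrow> nat" where
  "total_length xs = sum_list (map length xs)"

lemma total_length_simps [simp]: "total_length [] = 0"
  "total_length (x # xs) = length x + total_length xs"
  by (simp_all add: total_length_def)

lemma length_le_total: "x \<in> set xs \<Longrightarrow> length x \<le> total_length xs"
  by (simp add: total_length_def member_le_sum_list)

text \<open>\<open>tok\<close> is a letter with several duties: the truth value
  \<open>[tok]\<close>, the digit of unary numbers, the flag of a successful computation and the
  separator of the two input words.\<close>

locale alphabet =
  fixes \<Sigma> :: "'c set" and tok :: 'c
  assumes finite_alphabet: "finite \<Sigma>" and tok: "tok \<in> \<Sigma>"
begin

definition ok :: "'c com \<Rightarrow> bool" where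
  "ok c \<longleftrightarrow> (\<exists>m. com_ok \<Sigma> m c)"

lemma ok_simps [simp]: "ok Skip" "ok (Push v a) \<longleftrightarrow> a \<in> \<Sigma>" "ok (Pop v)"
  by (auto simp: ok_def)

lemma ok_Seq [simp]: "ok (Seq c d) \<longleftrightarrow> ok c \<and> ok d"
  unfolding ok_def using com_ok_mono by (metis com_ok.simps(5) nat_le_linear)

lemma ok_While [simp]: "ok (While v c) \<longleftrightarrow> ok c"
proof
  assume "ok c"
  then obtain m where "com_ok \<Sigma> m c" by (auto simp: ok_def)
  then have "com_ok \<Sigma> (max m (Suc v)) (While v c)" using com_ok_mono[of \<Sigma> m c] by auto
  then show "ok (While v c)" unfolding ok_def by blast
qed (auto simp: ok_def)

lemma ok_for_top [simp]:
  assumes "\<And>a. a \<in> \<Sigma> \<Longrightarrow> ok (f a)"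
  shows "ok (for_top v f)"
proof -
  obtain m where m: "\<And>a. a \<in> \<Sigma> \<Longrightarrow> com_ok \<Sigma> (m a) (f a)"
    using assms unfolding ok_def by metis
  define M where "M = Suc v + (\<Sum>a\<in>\<Sigma>. m a)"
  have "com_ok \<Sigma> M (f a)" if "a \<in> \<Sigma>" for a
    using com_ok_mono[OF m[OF that]] member_le_sum[OF that, of m] finite_alphabet
    by (simp add: M_def trans_le_add2)
  then have "com_ok \<Sigma> M (for_top v f)" by (auto simp: for_top_def M_def split: option.split)
  then show ?thesis unfolding ok_def by blast
qed

lemma ok_moves [simp]: "ok (move_rev v w)" "ok (move_rev2 v w w')" "ok (clear v)"
  by (simp_all add: move_rev_def move_rev2_def clear_def)

definition args :: "nat \<Rightarrow> 'c list list \<Rightarrow> bool" where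
  "args n xs \<longleftrightarrow> length xs = n \<and> (\<forall>x\<in>set xs. set x \<subseteq> \<Sigma>)"

text \<open>The final store is prescribed completely: arguments are restored and scratch registers
  empty again. Only so can programs be put in sequence and inside loops.\<close>

definition computes :: "'c com \<Rightarrow> nat poly \<Rightarrow> nat list \<Rightarrow> nat \<Rightarrow> nat \<Rightarrow>
    ('c list list \<Rightarrow> 'c list) \<Rightarrow> bool" where
  "computes c p vs r B f \<longleftrightarrow> ok c \<and> (\<forall>s. valid \<Sigma> s \<and> (\<forall>v\<ge>B. s v = []) \<and> s r = [] \<longrightarrow>
     runs c s (poly p (total_length (map s vs))) (s(r := f (map s vs))))"

lemma computesI:
  assumes "ok c" "\<And>s. valid \<Sigma> s \<Longrightarrow> \<forall>v\<ge>B. s v = [] \<Longrightarrow> s r = [] \<Longrightarrow>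
     runs c s (poly p (total_length (map s vs))) (s(r := f (map s vs)))"
  shows "computes c p vs r B f"
  using assms by (simp add: computes_def)

lemma computesD:
  assumes "computes c p vs r B f"
  shows "ok c" "\<And>s. valid \<Sigma> s \<Longrightarrow> \<forall>v\<ge>B. s v = [] \<Longrightarrow> s r = [] \<Longrightarrow>
     runs c s (poly p (total_length (map s vs))) (s(r := f (map s vs)))"
  using assms by (simp_all add: computes_def)

text \<open>The argument registers, the empty result register and the scratch registers, all those
  from \<open>B\<close> on, are arbitrary, so that code can be reused without relocating it.\<close>

definition polytime :: "nat \<Rightarrow> ('c list list \<Rightarrow> 'c list) \<Rightarrow> bool" where
  "polytime n f \<longleftrightarrow> (\<forall>vs r B. length vs = n \<and> (\<forall>v\<in>set vs. v < B) \<and> r < B \<and> r \<notin> set vs \<longrightarrow>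
     (\<exists>c p. computes c p vs r B f))"

lemma polytimeI:
  assumes "\<And>vs r B. length vs = n \<Longrightarrow> \<forall>v\<in>set vs. v < B \<Longrightarrow> r < B \<Longrightarrow> r \<notin> set vs \<Longrightarrow>
     \<exists>c p. computes c p vs r B f"
  shows "polytime n f"
  using assms by (simp add: polytime_def)

lemma polytimeD:
  assumes "polytime n f" "length vs = n" "\<forall>v\<in>set vs. v < B" "r < B" "r \<notin> set vs"
  shows "\<exists>c p. computes c p vs r B f"
  using assms by (simp add: polytime_def)

lemma valid_args: "valid \<Sigma> s \<Longrightarrow> args (length vs) (map s vs)"
  by (auto simp: valid_def args_def)

lemma polytime_cong:
  assumes "polytime n f" "\<And>xs. args n xs \<Longrightarrow> f xs = g xs"
  shows "polytime n g"
proof (rule polytimeI)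
  fix vs :: "nat list" and r B :: nat assume a: "length vs = n" "\<forall>v\<in>set vs. v < B" "r < B" "r \<notin> set vs"
  obtain c p where "computes c p vs r B f"
    using polytimeD[OF assms(1) a] by blast
  note c = computesD[OF this]
  have "runs c s (poly p (total_length (map s vs))) (s(r := g (map s vs)))"
    if "valid \<Sigma> s" "\<forall>v\<ge>B. s v = []" "s r = []" for s
    using c(2)[OF that] assms(2) valid_args[OF that(1), of vs] a(1) by simp
  note runs = this
  have "ok (c)" by (simp add: c(1))
  from computesI[where f = "g", OF this runs]
  show "\<exists>c p. computes c p vs r B g" by blast
qed

lemma runs_valid: "runs c s T s' \<Longrightarrow> ok c \<Longrightarrow> valid \<Sigma> s \<Longrightarrow> valid \<Sigma> s'"
  unfolding runs_def ok_def using run_valid by blast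

text \<open>The length of the output is at most the running time. One run with the arguments in
  \<open>[0..<n]\<close> and the result in \<open>n\<close> is enough, since the bound does not
  mention registers.\<close>

lemma polytime_bound:
  assumes "polytime n f"
  obtains q where "\<And>xs. args n xs \<Longrightarrow> length (f xs) \<le> poly q (total_length xs)"
    "\<And>xs. args n xs \<Longrightarrow> set (f xs) \<subseteq> \<Sigma>"
proof -
  obtain c p where "computes c p [0..<n] n (Suc n) f"
    using polytimeD[OF assms, of "[0..<n]" "Suc n" n] by auto
  note c = computesD[OF this]
  have "length (f xs) \<le> poly p (total_length xs) \<and> set (f xs) \<subseteq> \<Sigma>" if xs: "args n xs" for xs
  proof -
    define s where "s = (\<lambda>v. if v < n then xs ! v else [])"
    have len: "length xs = n" using xs by (simp add: args_def)
    have v: "valid \<Sigma> s" using xs by (auto simp: valid_def s_def args_def)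
    have m: "map s [0..<n] = xs" using len by (intro nth_equalityI) (auto simp: s_def)
    have 1: "runs c s (poly p (total_length xs)) (s(n := f xs))"
      using c(2)[of s] v by (simp add: m) (simp add: s_def)
    then have "set (f xs) \<subseteq> \<Sigma>" using runs_valid[OF 1 c(1) v]
      unfolding valid_def by (metis fun_upd_same)
    moreover have "length (f xs) \<le> poly p (total_length xs)"
      using 1 run_length[of c s _ "s(n := f xs)" n] by (auto simp: runs_def s_def) (meson order_trans)
    ultimately show ?thesis by blast
  qed
  then show ?thesis using that by blast
qed

text \<open>The value of \<open>g\<close> is kept in register \<open>B\<close>, both programs use
  scratch registers from \<open>Suc B\<close> on, and \<open>B\<close> is cleared at the end. By
  \<open>polytime_bound\<close> the second program gets arguments of polynomial length.\<close>

lemma polytime_let: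
  assumes "polytime n g" "polytime (Suc n) f"
  shows "polytime n (\<lambda>xs. f (g xs # xs))"
proof (rule polytimeI)
  fix vs :: "nat list" and r B :: nat assume a: "length vs = n" "\<forall>v\<in>set vs. v < B" "r < B" "r \<notin> set vs"
  obtain c1 p1 where "computes c1 p1 vs B (Suc B) g"
    using polytimeD[OF assms(1), of vs "Suc B" B] a by fastforce
  note c1 = computesD[OF this]
  obtain c2 p2 where "computes c2 p2 (B # vs) r (Suc B) f"
    using polytimeD[OF assms(2), of "B # vs" "Suc B" r] a by fastforce
  note c2 = computesD[OF this]
  obtain q where q: "\<And>xs. args n xs \<Longrightarrow> length (g xs) \<le> poly q (total_length xs)"
    using polytime_bound[OF assms(1)] by metis
  define p where "p = p1 + pcompose p2 ([:0, 1:] + q) + 2 * q + 3"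
  have "runs (Seq c1 (Seq c2 (clear B))) s (poly p (total_length (map s vs)))
      (s(r := f (g (map s vs) # map s vs)))"
    if s: "valid \<Sigma> s" "\<forall>v\<ge>B. s v = []" "s r = []" for s
  proof -
    let ?x = "map s vs" and ?n = "total_length (map s vs)"
    define s1 where "s1 = s(B := g ?x)"
    have 1: "runs c1 s (poly p1 ?n) s1" unfolding s1_def using s by (intro c1(2)) auto
    have v1: "valid \<Sigma> s1" using runs_valid[OF 1 c1(1) s(1)] .
    have "B \<notin> set vs" using a(2) by auto
    then have m: "map s1 (B # vs) = g ?x # ?x" by (auto simp: s1_def)
    define s2 where "s2 = s1(r := f (g ?x # ?x))"
    have 2: "runs c2 s1 (poly p2 (length (g ?x) + ?n)) s2"
    proof -
      have "\<forall>v\<ge>Suc B. s1 v = []" "s1 r = []" using s a(3) by (auto simp: s1_def)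
      from c2(2)[OF v1 this, unfolded m] show ?thesis by (simp add: s2_def)
    qed
    have 3: "runs (clear B) s2 (2 * length (g ?x) + 1) (s2(B := []))"
      using runs_clear[of B s2] a(3) by (simp add: s2_def s1_def)
    have e: "s2(B := []) = s(r := f (g ?x # ?x))"
      using s(2) a(3) by (auto simp: s2_def s1_def fun_eq_iff)
    have lg: "length (g ?x) \<le> poly q ?n" using q[OF valid_args[OF s(1), of vs, unfolded a(1)]] .
    then have "poly p2 (length (g ?x) + ?n) \<le> poly p2 (?n + poly q ?n)"
      by (intro poly_nat_mono) auto
    then show ?thesis
      using runs_Seq[OF 1 runs_Seq[OF 2 3]] lg unfolding e
      by (elim runs_mono) (simp add: p_def poly_pcompose)
  qed
  note runs = this
  have "ok (Seq c1 (Seq c2 (clear B)))" by (simp add: c1(1) c2(1))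
  from computesI[where f = "(\<lambda>xs. f (g xs # xs))", OF this runs]
  show "\<exists>c p. computes c p vs r B (\<lambda>xs. f (g xs # xs))" by blast
qed

lemma total_length_nth:
  assumes "\<forall>i\<in>set is. i < length xs"
  shows "total_length (map ((!) xs) is) \<le> length is * total_length xs"
  using assms
proof (induction "is")
  case (Cons i "is")
  then show ?case using length_le_total[of "xs ! i" xs] by auto
qed auto

text \<open>No data are moved: argument registers may repeat in \<open>polytime\<close>, so the same
  program is taken for another list of registers. Repetition enlarges the total length at most by
  the factor \<open>length is\<close>.\<close>

lemma polytime_reindex:
  assumes "polytime (length is) f" "\<forall>i\<in>set is. i < n"
  shows "polytime n (\<lambda>xs. f (map ((!) xs) is))"
proof (rule polytimeI)
  fix vs :: "nat list" and r B :: nat assume a: "length vs = n" "\<forall>v\<in>set vs. v < B" "r < B" "r \<notin> set vs"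
  let ?vs = "map ((!) vs) is"
  have sub: "set ?vs \<subseteq> set vs" using assms(2) a(1) by auto
  obtain c p where "computes c p ?vs r B f"
    using polytimeD[OF assms(1), of ?vs B r] a sub by fastforce
  note c = computesD[OF this]
  have "runs c s (poly (pcompose p [:0, length is:]) (total_length (map s vs)))
      (s(r := f (map ((!) (map s vs)) is)))"
    if s: "valid \<Sigma> s" "\<forall>v\<ge>B. s v = []" "s r = []" for s
  proof -
    have m: "map s ?vs = map ((!) (map s vs)) is" using assms(2) a(1) by auto
    have "total_length (map s ?vs) \<le> length is * total_length (map s vs)"
      unfolding m using assms(2) a(1) by (intro total_length_nth) auto
    from runs_mono[OF c(2)[OF s] poly_nat_mono[OF this]] show ?thesis
      unfolding m by (simp add: poly_pcompose mult.commute del: map_map)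
  qed
  note runs = this
  have "ok (c)" by (simp add: c(1))
  from computesI[where f = "(\<lambda>xs. f (map ((!) xs) is))", OF this runs]
  show "\<exists>c p. computes c p vs r B (\<lambda>xs. f (map ((!) xs) is))" by blast
qed

lemma polytime_nil: "polytime n (\<lambda>_. [])"
proof (rule polytimeI)
  fix vs :: "nat list" and r B :: nat
  have "runs Skip s (poly 1 (total_length (map s vs))) (s(r := []))" if "s r = []" for s :: "'c store"
  proof -
    have "s(r := []) = s" using that by auto
    then show ?thesis using run_Skip[of s] by (auto intro: runsI)
  qed
  note runs = this
  have "ok (Skip)" by simp
  from computesI[where f = "(\<lambda>_. [])", OF this runs]
  show "\<exists>c p. computes c p vs r B (\<lambda>_. [])" by blast
qed

lemma polytime_cons:
  assumes "polytime n f" "a \<in> \<Sigma>"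
  shows "polytime n (\<lambda>xs. a # f xs)"
proof (rule polytimeI)
  fix vs :: "nat list" and r B :: nat assume a: "length vs = n" "\<forall>v\<in>set vs. v < B" "r < B" "r \<notin> set vs"
  obtain c p where "computes c p vs r B f"
    using polytimeD[OF assms(1) a] by blast
  note c = computesD[OF this]
  have "runs (Seq c (Push r a)) s (poly (p + 3) (total_length (map s vs)))
      (s(r := a # f (map s vs)))"
    if s: "valid \<Sigma> s" "\<forall>v\<ge>B. s v = []" "s r = []" for s
  proof -
    have "runs (Push r a) (s(r := f (map s vs))) 2 (s(r := a # f (map s vs)))"
      using run_Push[of r a "s(r := f (map s vs))"] by (auto intro: runsI)
    from runs_Seq[OF c(2)[OF s] this] show ?thesis by (elim runs_mono) simp
  qed
  note runs = this
  have "ok (Seq c (Push r a))" by (simp add: c(1) assms(2))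
  from computesI[where f = "(\<lambda>xs. a # f xs)", OF this runs]
  show "\<exists>c p. computes c p vs r B (\<lambda>xs. a # f xs)" by blast
qed

lemma polytime_nth:
  assumes "i < n"
  shows "polytime n (\<lambda>xs. xs ! i)"
proof (rule polytimeI)
  fix vs :: "nat list" and r B :: nat assume a: "length vs = n" "\<forall>v\<in>set vs. v < B" "r < B" "r \<notin> set vs"
  let ?v = "vs ! i"
  have d: "?v \<in> set vs" "?v < B" "?v \<noteq> r" using a assms nth_mem[of i vs] by auto
  let ?c = "Seq (move_rev ?v B) (move_rev2 B ?v r)"
  \<comment> \<open>The two moves cost 6 and 9 steps per symbol plus 1 each, and \<open>Seq\<close>
    costs 1.\<close>
  have "runs ?c s (poly [:3, 15:] (total_length (map s vs))) (s(r := map s vs ! i))"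
    if s: "valid \<Sigma> s" "\<forall>v\<ge>B. s v = []" "s r = []" for s
  proof -
    define s1 where "s1 = s(?v := [], B := rev (s ?v) @ s B)"
    have 1: "runs (move_rev ?v B) s (6 * length (s ?v) + 1) s1"
      unfolding s1_def using d by (intro runs_move_rev) auto
    have 2: "runs (move_rev2 B ?v r) s1 (9 * length (s1 B) + 1)
        (s1(B := [], ?v := rev (s1 B) @ s1 ?v, r := rev (s1 B) @ s1 r))"
      using d a(3) by (intro runs_move_rev2) auto
    have e: "s1(B := [], ?v := rev (s1 B) @ s1 ?v, r := rev (s1 B) @ s1 r) = s(r := map s vs ! i)"
      using s d a(1,3) assms by (auto simp: s1_def fun_eq_iff)
    have l: "length (s1 B) = length (s ?v)" using s(2) by (simp add: s1_def)
    have "length (s ?v) \<le> total_length (map s vs)" using d(1) by (intro length_le_total) auto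
    then show ?thesis using runs_Seq[OF 1 2] unfolding e l
      by (elim runs_mono) (simp add: mult.commute)
  qed
  note runs = this
  have "ok (?c)" by simp
  from computesI[where f = "(\<lambda>xs. xs ! i)", OF this runs]
  show "\<exists>c p. computes c p vs r B (\<lambda>xs. xs ! i)" by blast
qed

text \<open>Bounded recursion on notation in the sense of Cobham. \<open>rec_list\<close> starts
  from the end of the list, so the recursion argument is first reversed; a loop then rebuilds it
  letter by letter and carries the value at the suffix rebuilt so far. Without \<open>bound\<close>,
  iterated doubling would give values of exponential length.\<close>

lemma polytime_rec:
  assumes g: "polytime n g" and h: "\<And>a. a \<in> \<Sigma> \<Longrightarrow> polytime (Suc (Suc n)) (h a)"
    and e: "polytime n e"
    and bound: "\<And>xs l. args n xs \<Longrightarrow> set l \<subseteq> \<Sigma> \<Longrightarrow>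
      length (rec_list (g xs) (\<lambda>a l r. h a (l # r # xs)) l) \<le> poly q (total_length xs + length l)"
  shows "polytime n (\<lambda>xs. rec_list (g xs) (\<lambda>a l r. h a (l # r # xs)) (e xs))"
proof (rule polytimeI)
  fix vs :: "nat list" and r B :: nat
  assume a: "length vs = n" "\<forall>v\<in>set vs. v < B" "r < B" "r \<notin> set vs"
  \<comment> \<open>\<open>X\<close> holds the suffix already rebuilt, \<open>Y\<close> the letters
    still to come, \<open>A\<close> the value at \<open>X\<close>, \<open>Z\<close> the next value.
    \<open>Z\<close> reaches \<open>A\<close> through \<open>T\<close> because a single move
    reverses.\<close>
  define X Y A Z T B' where regs: "X = B" "Y = B + 1" "A = B + 2" "Z = B + 3" "T = B + 4" "B' = B + 5"
  note vs_less = bspec[OF a(2)]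
  have notin: "X \<notin> set vs" "Y \<notin> set vs" "A \<notin> set vs" "Z \<notin> set vs" "T \<notin> set vs"
    using vs_less unfolding regs by fastforce+
  have vs': "\<forall>v\<in>set vs. v < B'" by (auto simp: regs dest!: vs_less)
  obtain ce pe where "computes ce pe vs X B' e"
    using polytimeD[OF e a(1) vs', of X] notin by (auto simp: regs)
  note ce = computesD[OF this]
  obtain cg pg where "computes cg pg vs A B' g"
    using polytimeD[OF g a(1) vs', of A] notin by (auto simp: regs)
  note cg = computesD[OF this]
  have "\<exists>c p. computes c p (X # A # vs) Z B' (h a)" if "a \<in> \<Sigma>" for a
    using polytimeD[OF h[OF that], of "X # A # vs" B' Z] a(1) vs' notin by (auto simp: regs)
  then obtain ch ph where ch': "\<And>a. a \<in> \<Sigma> \<Longrightarrow> computes (ch a) (ph a) (X # A # vs) Z B' (h a)"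
    by metis
  note ch = computesD[OF ch']
  obtain qe where qe: "\<And>xs. args n xs \<Longrightarrow> length (e xs) \<le> poly qe (total_length xs)"
    "\<And>xs. args n xs \<Longrightarrow> set (e xs) \<subseteq> \<Sigma>"
    using polytime_bound[OF e] by metis
  define R where "R xs l = rec_list (g xs) (\<lambda>a l r. h a (l # r # xs)) l" for xs l
  have R_simps: "R xs [] = g xs" "R xs (a # l) = h a (l # R xs l # xs)" for xs a l
    by (simp_all add: R_def)
  \<comment> \<open>The sum is one polynomial above the running times of the steps for all
    letters.\<close>
  define P where "P = (\<Sum>a\<in>\<Sigma>. ph a)"
  have P: "poly (ph a) x \<le> poly P x" if "a \<in> \<Sigma>" for a x
    unfolding P_def poly_sum using finite_alphabet that by (intro member_le_sum) auto
  define body where "body = for_top Y (\<lambda>a. Seq (ch a) (Seq (clear A) (Seq (move_rev Z T)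
      (Seq (move_rev T A) (Push X a)))))"
  define c where "c = Seq ce (Seq (move_rev X Y) (Seq cg (Seq (While Y body)
      (Seq (clear X) (Seq (move_rev A T) (move_rev T r))))))"
  have "ok c" using ce(1) cg(1) ch(1) by (simp add: c_def body_def)
  \<comment> \<open>\<open>qe\<close>, \<open>qs\<close> and \<open>pW\<close> bound the length of
    the recursion argument, the length of all intermediate values and the cost of one pass;
    \<open>L\<close>, \<open>S\<close> and \<open>W\<close> below are their values.\<close>
  define qs where "qs = pcompose q ([:0, 1:] + qe)"
  define pW where "pW = 14 * qs + pcompose P ([:0, 1:] + qe + qs) + 20"
  define p where "p = pe + pg + qe * pW + 8 * qe + 12 * qs + 20"
  have "runs c s (poly p (total_length (map s vs))) (s(r := R (map s vs) (e (map s vs))))"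
    if s: "valid \<Sigma> s" "\<forall>v\<ge>B. s v = []" "s r = []" for s
  proof -
    define xs where "xs = map s vs"
    define x where "x = total_length xs"
    define L where "L = poly qe x"
    define S where "S = poly q (x + L)"
    define W where "W = 14 * S + poly P (x + L + S) + 20"
    have xs: "args n xs" using valid_args[OF s(1), of vs] a(1) by (simp add: xs_def)
    have eL: "length (e xs) \<le> L" using qe(1)[OF xs] by (simp add: L_def x_def)
    have RS: "length (R xs l) \<le> S" if "set l \<subseteq> \<Sigma>" "length l \<le> L" for l
    proof -
      have "length (R xs l) \<le> poly q (x + length l)" using bound[OF xs that(1)] by (simp add: R_def x_def)
      also have "\<dots> \<le> S" unfolding S_def using that(2) by (intro poly_nat_mono) simp
      finally show ?thesis .
    qed
    define st where "st l ys = s(X := l, Y := ys, A := R xs l)" for l ys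
    have R\<Sigma>: "set (R xs l) \<subseteq> \<Sigma>" if "set l \<subseteq> \<Sigma>" for l
      using that
    proof (induction l)
      case Nil
      show ?case using polytime_bound[OF g] xs by (metis R_simps(1))
    next
      case (Cons a l)
      have "args (Suc (Suc n)) (l # R xs l # xs)" using Cons xs by (auto simp: args_def)
      then show ?case using polytime_bound[OF h[of a]] Cons.prems unfolding R_simps
        by (metis insert_subset list.simps(15))
    qed
    have valid_st: "valid \<Sigma> (st l ys)" if "set l \<subseteq> \<Sigma>" "set ys \<subseteq> \<Sigma>" for l ys
      unfolding st_def using that R\<Sigma> s(1) by (intro valid_upd) auto
    have m: "map (st l ys) vs = xs" for l ys
      using notin by (auto simp: st_def xs_def)
    \<comment> \<open>The loop invariant is the shape \<open>st l ys\<close> of the store: the value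
      for \<open>l\<close> sits in \<open>A\<close>, and \<open>rev ys @ l\<close> is the same in
      every pass.\<close>
    have loop: "runs (While Y body) (st l ys) (length ys * W + 1) (st (rev ys @ l) [])"
      if "set l \<subseteq> \<Sigma>" "set ys \<subseteq> \<Sigma>" "length l + length ys \<le> L" for l ys
      using that
    proof (induction ys arbitrary: l)
      case Nil
      have "runs (While Y body) (st l []) 1 (st l [])"
        by (intro runsI[OF run_While_empty]) (auto simp: st_def regs)
      then show ?case by simp
    next
      case (Cons b ys)
      let ?R = "R xs l" and ?R' = "R xs (b # l)"
      have b: "b \<in> \<Sigma>" "set (b # l) \<subseteq> \<Sigma>" using Cons.prems by auto
      have len: "length ?R \<le> S" "length ?R' \<le> S" using RS Cons.prems b by auto
      define s1 where "s1 = (st l ys)(Z := ?R')"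
      define s2 where "s2 = s1(A := [])"
      define s3 where "s3 = s2(Z := [], T := rev (s2 Z) @ s2 T)"
      define s4 where "s4 = s3(T := [], A := rev (s3 T) @ s3 A)"
      have 0: "(st l (b # ys))(Y := ys) = st l ys" by (auto simp: st_def regs fun_eq_iff)
      have m': "map (st l ys) (X # A # vs) = l # ?R # xs"
        using m by (simp add: st_def regs)
      have "\<forall>v\<ge>B'. st l ys v = []" "st l ys Z = []"
        using s(2) by (auto simp: st_def regs)
      from ch(2)[OF b(1) valid_st this, unfolded m', folded R_simps s1_def]
      have 1: "runs (ch b) (st l ys) (poly (ph b) (length l + (length ?R + x))) s1"
        using Cons.prems by (simp add: x_def)
      have 2: "runs (clear A) s1 (2 * S + 1) s2"
        unfolding s2_def using len by (intro runs_mono[OF runs_clear]) (simp add: s1_def st_def regs)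
      have Zs: "s2 Z = ?R'" by (simp add: s2_def s1_def st_def regs)
      have Ts: "s3 T = rev ?R'" using s(2) by (simp add: s3_def Zs) (simp add: s2_def s1_def st_def regs)
      have 3: "runs (move_rev Z T) s2 (6 * S + 1) s3"
        unfolding s3_def using len Zs by (intro runs_mono[OF runs_move_rev]) (auto simp: regs)
      have 4: "runs (move_rev T A) s3 (6 * S + 1) s4"
        unfolding s4_def using len Ts by (intro runs_mono[OF runs_move_rev]) (auto simp: regs)
      have s4: "s4 = (st l ys)(A := ?R')"
        unfolding s4_def Ts using s(2)
        by (auto simp: s3_def s2_def s1_def st_def regs fun_eq_iff)
      then have "s4(X := b # s4 X) = st (b # l) ys" by (auto simp: st_def regs fun_eq_iff)
      then have 5: "runs (Push X b) s4 2 (st (b # l) ys)"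
        using run_Push[of X b s4] by (auto intro: runsI)
      have "poly (ph b) (length l + (length ?R + x)) \<le> poly P (length l + (length ?R + x))"
        using P[OF b(1)] .
      also have "\<dots> \<le> poly P (x + L + S)"
        using Cons.prems(3) len by (intro poly_nat_mono) auto
      finally have le: "1 + (3 + (1 + poly (ph b) (length l + (length ?R + x)) + (1 + (2 * S + 1) +
          (1 + (6 * S + 1) + (1 + (6 * S + 1) + 2))))) + (length ys * W + 1) \<le> length (b # ys) * W + 1"
        by (simp add: W_def)
      have "runs (for_top Y (\<lambda>a. Seq (ch a) (Seq (clear A) (Seq (move_rev Z T)
          (Seq (move_rev T A) (Push X a)))))) (st l (b # ys))
          (3 + (1 + poly (ph b) (length l + (length ?R + x)) + (1 + (2 * S + 1) +
          (1 + (6 * S + 1) + (1 + (6 * S + 1) + 2))))) (st (b # l) ys)"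
        by (rule runs_for_top[where x = ys and a = b], simp add: st_def regs, unfold 0,
            rule runs_Seq[OF 1 runs_Seq[OF 2 runs_Seq[OF 3 runs_Seq[OF 4 5]]]])
      note it = runs_While[OF _ this[folded body_def] Cons.IH[of "b # l"]]
      have "runs (While Y body) (st l (b # ys)) (length (b # ys) * W + 1) (st (rev ys @ b # l) [])"
        using b Cons.prems by (intro runs_mono[OF it le]) (auto simp: st_def regs)
      then show ?case by simp
    qed
    define l where "l = e xs"
    have l: "set l \<subseteq> \<Sigma>" "length l \<le> L" using qe(2)[OF xs] eL by (auto simp: l_def)
    define s1 where "s1 = s(X := l)"
    define s2 where "s2 = s1(X := [], Y := rev (s1 X) @ s1 Y)"
    have s2: "s2 = s(Y := rev l)" using s(2) by (auto simp: s2_def s1_def regs fun_eq_iff)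
    define s3 where "s3 = st [] (rev l)"
    define s4 where "s4 = st l []"
    define s5 where "s5 = s4(X := [])"
    define s6 where "s6 = s5(A := [], T := rev (s5 A) @ s5 T)"
    define s7 where "s7 = s6(T := [], r := rev (s6 T) @ s6 r)"
    have 1: "runs ce s (poly pe x) s1"
      using ce(2)[of s] s by (simp add: s1_def l_def xs_def x_def regs)
    have 2: "runs (move_rev X Y) s1 (6 * L + 1) s2"
      unfolding s2_def using l(2) by (intro runs_mono[OF runs_move_rev]) (auto simp: s1_def regs)
    have v2: "valid \<Sigma> s2" unfolding s2 using l s(1) by (intro valid_upd) auto
    have m2: "map s2 vs = xs" using notin by (auto simp: s2 xs_def)
    have 3: "runs cg s2 (poly pg x) s3"
    proof -
      have "\<forall>v\<ge>B'. s2 v = []" "s2 A = []" using s(2) by (auto simp: s2 regs)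
      moreover have "s2(A := g xs) = s3"
        using s(2) by (auto simp: s2 s3_def st_def R_simps regs fun_eq_iff)
      ultimately show ?thesis using cg(2)[OF v2, unfolded m2] by (simp add: x_def)
    qed
    have 4: "runs (While Y body) s3 (L * W + 1) s4"
      unfolding s3_def s4_def using l loop[of "[]" "rev l"]
      by (auto elim!: runs_mono)
    have 5: "runs (clear X) s4 (2 * L + 1) s5"
      unfolding s5_def using l(2) by (intro runs_mono[OF runs_clear]) (simp add: s4_def st_def regs)
    have As: "s5 A = R xs l" by (simp add: s5_def s4_def st_def regs)
    have Ts: "s6 T = rev (R xs l)" using s(2) by (simp add: s6_def As) (simp add: s5_def s4_def st_def regs)
    note lR = RS[OF l]
    have 6: "runs (move_rev A T) s5 (6 * S + 1) s6"
      unfolding s6_def using lR As by (intro runs_mono[OF runs_move_rev]) (auto simp: regs)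
    have 7: "runs (move_rev T r) s6 (6 * S + 1) s7"
      unfolding s7_def using lR Ts a(3) by (intro runs_mono[OF runs_move_rev]) (auto simp: regs)
    have e: "s7 = s(r := R xs l)"
      unfolding s7_def Ts using s(2,3) a(3)
      by (auto simp: s6_def s5_def s4_def st_def regs fun_eq_iff)
    have p: "poly p x = poly pe x + poly pg x + L * W + 8 * L + 12 * S + 20"
      by (simp add: p_def pW_def qs_def poly_pcompose W_def S_def L_def)
    show ?thesis
      using runs_Seq[OF 1 runs_Seq[OF 2 runs_Seq[OF 3 runs_Seq[OF 4 runs_Seq[OF 5 runs_Seq[OF 6 7]]]]]]
      unfolding c_def[symmetric] e l_def xs_def[symmetric] x_def[symmetric]
      by (rule runs_mono) (simp add: p)
  qed
  from computesI[where f = "\<lambda>xs. R xs (e xs)", OF \<open>ok c\<close> this]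
  show "\<exists>c p. computes c p vs r B (\<lambda>xs. rec_list (g xs) (\<lambda>a l r. h a (l # r # xs)) (e xs))"
    unfolding R_def by blast
qed

end

section \<open>Case distinction, predicates and search over suffixes\<close>

context alphabet
begin

declare upt_Suc [simp del]

text \<open>Composition that also selects the remaining arguments: the new value takes position 0,
  so the selected positions shift by one.\<close>

lemma polytime_bind:
  assumes "polytime (Suc (length is)) f" "polytime m e" "\<forall>i\<in>set is. i < m"
  shows "polytime m (\<lambda>ys. f (e ys # map ((!) ys) is))"
proof -
  have "polytime (Suc m) (\<lambda>zs. f (map ((!) zs) (0 # map Suc is)))"
    using assms(1,3) by (intro polytime_reindex) auto
  from polytime_let[OF assms(2) this] show ?thesis by (simp add: comp_def)
qed

lemma map_nth_shift: "map ((!) (y # xs)) [1..<Suc (length xs)] = xs"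
  by (intro nth_equalityI) auto

lemma map_nth_shift2: "map ((!) (y # z # xs)) [2..<Suc (Suc (length xs))] = xs"
  by (intro nth_equalityI) auto

lemma polytime_weaken:
  assumes "polytime n f"
  shows "polytime (Suc n) (\<lambda>ys. f (tl ys))"
proof -
  have "polytime (Suc n) (\<lambda>ys. f (map ((!) ys) [1..<Suc n]))"
    using assms by (intro polytime_reindex) auto
  then show ?thesis
  proof (rule polytime_cong)
    fix ys assume "args (Suc n) ys"
    then obtain y xs where "ys = y # xs" "length xs = n" by (auto simp: args_def length_Suc_conv)
    then show "f (map ((!) ys) [1..<Suc n]) = f (tl ys)" using map_nth_shift[of y xs] by simp
  qed
qed

lemma polytime_weaken2:
  assumes "polytime n f"
  shows "polytime (Suc (Suc n)) (\<lambda>ys. f (tl (tl ys)))"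
  using polytime_weaken[OF polytime_weaken[OF assms]] .

text \<open>A recursion whose step ignores the recursive value. The required length bound is the sum
  of the bounds for \<open>g\<close> and for the finitely many \<open>h a\<close>.\<close>

lemma polytime_case:
  assumes e: "polytime n e" and g: "polytime n g" and h: "\<And>a. a \<in> \<Sigma> \<Longrightarrow> polytime (Suc n) (h a)"
  shows "polytime n (\<lambda>xs. case e xs of [] \<Rightarrow> g xs | a # l \<Rightarrow> h a (l # xs))"
proof -
  \<comment> \<open>Position 1, which holds the recursive value, is left out.\<close>
  let ?is = "0 # [2..<Suc (Suc n)]"
  let ?h = "\<lambda>a ys. h a (map ((!) ys) ?is)"
  have h': "polytime (Suc (Suc n)) (?h a)" if "a \<in> \<Sigma>" for a
    using h[OF that] by (intro polytime_reindex) auto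
  have eq: "?h a (l # r # xs) = h a (l # xs)" if "length xs = n" for a l r xs
    using map_nth_shift2[of l r xs] that by simp
  have rec: "rec_list (g xs) (\<lambda>a l r. ?h a (l # r # xs)) y =
      (case y of [] \<Rightarrow> g xs | a # l \<Rightarrow> h a (l # xs))" if "length xs = n" for y xs
    using eq[OF that] by (cases y) simp_all
  obtain qg where qg: "\<And>xs. args n xs \<Longrightarrow> length (g xs) \<le> poly qg (total_length xs)"
    using polytime_bound[OF g] by metis
  have "\<forall>a\<in>\<Sigma>. \<exists>q. \<forall>xs. args (Suc n) xs \<longrightarrow> length (h a xs) \<le> poly q (total_length xs)"
    using polytime_bound[OF h] by metis
  then obtain qh where qh: "\<And>a xs. a \<in> \<Sigma> \<Longrightarrow> args (Suc n) xs \<Longrightarrow>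
      length (h a xs) \<le> poly (qh a) (total_length xs)"
    by metis
  define q where "q = qg + (\<Sum>a\<in>\<Sigma>. qh a)"
  have "polytime n (\<lambda>xs. rec_list (g xs) (\<lambda>a l r. ?h a (l # r # xs)) (e xs))"
  proof (rule polytime_rec[OF g h' e, of _ q])
    fix xs y assume xs: "args n xs" and y: "set y \<subseteq> \<Sigma>"
    have len: "length xs = n" using xs by (simp add: args_def)
    have "length (case y of [] \<Rightarrow> g xs | a # l \<Rightarrow> h a (l # xs)) \<le> poly q (total_length xs + length y)"
    proof (cases y)
      case Nil
      then show ?thesis using qg[OF xs] by (simp add: q_def)
    next
      case (Cons a l)
      have a: "a \<in> \<Sigma>" "args (Suc n) (l # xs)" using y xs Cons by (auto simp: args_def)
      have "length (h a (l # xs)) \<le> poly (qh a) (total_length (l # xs))" using qh[OF a] .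
      also have "\<dots> \<le> poly (qh a) (total_length xs + length y)"
        using Cons by (intro poly_nat_mono) simp
      also have "\<dots> \<le> (\<Sum>a\<in>\<Sigma>. poly (qh a) (total_length xs + length y))"
        using finite_alphabet a(1) by (intro member_le_sum) auto
      finally show ?thesis using Cons by (simp add: q_def poly_sum)
    qed
    then show "length (rec_list (g xs) (\<lambda>a l r. ?h a (l # r # xs)) y)
        \<le> poly q (total_length xs + length y)"
      unfolding rec[OF len] .
  qed
  then show ?thesis by (rule polytime_cong) (use rec in \<open>auto simp: args_def\<close>)
qed

lemma polytime_append:
  assumes "polytime n e" "polytime n f"
  shows "polytime n (\<lambda>xs. e xs @ f xs)"
proof -
  have rec: "rec_list y (\<lambda>a l r. a # (l # r # xs) ! 1) x = x @ y" for x y :: "'c list" and xs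
    by (induction x) auto
  obtain q where q: "\<And>xs. args n xs \<Longrightarrow> length (f xs) \<le> poly q (total_length xs)"
    using polytime_bound[OF assms(2)] by metis
  have "polytime n (\<lambda>xs. rec_list (f xs) (\<lambda>a l r. a # (l # r # xs) ! 1) (e xs))"
  proof (rule polytime_rec[OF assms(2) _ assms(1), where q = "q + [:0, 1:]"])
    fix xs and l :: "'c list" assume "args n xs"
    from order_trans[OF q[OF this] poly_nat_mono[of "total_length xs" "total_length xs + length l" q]]
    show "length (rec_list (f xs) (\<lambda>a l r. a # (l # r # xs) ! 1) l)
      \<le> poly (q + [:0, 1:]) (total_length xs + length l)"
      unfolding rec by (simp add: trans_le_add1)
  qed (intro polytime_cons polytime_nth, auto)
  then show ?thesis unfolding rec .
qed

lemma polytime_const: "set w \<subseteq> \<Sigma> \<Longrightarrow> polytime n (\<lambda>_. w)"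
  by (induction w) (auto intro: polytime_nil polytime_cons)

lemma polytime_rev:
  assumes "polytime n e"
  shows "polytime n (\<lambda>xs. rev (e xs))"
proof -
  have rec: "rec_list [] (\<lambda>a l r. (l # r # xs) ! 1 @ [a]) x = rev x" for x :: "'c list" and xs
    by (induction x) auto
  have "polytime n (\<lambda>xs. rec_list [] (\<lambda>a l r. (l # r # xs) ! 1 @ [a]) (e xs))"
    by (rule polytime_rec[OF polytime_nil _ assms, where q = "[:0, 1:]"])
      (unfold rec, auto intro!: polytime_append polytime_nth polytime_const)
  then show ?thesis unfolding rec .
qed

definition decidable :: "nat \<Rightarrow> ('c list list \<Rightarrow> bool) \<Rightarrow> bool" where
  "decidable n P \<longleftrightarrow> polytime n (\<lambda>xs. if P xs then [tok] else [])"

lemma decidable_nonempty: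
  assumes "polytime n e"
  shows "decidable n (\<lambda>xs. e xs \<noteq> [])"
proof -
  have "polytime n (\<lambda>xs. case e xs of [] \<Rightarrow> [] | a # l \<Rightarrow> [tok])"
    using tok by (intro polytime_case[where h = "\<lambda>_ _. [tok]"] assms polytime_nil polytime_const) auto
  then show ?thesis unfolding decidable_def by (rule polytime_cong) (simp split: list.split)
qed

lemma polytime_if:
  assumes "decidable n P" "polytime n f" "polytime n g"
  shows "polytime n (\<lambda>xs. if P xs then f xs else g xs)"
proof -
  have "polytime n (\<lambda>xs. case if P xs then [tok] else [] of [] \<Rightarrow> g xs | a # l \<Rightarrow> f (tl (l # xs)))"
    using assms by (intro polytime_case[where h = "\<lambda>_ ys. f (tl ys)"] polytime_weaken)
      (simp_all add: decidable_def)
  then show ?thesis by (rule polytime_cong) simp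
qed

lemma decidable_cong:
  "decidable n P \<Longrightarrow> (\<And>xs. args n xs \<Longrightarrow> P xs = Q xs) \<Longrightarrow> decidable n Q"
  unfolding decidable_def by (erule polytime_cong) simp

lemma decidable_const: "decidable n (\<lambda>_. b)"
  unfolding decidable_def using tok by (cases b) (auto intro: polytime_nil polytime_const)

lemma decidable_if:
  assumes "decidable n P" "decidable n Q" "decidable n R"
  shows "decidable n (\<lambda>xs. if P xs then Q xs else R xs)"
  using polytime_if[OF assms(1) assms(2,3)[unfolded decidable_def]]
  unfolding decidable_def by (rule polytime_cong) simp

lemma decidable_not: "decidable n P \<Longrightarrow> decidable n (\<lambda>xs. \<not> P xs)"
  by (rule decidable_cong[OF decidable_if[of n P "\<lambda>_. False" "\<lambda>_. True"]])
    (simp_all add: decidable_const)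

lemma decidable_conj: "decidable n P \<Longrightarrow> decidable n Q \<Longrightarrow> decidable n (\<lambda>xs. P xs \<and> Q xs)"
  by (rule decidable_cong[OF decidable_if[of n P Q "\<lambda>_. False"]]) (simp_all add: decidable_const)

lemma decidable_disj: "decidable n P \<Longrightarrow> decidable n Q \<Longrightarrow> decidable n (\<lambda>xs. P xs \<or> Q xs)"
  by (rule decidable_cong[OF decidable_if[of n P "\<lambda>_. True" Q]]) (simp_all add: decidable_const)

lemma decidable_bex_list:
  assumes "\<And>p. p \<in> set L \<Longrightarrow> decidable n (P p)"
  shows "decidable n (\<lambda>xs. \<exists>p\<in>set L. P p xs)"
  using assms by (induction L) (auto intro: decidable_disj decidable_const)

lemma decidable_bind:
  assumes "decidable (Suc (length is)) P" "polytime m e" "\<forall>i\<in>set is. i < m"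
  shows "decidable m (\<lambda>ys. P (e ys # map ((!) ys) is))"
  using polytime_bind[OF assms(1)[unfolded decidable_def] assms(2,3)] by (simp add: decidable_def)

text \<open>A recursion over a word passes through exactly its suffixes, and the value is a single
  truth value, so its length is at most 1. This is the way to search through linearly many
  objects.\<close>

lemma decidable_ex_suffix:
  assumes e: "polytime n e" and P: "decidable (Suc n) P"
  shows "decidable n (\<lambda>xs. \<exists>y. suffix y (e xs) \<and> P (y # xs))"
proof -
  let ?h = "\<lambda>a ys. if P ((a # ys ! 0) # map ((!) ys) [2..<Suc (Suc n)]) then [tok] else ys ! 1"
  have rec: "rec_list (if P ([] # xs) then [tok] else []) (\<lambda>a l r. ?h a (l # r # xs)) x =
      (if \<exists>y. suffix y x \<and> P (y # xs) then [tok] else [])" if len: "length xs = n" for x xs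
    by (induction x) (simp_all add: suffix_Cons ex_disj_distrib conj_disj_distribR
      map_nth_shift2[of _ _ xs, unfolded len])
  have g: "polytime n (\<lambda>xs. if P ([] # xs) then [tok] else [])"
    using polytime_let[OF polytime_nil P[unfolded decidable_def]] .
  have "polytime n (\<lambda>xs. rec_list (if P ([] # xs) then [tok] else [])
      (\<lambda>a l r. ?h a (l # r # xs)) (e xs))"
  proof (rule polytime_rec[OF g _ e, where q = 1])
    fix a assume "a \<in> \<Sigma>"
    then show "polytime (Suc (Suc n)) (?h a)"
      using tok P by (intro polytime_if decidable_bind polytime_const polytime_nth polytime_cons) auto
  next
    fix xs l assume "args n xs"
    then have len: "length xs = n" by (simp add: args_def)
    show "length (rec_list (if P ([] # xs) then [tok] else []) (\<lambda>a l r. ?h a (l # r # xs)) l)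
       \<le> poly 1 (total_length xs + length l)"
      unfolding rec[OF len] by simp
  qed
  then show ?thesis unfolding decidable_def
    by (rule polytime_cong) (simp only: rec args_def)
qed

text \<open>The constant \<open>K\<close> is essential for the recursion: with at most
  \<open>K\<close> symbols per suffix the result is linear in the length of the word.\<close>

lemma polytime_count_suffixes:
  assumes e: "polytime n e" and f: "polytime (Suc n) f" and
    len: "\<And>xs. args (Suc n) xs \<Longrightarrow> length (f xs) \<le> K"
  shows "polytime n (\<lambda>xs. concat (map (\<lambda>y. f (y # xs)) (rev (suffixes (e xs)))))"
proof -
  let ?h = "\<lambda>a ys. f ((a # ys ! 0) # map ((!) ys) [2..<Suc (Suc n)]) @ ys ! 1"
  have f': "polytime n (\<lambda>xs. f ([] # xs))" using polytime_let[OF polytime_nil f] .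
  let ?R = "\<lambda>xs. rec_list (f ([] # xs)) (\<lambda>a l r. ?h a (l # r # xs))"
  have R: "?R xs (a # l) = f ((a # l) # xs) @ ?R xs l" if "length xs = n" for a l xs
    using map_nth_shift2[of l _ xs, unfolded that] by (simp)
  have "polytime n (\<lambda>xs. ?R xs (e xs))"
  proof (rule polytime_rec[OF f' _ e, where q = "[:K, K:]"])
    fix a assume "a \<in> \<Sigma>"
    then show "polytime (Suc (Suc n)) (?h a)"
      using f by (intro polytime_append polytime_bind polytime_nth polytime_cons) auto
  next
    fix xs l assume a: "args n xs" "set l \<subseteq> \<Sigma>"
    then have "length (?R xs l) \<le> K + K * length l"
    proof (induction l)
      case Nil
      then show ?case using len[of "[] # xs"] by (simp add: args_def)
    next
      case (Cons a l)
      have "args (Suc n) ((a # l) # xs)" using Cons by (simp add: args_def)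
      then have "length (f ((a # l) # xs)) \<le> K" by (rule len)
      moreover have "length (?R xs l) \<le> K + K * length l" using Cons by simp
      moreover have "length xs = n" using a by (simp add: args_def)
      ultimately show ?case unfolding R[OF \<open>length xs = n\<close>] length_append list.size
        by (simp add: algebra_simps)
    qed
    then show "length (?R xs l) \<le> poly [:K, K:] (total_length xs + length l)"
      by (simp add: algebra_simps trans_le_add1)
  qed
  moreover have "?R xs x = concat (map (\<lambda>y. f (y # xs)) (rev (suffixes x)))"
    if "length xs = n" for x xs
  proof (induction x)
    case (Cons a x)
    then show ?case unfolding R[OF that] by simp
  qed simp
  ultimately show ?thesis by (elim polytime_cong) (simp only: args_def)
qed

end

theorem in_P_if_decidable:
  assumes "alphabet \<Sigma> tok" "alphabet.decidable \<Sigma> tok 1 P"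
    "inj_on f A" "f ` A \<subseteq> \<Sigma>" "L \<subseteq> lists A" "\<And>w. w \<in> lists A \<Longrightarrow> P [map f w] \<longleftrightarrow> w \<in> L"
  shows "in_P A L"
proof -
  interpret alphabet \<Sigma> tok by fact
  obtain c p where "computes c p [0] 1 2 (\<lambda>xs. if P xs then [tok] else [])"
    using polytimeD[OF assms(2)[unfolded decidable_def], of "[0]" 2 1] by auto
  note c = computesD[OF this]
  obtain m' where m': "com_ok \<Sigma> m' c" using c(1) by (auto simp: ok_def)
  define m where "m = max m' 2"
  have m: "com_ok \<Sigma> m c" "1 < m" "0 < m" using com_ok_mono[OF m', of m] by (auto simp: m_def)
  show ?thesis
  proof (rule in_P_if_run[OF finite_alphabet m assms(3-5)])
    fix w assume w: "w \<in> lists A"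
    let ?s = "(\<lambda>_. [])(0 := map f w)"
    have "set (map f w) \<subseteq> \<Sigma>" using w image_subset_iff[THEN iffD1, OF assms(4)] by auto
    then have "valid \<Sigma> ?s" by (auto simp: valid_def)
    from c(2)[OF this] have "runs c ?s (poly p (length w)) (?s(1 := if P [map f w] then [tok] else []))"
      by simp
    then obtain t where "t \<le> poly p (length w)" "run c ?s t (?s(1 := if P [map f w] then [tok] else []))"
      by (auto simp: runs_def)
    then show "\<exists>t s'. t \<le> poly p (length w) \<and> run c ?s t s' \<and> (s' 1 \<noteq> []) = (w \<in> L)"
      using assms(6)[OF w] by (intro exI conjI) auto
  qed
qed

section \<open>Right ideal homomorphisms up to essential equality\<close>

lemma finite_words_le: "finite {w :: 'a::finite list. length w \<le> n}"
  using finite_lists_length_le[of "UNIV :: 'a set" n] by simp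

text \<open>Finite generation as bounded look-ahead: \<open>N\<close> is the maximal length of a
  generator, and conversely the members of length at most \<open>N\<close> generate.\<close>

lemma fg_right_ideal_iff:
  fixes R :: "'a::finite list set"
  shows "fg_right_ideal R \<longleftrightarrow> (\<forall>w\<in>R. \<forall>x. w @ x \<in> R) \<and> (\<exists>N. \<forall>w\<in>R. take N w \<in> R)"
proof
  assume "fg_right_ideal R"
  then obtain F where F: "finite F" "R = cone F" by (auto simp: fg_right_ideal_def)
  define N where "N = Max (insert 0 (length ` F))"
  have N: "length f \<le> N" if "f \<in> F" for f
    unfolding N_def using that F(1) by (intro Max_ge) auto
  have "take N w \<in> R" if wR: "w \<in> R" for w
  proof -
    obtain f y where w: "w = f @ y" "f \<in> F" using wR unfolding F(2) cone_def by auto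
    then have "take N w = f @ take (N - length f) y" using N[of f] by simp
    then show ?thesis using w F(2) by (auto simp: cone_def)
  qed
  moreover have "w @ x \<in> R" if "w \<in> R" for w x
    using that F(2) unfolding cone_def by (fastforce simp: append_assoc)
  ultimately show "(\<forall>w\<in>R. \<forall>x. w @ x \<in> R) \<and> (\<exists>N. \<forall>w\<in>R. take N w \<in> R)" by blast
next
  assume "(\<forall>w\<in>R. \<forall>x. w @ x \<in> R) \<and> (\<exists>N. \<forall>w\<in>R. take N w \<in> R)"
  then obtain N where R: "\<And>w x. w \<in> R \<Longrightarrow> w @ x \<in> R" and N: "\<And>w. w \<in> R \<Longrightarrow> take N w \<in> R" by blast
  have "w \<in> cone {w \<in> R. length w \<le> N}" if "w \<in> R" for w
  proof -
    have "w = take N w @ drop N w" "take N w \<in> {w \<in> R. length w \<le> N}" using N[OF that] by auto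
    then show ?thesis unfolding cone_def by blast
  qed
  then have "R = cone {w \<in> R. length w \<le> N}" using R by (auto simp: cone_def)
  moreover have "finite {w \<in> R. length w \<le> N}"
    by (rule finite_subset[OF _ finite_words_le[of N]]) auto
  ultimately show "fg_right_ideal R" unfolding fg_right_ideal_def by blast
qed

text \<open>The range inherits finite generation: the images of the domain words of length at most
  \<open>N\<close> generate it.\<close>

lemma ri_hom_iff:
  fixes \<phi> :: "'a::finite pfun"
  shows "ri_hom \<phi> \<longleftrightarrow> (\<forall>w v x. \<phi> w = Some v \<longrightarrow> \<phi> (w @ x) = Some (v @ x)) \<and>
     (\<exists>N. \<forall>w\<in>dom \<phi>. take N w \<in> dom \<phi>)" (is "_ \<longleftrightarrow> ?h \<and> ?f")
proof
  assume a: "ri_hom \<phi>"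
  then have ?h unfolding ri_hom_def by (metis domI option.sel)
  moreover have ?f using a unfolding ri_hom_def fg_right_ideal_iff by blast
  ultimately show "?h \<and> ?f" by blast
next
  assume a: "?h \<and> ?f"
  then obtain N where N: "\<And>w. w \<in> dom \<phi> \<Longrightarrow> take N w \<in> dom \<phi>" by blast
  from a have h: "\<And>w v x. \<phi> w = Some v \<Longrightarrow> \<phi> (w @ x) = Some (v @ x)" by blast
  have "fg_right_ideal (dom \<phi>)" using a unfolding fg_right_ideal_iff by blast
  moreover have "fg_right_ideal (ran \<phi>)"
  proof -
    let ?F = "{v. \<exists>w. length w \<le> N \<and> \<phi> w = Some v}"
    have "?F \<subseteq> (\<lambda>w. the (\<phi> w)) ` {w. length w \<le> N}" by force
    then have "finite ?F" using finite_words_le finite_surj by blast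
    moreover have "ran \<phi> = cone ?F"
    proof
      show "ran \<phi> \<subseteq> cone ?F"
      proof
        fix v assume "v \<in> ran \<phi>"
        then obtain w where w: "\<phi> w = Some v" by (auto simp: ran_def)
        then obtain v' where v': "\<phi> (take N w) = Some v'" using N by blast
        have "\<phi> (take N w @ drop N w) = Some (v' @ drop N w)" using h[OF v'] by blast
        then have "v = v' @ drop N w" using w by simp
        moreover have "v' \<in> ?F" using v' by (auto intro!: exI[of _ "take N w"])
        ultimately show "v \<in> cone ?F" unfolding cone_def by blast
      qed
      show "cone ?F \<subseteq> ran \<phi>" using h by (fastforce simp: cone_def ran_def)
    qed
    ultimately show ?thesis unfolding fg_right_ideal_def by blast
  qed
  moreover have "\<forall>r\<in>dom \<phi>. \<forall>x. \<phi> (r @ x) = Some (the (\<phi> r) @ x)" using h by fastforce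
  ultimately show "ri_hom \<phi>" by (simp add: ri_hom_def)
qed

lemma ri_hom_append: "ri_hom \<phi> \<Longrightarrow> \<phi> w = Some v \<Longrightarrow> \<phi> (w @ x) = Some (v @ (x :: 'a::finite list))"
  by (simp add: ri_hom_iff)

lemma ri_hom_dom_append: "ri_hom \<phi> \<Longrightarrow> w \<in> dom \<phi> \<Longrightarrow> w @ (x :: 'a::finite list) \<in> dom \<phi>"
  using ri_hom_append by blast

lemma ri_hom_take:
  fixes \<phi> :: "'a::finite pfun"
  assumes "ri_hom \<phi>"
  obtains N where "\<And>w n. w \<in> dom \<phi> \<Longrightarrow> N \<le> n \<Longrightarrow> take n w \<in> dom \<phi>"
proof -
  obtain N where N: "\<And>w. w \<in> dom \<phi> \<Longrightarrow> take N w \<in> dom \<phi>"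
    using assms unfolding ri_hom_iff by blast
  have "take n w \<in> dom \<phi>" if "w \<in> dom \<phi>" "N \<le> n" for w n
  proof -
    have "take n w = take N w @ take (n - N) (drop N w)"
      using that(2) by (metis add.commute le_add_diff_inverse2 take_add)
    then show ?thesis using ri_hom_dom_append[OF assms N[OF that(1)]] by simp
  qed
  then show ?thesis using that by blast
qed

section \<open>Agreement on long words and the maximal extension\<close>

definition ev_eq :: "'a pfun \<Rightarrow> 'a pfun \<Rightarrow> bool" where
  "ev_eq \<phi> \<psi> \<longleftrightarrow> (\<exists>N. \<forall>w. N \<le> length w \<longrightarrow> \<phi> w = \<psi> w)"

lemma ev_eq_sym: "ev_eq \<phi> \<psi> \<Longrightarrow> ev_eq \<psi> \<phi>" unfolding ev_eq_def by metis

lemma ev_eq_trans: "ev_eq \<phi> \<psi> \<Longrightarrow> ev_eq \<psi> \<chi> \<Longrightarrow> ev_eq \<phi> \<chi>"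
  unfolding ev_eq_def by (metis max.bounded_iff)

text \<open>Explicit form of \<open>max_ext\<close>. In contrast to the original definition it shows
  that only the values of \<phi> on long words count, which is \<open>max_hom_cong\<close>.\<close>

definition max_hom :: "'a pfun \<Rightarrow> 'a pfun" where
  "max_hom \<phi> w = (if \<exists>v N. \<forall>x. N \<le> length x \<longrightarrow> \<phi> (w @ x) = Some (v @ x)
     then Some (THE v. \<exists>N. \<forall>x. N \<le> length x \<longrightarrow> \<phi> (w @ x) = Some (v @ x)) else None)"

lemma max_hom_iff:
  "max_hom \<phi> w = Some v \<longleftrightarrow> (\<exists>N. \<forall>x. N \<le> length x \<longrightarrow> \<phi> (w @ x) = Some (v @ x))"
proof -
  let ?P = "\<lambda>v. \<exists>N. \<forall>x. N \<le> length x \<longrightarrow> \<phi> (w @ x) = Some (v @ x)"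
  have uniq: "v = v'" if v: "?P v" "?P v'" for v v'
  proof -
    obtain N N' where N: "\<forall>x. N \<le> length x \<longrightarrow> \<phi> (w @ x) = Some (v @ x)"
      "\<forall>x. N' \<le> length x \<longrightarrow> \<phi> (w @ x) = Some (v' @ x)" using v by blast
    \<comment> \<open>\<open>undefined\<close> is an arbitrary letter; all that matters is a word
      longer than both bounds.\<close>
    have "N \<le> length (replicate (N + N') undefined)" "N' \<le> length (replicate (N + N') undefined)"
      by auto
    with N have "v @ replicate (N + N') undefined = v' @ replicate (N + N') undefined"
      by (metis option.inject)
    then show ?thesis by simp
  qed
  show ?thesis
  proof
    assume a: "max_hom \<phi> w = Some v"
    then have ex: "\<exists>v. ?P v" by (auto simp: max_hom_def split: if_splits)
    then have "v = (THE v. ?P v)" using a by (auto simp: max_hom_def split: if_splits)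
    then show "?P v" using theI'[of ?P] ex uniq by blast
  next
    assume a: "?P v"
    then have "(THE v. ?P v) = v" using uniq by blast
    then show "max_hom \<phi> w = Some v" using a by (auto simp: max_hom_def)
  qed
qed

lemma ev_eq_append:
  assumes "ev_eq \<phi> \<psi>"
  obtains N where "\<And>w x. N \<le> length x \<Longrightarrow> \<phi> (w @ x) = \<psi> (w @ x)"
  using assms unfolding ev_eq_def by (metis length_append trans_le_add2)

lemma max_hom_cong_le:
  assumes "ev_eq \<phi> \<psi>" "max_hom \<phi> w = Some v"
  shows "max_hom \<psi> w = Some v"
proof -
  obtain N where N: "\<And>w x. N \<le> length x \<Longrightarrow> \<phi> (w @ x) = \<psi> (w @ x)"
    using ev_eq_append[OF assms(1)] by metis
  obtain M where "\<forall>x. M \<le> length x \<longrightarrow> \<phi> (w @ x) = Some (v @ x)"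
    using assms(2) unfolding max_hom_iff by blast
  then have "\<forall>x. max N M \<le> length x \<longrightarrow> \<psi> (w @ x) = Some (v @ x)"
    using N by (metis max.bounded_iff)
  then show ?thesis unfolding max_hom_iff by blast
qed

lemma map_eqI: "(\<And>w v. \<phi> w = Some v \<longleftrightarrow> \<psi> w = Some v) \<Longrightarrow> \<phi> = \<psi>"
  by (metis ext option.exhaust)

lemma max_hom_cong: "ev_eq \<phi> \<psi> \<Longrightarrow> max_hom \<phi> = max_hom \<psi>"
  by (rule map_eqI) (metis max_hom_cong_le ev_eq_sym)

lemma le_max_hom:
  fixes \<phi> :: "'a::finite pfun"
  assumes "ri_hom \<phi>"
  shows "\<phi> \<subseteq>\<^sub>m max_hom \<phi>"
proof -
  have "max_hom \<phi> w = Some v" if "\<phi> w = Some v" for w v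
    unfolding max_hom_iff using ri_hom_append[OF assms that] by blast
  then show ?thesis by (auto simp: map_le_def)
qed

lemma dom_max_hom_long:
  fixes \<phi> :: "'a::finite pfun"
  assumes "\<And>w n. w \<in> dom \<phi> \<Longrightarrow> N \<le> n \<Longrightarrow> take n w \<in> dom \<phi>"
    and "w \<in> dom (max_hom \<phi>)" "N \<le> length w"
  shows "w \<in> dom \<phi>"
proof -
  obtain v M where "\<forall>x. M \<le> length x \<longrightarrow> \<phi> (w @ x) = Some (v @ x)"
    using assms(2) by (auto simp: max_hom_iff)
  then have "w @ replicate M undefined \<in> dom \<phi>" by (auto simp: dom_def)
  from assms(1)[OF this assms(3)] show ?thesis by simp
qed

lemma ev_eq_max_hom:
  fixes \<phi> :: "'a::finite pfun"
  assumes "ri_hom \<phi>"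
  shows "ev_eq (max_hom \<phi>) \<phi>"
proof -
  obtain N where N: "\<And>w n. w \<in> dom \<phi> \<Longrightarrow> N \<le> n \<Longrightarrow> take n w \<in> dom \<phi>"
    using ri_hom_take[OF assms] by metis
  have "max_hom \<phi> w = \<phi> w" if "N \<le> length w" for w
    using dom_max_hom_long[OF N _ that] le_max_hom[OF assms]
    by (metis domIff map_le_def)
  then show ?thesis unfolding ev_eq_def by blast
qed

lemma ri_hom_max_hom:
  fixes \<phi> :: "'a::finite pfun"
  assumes "ri_hom \<phi>"
  shows "ri_hom (max_hom \<phi>)"
proof -
  obtain N where N: "\<And>w n. w \<in> dom \<phi> \<Longrightarrow> N \<le> n \<Longrightarrow> take n w \<in> dom \<phi>"
    using ri_hom_take[OF assms] by metis
  have "max_hom \<phi> (w @ x) = Some (v @ x)" if a: "max_hom \<phi> w = Some v" for w v x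
  proof -
    obtain M where M: "\<And>x. M \<le> length x \<Longrightarrow> \<phi> (w @ x) = Some (v @ x)"
      using a unfolding max_hom_iff by blast
    have "\<forall>y. M \<le> length y \<longrightarrow> \<phi> ((w @ x) @ y) = Some ((v @ x) @ y)" using M[of "x @ _"] by simp
    then show ?thesis unfolding max_hom_iff by blast
  qed
  moreover have "take N w \<in> dom (max_hom \<phi>)" if a: "w \<in> dom (max_hom \<phi>)" for w
  proof (cases "N \<le> length w")
    case True
    then have "take N w \<in> dom \<phi>" using N[OF dom_max_hom_long[OF N a]] by blast
    then show ?thesis using le_max_hom[OF assms] map_le_implies_dom_le by blast
  qed (use a in simp)
  ultimately show ?thesis unfolding ri_hom_iff by blast
qed

lemma max_hom_in_ess_extensions:
  fixes \<phi> :: "'a::finite pfun"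
  assumes "ri_hom \<phi>"
  shows "max_hom \<phi> \<in> ess_extensions \<phi>"
proof -
  have sub: "dom \<phi> \<subseteq> dom (max_hom \<phi>)" using map_le_implies_dom_le[OF le_max_hom[OF assms]] .
  have "I \<inter> dom \<phi> \<noteq> {}" if I: "right_ideal I" "I \<inter> dom (max_hom \<phi>) \<noteq> {}" for I
  proof -
    obtain w v where w: "w \<in> I" "max_hom \<phi> w = Some v" using I(2) by blast
    then obtain N where "\<forall>x. N \<le> length x \<longrightarrow> \<phi> (w @ x) = Some (v @ x)"
      unfolding max_hom_iff by blast
    then have "w @ replicate N undefined \<in> dom \<phi>" by (auto simp: dom_def)
    moreover have "w @ x \<in> I" for x using I(1) w(1) unfolding right_ideal_def cone_def by blast
    ultimately show ?thesis by blast
  qed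
  then have "ess_equal (dom (max_hom \<phi>)) (dom \<phi>)"
    unfolding ess_equal_def using sub by blast
  then show ?thesis
    using ri_hom_max_hom[OF assms] le_max_hom[OF assms]
    by (auto simp: ess_extensions_def ess_equal_hom_def map_le_def)
qed

text \<open>If \<chi> is defined on \<open>w\<close>, the principal right ideal of
  \<open>w @ x\<close> meets the domain of \<chi> and hence that of \<phi>. For long
  \<open>x\<close> the word found there can be cut back to \<open>w @ x\<close>, so \<phi> is
  already defined at \<open>w @ x\<close>.\<close>

lemma ess_extensions_le:
  fixes \<phi> :: "'a::finite pfun"
  assumes "ri_hom \<phi>" "\<chi> \<in> ess_extensions \<phi>"
  shows "\<chi> \<subseteq>\<^sub>m max_hom \<phi>"
proof -
  have \<chi>: "ri_hom \<chi>" "ess_equal (dom \<chi>) (dom \<phi>)" "\<phi> \<subseteq>\<^sub>m \<chi>"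
    using assms(2) by (auto simp: ess_extensions_def ess_equal_hom_def)
  obtain N where N: "\<And>w n. w \<in> dom \<phi> \<Longrightarrow> N \<le> n \<Longrightarrow> take n w \<in> dom \<phi>"
    using ri_hom_take[OF assms(1)] by metis
  have "max_hom \<phi> w = Some v" if w: "\<chi> w = Some v" for w v
  proof -
    have "\<phi> (w @ x) = Some (v @ x)" if x: "N \<le> length x" for x
    proof -
      have \<chi>x: "\<chi> (w @ x) = Some (v @ x)" using ri_hom_append[OF \<chi>(1) w] .
      have "right_ideal (cone {w @ x})" by (auto simp: right_ideal_def cone_def)
      moreover have "w @ x \<in> cone {w @ x} \<inter> dom \<chi>" using \<chi>x by (auto simp: cone_def)
      ultimately have "cone {w @ x} \<inter> dom \<phi> \<noteq> {}"
        using \<chi>(2) unfolding ess_equal_def by blast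
      then obtain z where "(w @ x) @ z \<in> dom \<phi>" unfolding cone_def by blast
      from N[OF this, of "length (w @ x)"] x have "w @ x \<in> dom \<phi>" by simp
      then show ?thesis using \<chi>x \<chi>(3) by (metis map_le_def)
    qed
    then show ?thesis unfolding max_hom_iff by blast
  qed
  then show ?thesis by (auto simp: map_le_def)
qed

lemma max_ext_eq:
  fixes \<phi> :: "'a::finite pfun"
  assumes "ri_hom \<phi>"
  shows "max_ext \<phi> = max_hom \<phi>"
  unfolding max_ext_def
proof (rule the_equality)
  show "max_hom \<phi> \<in> ess_extensions \<phi> \<and>
      (\<forall>\<chi>\<in>ess_extensions \<phi>. max_hom \<phi> \<subseteq>\<^sub>m \<chi> \<longrightarrow> \<chi> = max_hom \<phi>)"
    using max_hom_in_ess_extensions[OF assms] ess_extensions_le[OF assms] map_le_antisym by blast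
  show "\<psi> = max_hom \<phi>" if "\<psi> \<in> ess_extensions \<phi> \<and> (\<forall>\<chi>\<in>ess_extensions \<phi>. \<psi> \<subseteq>\<^sub>m \<chi> \<longrightarrow> \<chi> = \<psi>)" for \<psi>
    using that max_hom_in_ess_extensions[OF assms] ess_extensions_le[OF assms, of \<psi>] by blast
qed

text \<open>Equality in the monoid becomes agreement on long words, the form in which all
  factorizations are checked.\<close>

lemma max_hom_eq_iff:
  fixes \<phi> \<psi> :: "'a::finite pfun"
  assumes "ri_hom \<phi>" "ri_hom \<psi>"
  shows "max_hom \<phi> = max_hom \<psi> \<longleftrightarrow> ev_eq \<phi> \<psi>"
  using ev_eq_max_hom[OF assms(1)] ev_eq_max_hom[OF assms(2)] max_hom_cong ev_eq_sym ev_eq_trans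
  by metis

text \<open>Everything behind the first \<open>N\<close> letters of an argument reappears in the
  value, so at most \<open>N\<close> letters are lost. Long words thus have long images, which makes
  \<open>ev_eq\<close> compatible with composition.\<close>

lemma ri_hom_length:
  fixes \<phi> :: "'a::finite pfun"
  assumes "ri_hom \<phi>"
  obtains N where "\<And>w v. \<phi> w = Some v \<Longrightarrow> length w \<le> length v + N"
proof -
  obtain N where N: "\<And>w n. w \<in> dom \<phi> \<Longrightarrow> N \<le> n \<Longrightarrow> take n w \<in> dom \<phi>"
    using ri_hom_take[OF assms] by metis
  have "length w \<le> length v + N" if w: "\<phi> w = Some v" for w v
  proof -
    obtain v' where "\<phi> (take N w) = Some v'" using N[of w N] w by blast
    from ri_hom_append[OF assms this, of "drop N w"] have "v = v' @ drop N w" using w by simp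
    then show ?thesis by simp
  qed
  then show ?thesis using that by blast
qed

lemma ri_hom_comp:
  fixes \<phi> \<psi> :: "'a::finite pfun"
  assumes "ri_hom \<phi>" "ri_hom \<psi>"
  shows "ri_hom (\<phi> \<circ>\<^sub>m \<psi>)"
proof -
  obtain N where N: "\<And>w n. w \<in> dom \<phi> \<Longrightarrow> N \<le> n \<Longrightarrow> take n w \<in> dom \<phi>"
    using ri_hom_take[OF assms(1)] by metis
  obtain M where M: "\<And>w n. w \<in> dom \<psi> \<Longrightarrow> M \<le> n \<Longrightarrow> take n w \<in> dom \<psi>"
    using ri_hom_take[OF assms(2)] by metis
  \<comment> \<open>\<open>M\<close> letters suffice for \<psi> to be defined; the next
    \<open>N\<close> letters are passed on unchanged and are enough for \<phi>.\<close>
  have "take (M + N) w \<in> dom (\<phi> \<circ>\<^sub>m \<psi>)" if w: "w \<in> dom (\<phi> \<circ>\<^sub>m \<psi>)" for w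
  proof (cases "M + N \<le> length w")
    case True
    obtain v where v: "\<psi> w = Some v" "v \<in> dom \<phi>"
      using w by (fastforce simp: map_comp_Some_iff)
    obtain v' where v': "\<psi> (take M w) = Some v'" using M[of w M] v(1) by blast
    have 1: "\<psi> (take (M + N) w) = Some (v' @ take N (drop M w))"
      using ri_hom_append[OF assms(2) v', of "take N (drop M w)"] by (simp add: take_add)
    have "v = v' @ drop M w" using ri_hom_append[OF assms(2) v', of "drop M w"] v(1) by simp
    then have "v' @ take N (drop M w) \<in> dom \<phi>"
      using N[OF v(2), of "length v' + N"] by simp
    then show ?thesis using 1 by (simp add: map_comp_def domIff)
  qed (use w in simp)
  then have "\<exists>N. \<forall>w\<in>dom (\<phi> \<circ>\<^sub>m \<psi>). take N w \<in> dom (\<phi> \<circ>\<^sub>m \<psi>)" by blast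
  moreover have "(\<phi> \<circ>\<^sub>m \<psi>) (w @ x) = Some (v @ x)" if "(\<phi> \<circ>\<^sub>m \<psi>) w = Some v" for w v x
    using that ri_hom_append[OF assms(1)] ri_hom_append[OF assms(2)]
    by (fastforce simp: map_comp_def split: option.splits)
  ultimately show ?thesis unfolding ri_hom_iff by blast
qed

lemma ev_eq_comp:
  fixes \<phi> \<psi> :: "'a::finite pfun"
  assumes "ri_hom \<psi>" "ev_eq \<phi> \<phi>'" "ev_eq \<psi> \<psi>'"
  shows "ev_eq (\<phi> \<circ>\<^sub>m \<psi>) (\<phi>' \<circ>\<^sub>m \<psi>')"
proof -
  obtain N where N: "\<And>w v. \<psi> w = Some v \<Longrightarrow> length w \<le> length v + N"
    using ri_hom_length[OF assms(1)] by metis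
  obtain M where M: "\<And>w. M \<le> length w \<Longrightarrow> \<phi> w = \<phi>' w" using assms(2) unfolding ev_eq_def by blast
  obtain K where K: "\<And>w. K \<le> length w \<Longrightarrow> \<psi> w = \<psi>' w" using assms(3) unfolding ev_eq_def by blast
  have "(\<phi> \<circ>\<^sub>m \<psi>) w = (\<phi>' \<circ>\<^sub>m \<psi>') w" if "max (M + N) K \<le> length w" for w
  proof (cases "\<psi> w")
    case None
    moreover have "\<psi>' w = None" using K[of w] None that by simp
    ultimately show ?thesis by simp
  next
    case (Some v)
    then have "M \<le> length v" using N[of w v] that by simp
    moreover have "\<psi>' w = Some v" using K[of w] Some that by simp
    ultimately show ?thesis using M[of v] Some by simp
  qed
  then show ?thesis unfolding ev_eq_def by blast
qed

section \<open>Injective homomorphisms and their inverses\<close>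

definition inj_hom :: "'a pfun \<Rightarrow> bool" where
  "inj_hom \<phi> \<longleftrightarrow> ri_hom \<phi> \<and> inj_on \<phi> (dom \<phi>)"

lemma inj_hom_ri_hom: "inj_hom \<phi> \<Longrightarrow> ri_hom \<phi>" by (simp add: inj_hom_def)

lemma inj_homD: "inj_hom \<phi> \<Longrightarrow> \<phi> w = Some v \<Longrightarrow> \<phi> w' = Some v \<Longrightarrow> w = w'"
  unfolding inj_hom_def inj_on_def by (metis domI)

lemma inj_homI:
  "ri_hom \<phi> \<Longrightarrow> (\<And>w w' v. \<phi> w = Some v \<Longrightarrow> \<phi> w' = Some v \<Longrightarrow> w = w') \<Longrightarrow> inj_hom \<phi>"
  unfolding inj_hom_def inj_on_def by fastforce

lemma inj_hom_id [simp]: "inj_hom (Some :: 'a::finite pfun)"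
  by (intro inj_homI) (auto simp: ri_hom_iff)

lemma inj_hom_comp:
  fixes \<phi> \<psi> :: "'a::finite pfun"
  assumes "inj_hom \<phi>" "inj_hom \<psi>"
  shows "inj_hom (\<phi> \<circ>\<^sub>m \<psi>)"
proof (rule inj_homI)
  show "ri_hom (\<phi> \<circ>\<^sub>m \<psi>)" using assms by (intro ri_hom_comp inj_hom_ri_hom)
  show "w = w'" if "(\<phi> \<circ>\<^sub>m \<psi>) w = Some v" "(\<phi> \<circ>\<^sub>m \<psi>) w' = Some v" for w w' v
    using that inj_homD[OF assms(1)] inj_homD[OF assms(2)] unfolding map_comp_Some_iff by metis
qed

lemma inj_hom_max_hom:
  fixes \<phi> :: "'a::finite pfun"
  assumes "inj_hom \<phi>"
  shows "inj_hom (max_hom \<phi>)"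
proof (rule inj_homI)
  show "ri_hom (max_hom \<phi>)" using assms by (simp add: inj_hom_ri_hom ri_hom_max_hom)
  fix w w' v assume "max_hom \<phi> w = Some v" "max_hom \<phi> w' = Some v"
  then obtain N N' where N: "\<forall>x. N \<le> length x \<longrightarrow> \<phi> (w @ x) = Some (v @ x)"
      "\<forall>x. N' \<le> length x \<longrightarrow> \<phi> (w' @ x) = Some (v @ x)" unfolding max_hom_iff by blast
  let ?x = "replicate (N + N') undefined"
  have "\<phi> (w @ ?x) = Some (v @ ?x)" "\<phi> (w' @ ?x) = Some (v @ ?x)" using N by auto
  from inj_homD[OF assms this] show "w = w'" by simp
qed

definition pinv :: "'a pfun \<Rightarrow> 'a pfun" where
  "pinv \<phi> v = (if \<exists>w. \<phi> w = Some v then Some (SOME w. \<phi> w = Some v) else None)"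

lemma pinv_iff: "inj_hom \<phi> \<Longrightarrow> pinv \<phi> v = Some w \<longleftrightarrow> \<phi> w = Some v"
  unfolding pinv_def using inj_homD[of \<phi>] by (auto intro: someI some_equality)

lemma dom_pinv: "dom (pinv \<phi>) = ran \<phi>"
  by (auto simp: pinv_def ran_def split: if_splits)

lemma inj_hom_pinv:
  fixes \<phi> :: "'a::finite pfun"
  assumes "inj_hom \<phi>"
  shows "inj_hom (pinv \<phi>)"
proof (rule inj_homI)
  have "fg_right_ideal (dom (pinv \<phi>))"
    using assms by (simp add: dom_pinv inj_hom_def ri_hom_def)
  then show "ri_hom (pinv \<phi>)"
    unfolding ri_hom_iff fg_right_ideal_iff pinv_iff[OF assms]
    using ri_hom_append[OF inj_hom_ri_hom[OF assms]] by blast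
qed (simp add: pinv_iff[OF assms])

lemma pinv_pinv: "inj_hom (\<phi> :: 'a::finite pfun) \<Longrightarrow> pinv (pinv \<phi>) = \<phi>"
  by (rule map_eqI) (simp add: pinv_iff inj_hom_pinv)

lemma pinv_comp:
  fixes \<phi> \<psi> :: "'a::finite pfun"
  assumes "inj_hom \<phi>" "inj_hom \<psi>"
  shows "pinv (\<phi> \<circ>\<^sub>m \<psi>) = pinv \<psi> \<circ>\<^sub>m pinv \<phi>"
  by (rule map_eqI) (auto simp: map_comp_Some_iff pinv_iff inj_hom_comp assms)

text \<open>By \<open>ri_hom_length\<close> for the two inverses, the preimages of a long word are
  long, and there \<phi> and \<psi> agree.\<close>

lemma ev_eq_pinv:
  fixes \<phi> \<psi> :: "'a::finite pfun"
  assumes "inj_hom \<phi>" "inj_hom \<psi>" "ev_eq \<phi> \<psi>"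
  shows "ev_eq (pinv \<phi>) (pinv \<psi>)"
proof -
  obtain N where N: "\<And>w v. pinv \<phi> w = Some v \<Longrightarrow> length w \<le> length v + N"
    using ri_hom_length[OF inj_hom_ri_hom[OF inj_hom_pinv[OF assms(1)]]] by metis
  obtain M where M: "\<And>w v. pinv \<psi> w = Some v \<Longrightarrow> length w \<le> length v + M"
    using ri_hom_length[OF inj_hom_ri_hom[OF inj_hom_pinv[OF assms(2)]]] by metis
  obtain K where K: "\<And>w. K \<le> length w \<Longrightarrow> \<phi> w = \<psi> w" using assms(3) unfolding ev_eq_def by blast
  have "pinv \<phi> w = Some v \<longleftrightarrow> pinv \<psi> w = Some v" if w: "K + N + M \<le> length w" for w v
    using N[of w v] M[of w v] K[of v] w pinv_iff[OF assms(1)] pinv_iff[OF assms(2)] by fastforce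
  then have "pinv \<phi> w = pinv \<psi> w" if "K + N + M \<le> length w" for w
    using that by (metis option.exhaust)
  then show ?thesis unfolding ev_eq_def by blast
qed

section \<open>Green's relations of the monoid\<close>

lemma carrier_Inv: "carrier Inv = {\<phi> :: 'a::finite pfun. inj_hom \<phi> \<and> max_hom \<phi> = \<phi>}"
  by (auto simp: Inv_def inj_hom_def max_ext_eq)

lemma max_hom_carrier: "inj_hom \<phi> \<Longrightarrow> max_hom \<phi> \<in> carrier (Inv :: 'a::finite pfun monoid)"
  by (simp add: carrier_Inv inj_hom_max_hom)
    (metis ev_eq_max_hom inj_hom_ri_hom max_hom_cong)

text \<open>Extension can be postponed to the end, because composing the extensions or the original
  maps gives the same values on long words.\<close>

lemma mult_Inv:
  fixes \<phi> \<psi> :: "'a::finite pfun"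
  assumes "inj_hom \<phi>" "inj_hom \<psi>"
  shows "max_hom \<phi> \<otimes>\<^bsub>Inv\<^esub> max_hom \<psi> = max_hom (\<phi> \<circ>\<^sub>m \<psi>)"
proof -
  have "max_hom \<phi> \<otimes>\<^bsub>Inv\<^esub> max_hom \<psi> = max_ext (max_hom \<phi> \<circ>\<^sub>m max_hom \<psi>)" by (simp add: Inv_def)
  also have "\<dots> = max_hom (max_hom \<phi> \<circ>\<^sub>m max_hom \<psi>)"
    using assms by (intro max_ext_eq ri_hom_comp ri_hom_max_hom inj_hom_ri_hom)
  also have "\<dots> = max_hom (\<phi> \<circ>\<^sub>m \<psi>)"
    using assms by (intro max_hom_cong ev_eq_comp ev_eq_max_hom ri_hom_max_hom inj_hom_ri_hom)
  finally show ?thesis .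
qed

definition comp_word :: "'a pfun list \<Rightarrow> 'a pfun" where
  "comp_word u = foldr (\<circ>\<^sub>m) u Some"

lemma comp_word_simps [simp]: "comp_word [] = Some" "comp_word (g # u) = g \<circ>\<^sub>m comp_word u"
  by (simp_all add: comp_word_def)

lemma inj_hom_comp_word:
  "\<forall>g\<in>set u. inj_hom g \<Longrightarrow> inj_hom (comp_word u :: 'a::finite pfun)"
  by (induction u) (auto intro: inj_hom_comp)

lemma word_value_Inv:
  fixes u :: "'a::finite pfun list"
  assumes "u \<in> lists (carrier Inv)"
  shows "word_value Inv u = max_hom (comp_word u)"
  using assms
proof (induction u)
  case Nil
  have "max_hom (Some :: 'a pfun) = Some" by (rule ext) (simp add: max_hom_iff)
  then show ?case by (simp add: word_value_def Inv_def)
next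
  case (Cons g u)
  then have g: "inj_hom g" "max_hom g = g" "\<forall>g\<in>set u. inj_hom g" by (auto simp: carrier_Inv)
  have "word_value Inv (g # u) = max_hom g \<otimes>\<^bsub>Inv\<^esub> max_hom (comp_word u)"
    using Cons g(2) by (simp add: word_value_def)
  then show ?case using mult_Inv[OF g(1) inj_hom_comp_word[OF g(3)]] by simp
qed

definition ev_subset :: "'a list set \<Rightarrow> 'a list set \<Rightarrow> bool" where
  "ev_subset R S \<longleftrightarrow> (\<exists>N. \<forall>w. N \<le> length w \<longrightarrow> w \<in> R \<longrightarrow> w \<in> S)"

lemma bex_carrier_Inv:
  "(\<exists>x\<in>carrier Inv. P x) \<longleftrightarrow> (\<exists>\<chi> :: 'a::finite pfun. inj_hom \<chi> \<and> P (max_hom \<chi>))"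
proof
  assume "\<exists>x\<in>carrier Inv. P x"
  then obtain x where "inj_hom x" "max_hom x = x" "P x" by (auto simp: carrier_Inv)
  then show "\<exists>\<chi>. inj_hom \<chi> \<and> P (max_hom \<chi>)" by metis
qed (use max_hom_carrier in blast)

lemma green_le_L_ev_eq:
  fixes \<phi> \<psi> :: "'a::finite pfun"
  assumes "inj_hom \<phi>" "inj_hom \<psi>"
  shows "green_le_L Inv (max_hom \<phi>) (max_hom \<psi>) \<longleftrightarrow> (\<exists>\<chi>. inj_hom \<chi> \<and> ev_eq \<phi> (\<chi> \<circ>\<^sub>m \<psi>))"
  unfolding green_le_L_def bex_carrier_Inv using assms
  by (simp add: mult_Inv max_hom_eq_iff inj_hom_ri_hom inj_hom_comp cong: conj_cong)

lemma green_le_R_ev_eq: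
  fixes \<phi> \<psi> :: "'a::finite pfun"
  assumes "inj_hom \<phi>" "inj_hom \<psi>"
  shows "green_le_R Inv (max_hom \<phi>) (max_hom \<psi>) \<longleftrightarrow> (\<exists>\<chi>. inj_hom \<chi> \<and> ev_eq \<phi> (\<psi> \<circ>\<^sub>m \<chi>))"
  unfolding green_le_R_def bex_carrier_Inv using assms
  by (simp add: mult_Inv max_hom_eq_iff inj_hom_ri_hom inj_hom_comp cong: conj_cong)

lemma green_le_L_Inv:
  fixes \<phi> \<psi> :: "'a::finite pfun"
  assumes "inj_hom \<phi>" "inj_hom \<psi>"
  shows "green_le_L Inv (max_hom \<phi>) (max_hom \<psi>) \<longleftrightarrow> ev_subset (dom \<phi>) (dom \<psi>)"
  unfolding green_le_L_ev_eq[OF assms]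
proof
  assume "\<exists>\<chi>. inj_hom \<chi> \<and> ev_eq \<phi> (\<chi> \<circ>\<^sub>m \<psi>)"
  then obtain \<chi> N where N: "\<And>w. N \<le> length w \<Longrightarrow> \<phi> w = (\<chi> \<circ>\<^sub>m \<psi>) w" unfolding ev_eq_def by blast
  have "w \<in> dom \<psi>" if "N \<le> length w" "w \<in> dom \<phi>" for w
    using N[OF that(1)] that(2) by (auto simp: map_comp_Some_iff dom_def)
  then show "ev_subset (dom \<phi>) (dom \<psi>)" unfolding ev_subset_def by blast
next
  assume "ev_subset (dom \<phi>) (dom \<psi>)"
  then obtain N where N: "\<And>w. N \<le> length w \<Longrightarrow> w \<in> dom \<phi> \<Longrightarrow> w \<in> dom \<psi>"
    unfolding ev_subset_def by blast
  \<comment> \<open>The multiplier is \<phi> after the inverse of \<psi>.\<close>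
  have "\<phi> w = ((\<phi> \<circ>\<^sub>m pinv \<psi>) \<circ>\<^sub>m \<psi>) w" if "N \<le> length w" for w
  proof (cases "\<psi> w")
    case None
    then have "\<phi> w = None" using N[OF that] by blast
    then show ?thesis using None by simp
  next
    case (Some v)
    then have "pinv \<psi> v = Some w" by (simp add: pinv_iff assms)
    then show ?thesis using Some by simp
  qed
  then have "ev_eq \<phi> ((\<phi> \<circ>\<^sub>m pinv \<psi>) \<circ>\<^sub>m \<psi>)" unfolding ev_eq_def by blast
  then show "\<exists>\<chi>. inj_hom \<chi> \<and> ev_eq \<phi> (\<chi> \<circ>\<^sub>m \<psi>)"
    using assms inj_hom_comp inj_hom_pinv by blast
qed

lemma ev_eq_pinv_swap:
  fixes \<phi> \<psi> \<chi> :: "'a::finite pfun"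
  assumes "inj_hom \<phi>" "inj_hom \<psi>" "inj_hom \<chi>"
  shows "ev_eq (pinv \<phi>) (\<chi> \<circ>\<^sub>m pinv \<psi>) \<longleftrightarrow> ev_eq \<phi> (\<psi> \<circ>\<^sub>m pinv \<chi>)"
proof
  assume "ev_eq (pinv \<phi>) (\<chi> \<circ>\<^sub>m pinv \<psi>)"
  from ev_eq_pinv[OF _ _ this] show "ev_eq \<phi> (\<psi> \<circ>\<^sub>m pinv \<chi>)"
    using assms by (simp add: pinv_comp pinv_pinv inj_hom_pinv inj_hom_comp)
next
  assume "ev_eq \<phi> (\<psi> \<circ>\<^sub>m pinv \<chi>)"
  from ev_eq_pinv[OF _ _ this] show "ev_eq (pinv \<phi>) (\<chi> \<circ>\<^sub>m pinv \<psi>)"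
    using assms by (simp add: pinv_comp pinv_pinv inj_hom_pinv inj_hom_comp)
qed

text \<open>Inversion reverses products and preserves agreement on long words, so it exchanges left
  and right multiples.\<close>

lemma green_le_R_Inv:
  fixes \<phi> \<psi> :: "'a::finite pfun"
  assumes "inj_hom \<phi>" "inj_hom \<psi>"
  shows "green_le_R Inv (max_hom \<phi>) (max_hom \<psi>) \<longleftrightarrow> green_le_L Inv (max_hom (pinv \<phi>)) (max_hom (pinv \<psi>))"
  unfolding green_le_R_ev_eq[OF assms] green_le_L_ev_eq[OF assms[THEN inj_hom_pinv]]
  using ev_eq_pinv_swap[OF assms] inj_hom_pinv pinv_pinv by metis

lemma inj_hom_empty [simp]: "inj_hom (Map.empty :: 'a::finite pfun)"
  by (intro inj_homI) (auto simp: ri_hom_iff)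

definition prepend :: "'a list \<Rightarrow> 'a pfun" where
  "prepend p w = Some (p @ w)"

lemma inj_hom_prepend: "inj_hom (prepend p :: 'a::finite pfun)"
  by (intro inj_homI) (auto simp: ri_hom_iff prepend_def)

lemma ev_eq_empty:
  fixes \<phi> :: "'a::finite pfun"
  assumes "ri_hom \<phi>" "ev_eq \<phi> Map.empty"
  shows "\<phi> = Map.empty"
proof
  fix w
  obtain N where N: "\<And>w. N \<le> length w \<Longrightarrow> \<phi> w = None" using assms(2) unfolding ev_eq_def by blast
  show "\<phi> w = None"
  proof (rule ccontr)
    assume "\<phi> w \<noteq> None"
    then obtain v where "\<phi> w = Some v" by blast
    from ri_hom_append[OF assms(1) this, of "replicate N undefined"]
      N[of "w @ replicate N undefined"] show False by simp
  qed
qed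

text \<open>If \<psi> maps \<open>p\<close> to \<open>q\<close>, then prepending \<open>p\<close>,
  applying \<psi> and cutting off \<open>q\<close> is the identity. Every element is therefore a
  multiple of a nonzero \<psi>, while multiples of zero are zero.\<close>

lemma green_le_J_Inv:
  fixes \<phi> \<psi> :: "'a::finite pfun"
  assumes "inj_hom \<phi>" "inj_hom \<psi>"
  shows "green_le_J Inv (max_hom \<phi>) (max_hom \<psi>) \<longleftrightarrow> dom \<phi> = {} \<or> dom \<psi> \<noteq> {}"
proof
  assume "green_le_J Inv (max_hom \<phi>) (max_hom \<psi>)"
  then obtain x y where xy: "inj_hom x" "inj_hom y"
    "max_hom \<phi> = max_hom x \<otimes>\<^bsub>Inv\<^esub> max_hom \<psi> \<otimes>\<^bsub>Inv\<^esub> max_hom y"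
    unfolding green_le_J_def bex_carrier_Inv by blast
  then have "ev_eq \<phi> ((x \<circ>\<^sub>m \<psi>) \<circ>\<^sub>m y)"
    using assms by (simp add: mult_Inv inj_hom_comp max_hom_eq_iff inj_hom_ri_hom)
  moreover have "(x \<circ>\<^sub>m \<psi>) \<circ>\<^sub>m y = Map.empty" if "dom \<psi> = {}"
    using that by (intro map_eqI) (auto simp: map_comp_Some_iff)
  ultimately show "dom \<phi> = {} \<or> dom \<psi> \<noteq> {}"
    using ev_eq_empty[OF inj_hom_ri_hom[OF assms(1)]] by auto
next
  assume "dom \<phi> = {} \<or> dom \<psi> \<noteq> {}"
  then have "\<exists>\<chi> \<xi>. inj_hom \<chi> \<and> inj_hom \<xi> \<and> \<phi> = \<chi> \<circ>\<^sub>m \<psi> \<circ>\<^sub>m \<xi>"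
  proof
    assume "dom \<phi> = {}"
    then have "\<phi> = Map.empty \<circ>\<^sub>m \<psi> \<circ>\<^sub>m Map.empty" by auto
    then show ?thesis using inj_hom_empty by blast
  next
    assume "dom \<psi> \<noteq> {}"
    then obtain p q where pq: "\<psi> p = Some q" by blast
    have "pinv (prepend q) (q @ w) = Some w" for w
      using pinv_iff[OF inj_hom_prepend, of q "q @ w" w] by (simp add: prepend_def)
    then have "(\<phi> \<circ>\<^sub>m pinv (prepend q)) \<circ>\<^sub>m \<psi> \<circ>\<^sub>m prepend p = \<phi>"
      using ri_hom_append[OF inj_hom_ri_hom[OF assms(2)] pq]
      by (intro map_eqI) (simp add: map_comp_Some_iff, simp add: prepend_def)
    then show ?thesis using assms inj_hom_comp inj_hom_pinv inj_hom_prepend by metis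
  qed
  then obtain \<chi> \<xi> where c: "inj_hom \<chi>" "inj_hom \<xi>" "\<phi> = \<chi> \<circ>\<^sub>m \<psi> \<circ>\<^sub>m \<xi>" by blast
  have "max_hom \<phi> = max_hom \<chi> \<otimes>\<^bsub>Inv\<^esub> max_hom \<psi> \<otimes>\<^bsub>Inv\<^esub> max_hom \<xi>"
    using mult_Inv[OF c(1) assms(2)] mult_Inv[OF inj_hom_comp[OF c(1) assms(2)] c(2)] c(3)
    by simp
  then show "green_le_J Inv (max_hom \<phi>) (max_hom \<psi>)"
    using max_hom_carrier c(1,2) unfolding green_le_J_def by blast
qed

section \<open>Prefix codes and their size modulo k - 1\<close>

definition prefix_code :: "'a list set \<Rightarrow> bool" where
  "prefix_code C \<longleftrightarrow> finite C \<and> (\<forall>c\<in>C. \<forall>d\<in>C. prefix c d \<longrightarrow> c = d)"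

lemma in_cone: "w \<in> cone C \<longleftrightarrow> (\<exists>c\<in>C. prefix c w)"
  by (auto simp: cone_def prefix_def)

lemma prefix_code_unique:
  "prefix_code C \<Longrightarrow> c \<in> C \<Longrightarrow> d \<in> C \<Longrightarrow> prefix c w \<Longrightarrow> prefix d w \<Longrightarrow> c = d"
  unfolding prefix_code_def using prefix_same_cases by metis

lemma card_words: "card {x :: 'a::finite list. length x = n} = CARD('a) ^ n"
  using card_lists_length_eq[of "UNIV :: 'a set" n] by simp

lemma finite_words: "finite {x :: 'a::finite list. length x = n}"
  using finite_lists_length_eq[of "UNIV :: 'a set" n] by simp

lemma card_cone_level:
  fixes C :: "'a::finite list set"
  assumes C: "prefix_code C" and n: "\<And>c. c \<in> C \<Longrightarrow> length c \<le> n"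
  shows "card {w \<in> cone C. length w = n} = (\<Sum>c\<in>C. CARD('a) ^ (n - length c))"
proof -
  let ?W = "\<lambda>c. (\<lambda>x. c @ x) ` {x. length x = n - length c}"
  have "{w \<in> cone C. length w = n} = (\<Union>c\<in>C. ?W c)"
    using n by (fastforce simp: cone_def)
  also have "card \<dots> = (\<Sum>c\<in>C. card (?W c))"
  proof (intro card_UN_disjoint ballI impI)
    show "finite C" using C by (simp add: prefix_code_def)
    show "finite (?W c)" for c :: "'a list" by (intro finite_imageI finite_words)
    show "?W c \<inter> ?W d = {}" if "c \<in> C" "d \<in> C" "c \<noteq> d" for c d
    proof (rule ccontr)
      assume "?W c \<inter> ?W d \<noteq> {}"
      then obtain w where "prefix c w" "prefix d w" by (auto intro: prefixI)
      then show False using prefix_code_unique[OF C that(1,2)] that(3) by blast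
    qed
  qed
  also have "\<dots> = (\<Sum>c\<in>C. CARD('a) ^ (n - length c))"
    by (intro sum.cong refl) (simp add: card_image inj_on_def card_words)
  finally show ?thesis .
qed

text \<open>The number of elements of a prefix code generating a right ideal is determined modulo
  \<open>k - 1\<close> by the right ideal up to essential equality, since it is congruent to the number of
  words of any large length in the ideal.\<close>

definition has_rank :: "'a::finite list set \<Rightarrow> nat \<Rightarrow> bool" where
  "has_rank R r \<longleftrightarrow>
     (\<exists>N. \<forall>n\<ge>N. [card {w \<in> R. length w = n} = r] (mod (CARD('a) - 1)))"

text \<open>A code word \<open>c\<close> has k^(n - length c) extensions of length n. Since k is 1
  modulo k - 1, each code word contributes 1.\<close>

lemma has_rank_cone:
  fixes C :: "'a::finite list set"
  assumes C: "prefix_code C"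
  shows "has_rank (cone C) (card C)"
proof -
  define N where "N = Max (insert 0 (length ` C))"
  have N: "length c \<le> N" if "c \<in> C" for c
    unfolding N_def using that C by (intro Max_ge) (auto simp: prefix_code_def)
  have "0 < CARD('a)" by simp
  then have "[CARD('a) = 1] (mod (CARD('a) - 1))"
    by (metis One_nat_def Suc_pred cong_add_lcancel_0_nat cong_def mod_self mod_0 plus_1_eq_Suc)
  from cong_pow[OF this] have 1: "[CARD('a) ^ m = 1] (mod (CARD('a) - 1))" for m by simp
  have "[card {w \<in> cone C. length w = n} = card C] (mod (CARD('a) - 1))" if "N \<le> n" for n
  proof -
    have "card {w \<in> cone C. length w = n} = (\<Sum>c\<in>C. CARD('a) ^ (n - length c))"
      using N that by (intro card_cone_level[OF C]) (meson order_trans)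
    moreover have "[(\<Sum>c\<in>C. CARD('a) ^ (n - length c)) = (\<Sum>c\<in>C. 1)] (mod (CARD('a) - 1))"
      using 1 by (intro cong_sum) auto
    ultimately show ?thesis by simp
  qed
  then show ?thesis unfolding has_rank_def by blast
qed

lemma has_rank_unique:
  fixes R :: "'a::finite list set"
  assumes "has_rank R r" "has_rank R s"
  shows "[r = s] (mod (CARD('a) - 1))"
proof -
  obtain N M where
    "\<forall>n\<ge>N. [card {w \<in> R. length w = n} = r] (mod (CARD('a) - 1))"
    "\<forall>n\<ge>M. [card {w \<in> R. length w = n} = s] (mod (CARD('a) - 1))"
    using assms unfolding has_rank_def by blast
  then have "[card {w \<in> R. length w = N + M} = r] (mod (CARD('a) - 1))"
    "[card {w \<in> R. length w = N + M} = s] (mod (CARD('a) - 1))" by auto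
  then show ?thesis by (metis cong_sym cong_trans)
qed

definition ev_same :: "'a list set \<Rightarrow> 'a list set \<Rightarrow> bool" where
  "ev_same R S \<longleftrightarrow> ev_subset R S \<and> ev_subset S R"

lemma ev_subset_trans: "ev_subset R S \<Longrightarrow> ev_subset S T \<Longrightarrow> ev_subset R T"
  unfolding ev_subset_def by (metis max.bounded_iff)

lemma ev_same_trans: "ev_same R S \<Longrightarrow> ev_same S T \<Longrightarrow> ev_same R T"
  unfolding ev_same_def using ev_subset_trans by blast

lemma ev_same_sym: "ev_same R S \<Longrightarrow> ev_same S R" by (simp add: ev_same_def)

lemma ev_same_refl [simp]: "ev_same R R" by (simp add: ev_same_def ev_subset_def)

lemma has_rank_ev_same:
  assumes "ev_same R S" "has_rank R r"
  shows "has_rank S r"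
proof -
  obtain N M where N: "\<And>w. N \<le> length w \<Longrightarrow> w \<in> R \<Longrightarrow> w \<in> S"
      "\<And>w. M \<le> length w \<Longrightarrow> w \<in> S \<Longrightarrow> w \<in> R"
    using assms(1) unfolding ev_same_def ev_subset_def by blast
  obtain K where K: "\<And>n. K \<le> n \<Longrightarrow> [card {w \<in> R. length w = n} = r] (mod (CARD('a) - 1))"
    using assms(2) unfolding has_rank_def by blast
  have "{w \<in> S. length w = n} = {w \<in> R. length w = n}" if "N + M + K \<le> n" for n
    using N that by fastforce
  then have "[card {w \<in> S. length w = n} = r] (mod (CARD('a) - 1))" if "N + M + K \<le> n" for n
    using K[of n] that by simp
  then show ?thesis unfolding has_rank_def by blast
qed

text \<open>\<open>C\<close> consists of the prefix-minimal domain words and \<open>D\<close> of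
  their images. If the image of \<open>c\<close> is a prefix of that of \<open>d\<close>, then
  \<open>d\<close> and some \<open>c @ x\<close> have equal images, so \<open>d = c @ x\<close> by
  injectivity and \<open>c = d\<close>. The equal sizes carry the rank from the domain to the
  range.\<close>

lemma inj_hom_codes:
  fixes \<phi> :: "'a::finite pfun"
  assumes "inj_hom \<phi>"
  obtains C D where "prefix_code C" "prefix_code D" "dom \<phi> = cone C" "ran \<phi> = cone D" "card C = card D"
proof -
  note ri = inj_hom_ri_hom[OF assms]
  obtain N where N: "\<And>w n. w \<in> dom \<phi> \<Longrightarrow> N \<le> n \<Longrightarrow> take n w \<in> dom \<phi>"
    using ri_hom_take[OF ri] by metis
  define C where "C = {c \<in> dom \<phi>. \<forall>d. strict_prefix d c \<longrightarrow> d \<notin> dom \<phi>}"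
  have "length c \<le> N" if "c \<in> C" for c
  proof (rule ccontr)
    assume "\<not> length c \<le> N"
    then have "strict_prefix (take N c) c"
      by (metis take_is_prefix strict_prefix_def length_take min.cobounded2 nle_le take_all_iff)
    then show False using that N[of c N] by (auto simp: C_def)
  qed
  then have fin: "finite C" using finite_subset[OF _ finite_words_le[of N]] by blast
  have C: "prefix_code C" unfolding prefix_code_def using fin
    by (auto simp: C_def strict_prefix_def)
  have ex: "\<exists>c\<in>C. prefix c w" if "w \<in> dom \<phi>" for w
    using that
  proof (induction "length w" arbitrary: w rule: less_induct)
    case less
    show ?case
    proof (cases "w \<in> C")
      case False
      then obtain d where d: "strict_prefix d w" "d \<in> dom \<phi>" using less(2) by (auto simp: C_def)
      then obtain c where "c \<in> C" "prefix c d" using less(1) prefix_length_less by blast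
      then show ?thesis using d(1) by (meson prefix_order.less_imp_le prefix_order.trans)
    qed auto
  qed
  have "w \<in> dom \<phi>" if "c \<in> C" "prefix c w" for c w
    using that ri_hom_dom_append[OF ri] unfolding C_def prefix_def by blast
  with ex have dom: "dom \<phi> = cone C" unfolding set_eq_iff in_cone by blast
  define f where "f c = the (\<phi> c)" for c
  have f: "\<phi> (c @ x) = Some (f c @ x)" if "c \<in> C" for c x
    using ri_hom_append[OF ri, of c "f c"] that by (auto simp: f_def C_def)
  have f0: "\<phi> c = Some (f c)" if "c \<in> C" for c using f[OF that, of "[]"] by simp
  define D where "D = f ` C"
  have "ran \<phi> = cone D"
  proof
    show "ran \<phi> \<subseteq> cone D"
    proof
      fix v assume "v \<in> ran \<phi>"
      then obtain w where w: "\<phi> w = Some v" by (auto simp: ran_def)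
      then obtain c x where "c \<in> C" "w = c @ x" using ex[of w] by (auto simp: prefix_def)
      then show "v \<in> cone D" using f[of c x] w by (auto simp: cone_def D_def)
    qed
    show "cone D \<subseteq> ran \<phi>" using f unfolding cone_def D_def ran_def by blast
  qed
  moreover have "inj_on f C"
    using f0 inj_homD[OF assms] by (metis inj_onI)
  then have "card C = card D" by (simp add: D_def card_image)
  moreover have "prefix_code D" unfolding prefix_code_def
  proof (intro conjI ballI impI)
    show "finite D" using fin by (simp add: D_def)
    fix c' d' assume a: "c' \<in> D" "d' \<in> D" "prefix c' d'"
    then obtain c d x where cd: "c \<in> C" "d \<in> C" "c' = f c" "d' = f d" "f d = f c @ x"
      by (auto simp: D_def prefix_def)
    then have "\<phi> d = \<phi> (c @ x)" using f[of c x] f0[of d] by simp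
    then have "d = c @ x" using inj_homD[OF assms] f[OF cd(1)] by metis
    then have "prefix c d" by simp
    then have "c = d" using C cd(1,2) unfolding prefix_code_def by blast
    then show "c' = d'" using cd(3,4) by simp
  qed
  ultimately show ?thesis using C dom that by blast
qed

text \<open>Splitting \<open>c\<close> into its one-letter extensions removes only the word
  \<open>c\<close> itself from the ideal, which is invisible on long words. Nonemptiness is carried
  along so that there is always a word to split.\<close>

lemma prefix_code_expand:
  fixes C :: "'a::finite list set"
  assumes "prefix_code C" "C \<noteq> {}"
  shows "\<exists>C'. prefix_code C' \<and> C' \<noteq> {} \<and> card C' = card C + m * (CARD('a) - 1) \<and> ev_same (cone C) (cone C')"
proof (induction m)
  case 0
  then show ?case using assms by (intro exI[of _ C]) simp
next
  case (Suc m)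
  then obtain C' where C': "prefix_code C'" "C' \<noteq> {}" "card C' = card C + m * (CARD('a) - 1)"
      "ev_same (cone C) (cone C')" by blast
  obtain c where c: "c \<in> C'" using C'(2) by blast
  let ?S = "range (\<lambda>a. c @ [a])"
  let ?D = "(C' - {c}) \<union> ?S"
  have fin: "finite C'" using C'(1) by (simp add: prefix_code_def)
  have np: "\<not> prefix d (c @ [a])" if d: "d \<in> C' - {c}" for d a
  proof
    assume "prefix d (c @ [a])"
    then show False using prefix_code_unique[OF C'(1), of d c "c @ [a]"] d c by auto
  qed
  have np': "\<not> prefix (c @ [a]) d" if "d \<in> C' - {c}" for d a
    using that c C'(1) append_prefixD unfolding prefix_code_def by blast
  have disj: "(C' - {c}) \<inter> ?S = {}" using np by blast
  have "card ?D = card (C' - {c}) + card ?S"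
    using fin disj by (intro card_Un_disjoint) auto
  moreover have "card ?S = CARD('a)" by (simp add: card_image inj_on_def)
  moreover have "card C' = Suc (card (C' - {c}))" using fin c by (metis card.remove)
  moreover have "0 < CARD('a)" by simp
  ultimately have "card ?D = card C' + (CARD('a) - 1)" by linarith
  then have "card ?D = card C + Suc m * (CARD('a) - 1)"
    unfolding C'(3) by (simp only: mult_Suc ac_simps)
  moreover have "prefix_code ?D"
    unfolding prefix_code_def
  proof (intro conjI ballI impI)
    show "finite ?D" using fin by simp
    fix d e assume de: "d \<in> ?D" "e \<in> ?D" "prefix d e"
    consider "d \<in> C'" "e \<in> C'" | "d \<in> C' - {c}" "e \<in> ?S" | "d \<in> ?S" "e \<in> C' - {c}"
      | "d \<in> ?S" "e \<in> ?S" using de(1,2) by blast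
    then show "d = e"
    proof cases
      case 1
      then show ?thesis using C'(1) de(3) unfolding prefix_code_def by blast
    next
      case 2
      then show ?thesis using np de(3) by blast
    next
      case 3
      then show ?thesis using np' de(3) by blast
    next
      case 4
      then show ?thesis using de(3) by auto
    qed
  qed
  moreover have "ev_same (cone C') (cone ?D)"
  proof -
    have "w \<in> cone ?D" if w: "Suc (length c) \<le> length w" "w \<in> cone C'" for w
    proof -
      obtain d where d: "d \<in> C'" "prefix d w" using w(2) by (auto simp: in_cone)
      show ?thesis
      proof (cases "d = c")
        case True
        then obtain x where x: "w = c @ x" using d(2) by (auto simp: prefix_def)
        then obtain a y where "x = a # y" using w(1) by (cases x) auto
        then have "prefix (c @ [a]) w" using x by simp
        then show ?thesis unfolding in_cone by blast
      next
        case False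
        then show ?thesis using d unfolding in_cone by blast
      qed
    qed
    moreover have "w \<in> cone C'" if "w \<in> cone ?D" for w
      using that c append_prefixD unfolding in_cone by blast
    ultimately show ?thesis unfolding ev_same_def ev_subset_def by blast
  qed
  then have "ev_same (cone C) (cone ?D)" using C'(4) ev_same_trans by blast
  moreover have "?D \<noteq> {}" by blast
  ultimately show ?case by blast
qed

text \<open>A word has at most one prefix in a code, so replacing that prefix by its partner is well
  defined; the same property of \<open>D\<close> makes the map injective.\<close>

lemma hom_of_codes:
  fixes C D :: "'a::finite list set"
  assumes C: "prefix_code C" and D: "prefix_code D" and "card C = card D"
  obtains \<sigma> where "inj_hom \<sigma>" "dom \<sigma> = cone C" "ran \<sigma> = cone D"
proof -
  have "finite C" "finite D" using C D by (auto simp: prefix_code_def)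
  then obtain b where b: "bij_betw b C D" using finite_same_card_bij assms(3) by blast
  define \<sigma> where "\<sigma> w = (if \<exists>c\<in>C. prefix c w then
      let c = (THE c. c \<in> C \<and> prefix c w) in Some (b c @ drop (length c) w) else None)" for w
  have app: "\<sigma> (c @ x) = Some (b c @ x)" if "c \<in> C" for c x
  proof -
    have "(THE d. d \<in> C \<and> prefix d (c @ x)) = c"
      using that prefix_code_unique[OF C] by (intro the_equality) auto
    moreover have "\<exists>d\<in>C. prefix d (c @ x)" using that prefixI by blast
    ultimately show ?thesis by (simp add: \<sigma>_def)
  qed
  have iff: "\<sigma> w = Some v \<longleftrightarrow> (\<exists>c\<in>C. \<exists>x. w = c @ x \<and> v = b c @ x)" for w v
  proof
    assume a: "\<sigma> w = Some v"
    then obtain c x where "c \<in> C" "w = c @ x" by (auto simp: \<sigma>_def prefix_def split: if_splits)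
    then show "\<exists>c\<in>C. \<exists>x. w = c @ x \<and> v = b c @ x" using a app[of c x] by auto
  qed (use app in auto)
  have d: "dom \<sigma> = cone C" unfolding dom_def cone_def using iff by auto
  have r: "ran \<sigma> = cone D"
    using bij_betw_imp_surj_on[OF b] by (fastforce simp: ran_def cone_def iff)
  have "ri_hom \<sigma>"
    unfolding ri_hom_def d r fg_right_ideal_def
    using \<open>finite C\<close> \<open>finite D\<close> app by (auto simp: cone_def)
  moreover have "w = w'" if a: "\<sigma> w = Some v" "\<sigma> w' = Some v" for w w' v
  proof -
    obtain c x c' x' where cx: "c \<in> C" "w = c @ x" "v = b c @ x" "c' \<in> C" "w' = c' @ x'" "v = b c' @ x'"
      using a unfolding iff by blast
    then have "b c \<in> D" "b c' \<in> D" using bij_betwE[OF b] by auto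
    then have "b c = b c'" using prefix_code_unique[OF D, of "b c" "b c'" v] cx by (metis prefixI)
    then have "c = c'" using bij_betw_imp_inj_on[OF b] cx(1,4) by (auto dest: inj_onD)
    then show ?thesis using cx by simp
  qed
  ultimately have "inj_hom \<sigma>" by (intro inj_homI)
  then show ?thesis using d r that by blast
qed

lemma green_L_Inv:
  fixes \<phi> \<psi> :: "'a::finite pfun"
  assumes "inj_hom \<phi>" "inj_hom \<psi>"
  shows "green_L Inv (max_hom \<phi>) (max_hom \<psi>) \<longleftrightarrow> ev_same (dom \<phi>) (dom \<psi>)"
  by (simp add: green_L_def green_le_L_Inv assms ev_same_def)

lemma green_R_Inv:
  fixes \<phi> \<psi> :: "'a::finite pfun"
  assumes "inj_hom \<phi>" "inj_hom \<psi>"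
  shows "green_R Inv (max_hom \<phi>) (max_hom \<psi>) \<longleftrightarrow> ev_same (ran \<phi>) (ran \<psi>)"
  by (simp add: green_R_def green_le_R_Inv green_le_L_Inv assms inj_hom_pinv ev_same_def dom_pinv)

lemma ev_same_cone_empty:
  fixes C D :: "'a::finite list set"
  assumes "ev_same (cone C) (cone D)"
  shows "C = {} \<longleftrightarrow> D = {}"
proof -
  have "T \<noteq> {}" if ST: "ev_subset (cone S) (cone T)" "S \<noteq> {}" for S T :: "'a list set"
  proof -
    obtain N where N: "\<And>w. N \<le> length w \<Longrightarrow> w \<in> cone S \<Longrightarrow> w \<in> cone T"
      using ST(1) unfolding ev_subset_def by blast
    obtain c where "c \<in> S" using ST(2) by blast
    then have "c @ replicate N undefined \<in> cone T" by (intro N) (auto simp: cone_def)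
    then show ?thesis by (auto simp: cone_def)
  qed
  then show ?thesis using assms unfolding ev_same_def by blast
qed

text \<open>Only the smaller code is enlarged; its size falls short by a multiple of k - 1. If it is
  empty, so is the other one and there is nothing to do.\<close>

lemma equal_card_codes:
  fixes C D :: "'a::finite list set"
  assumes "CARD('a) \<ge> 2" "prefix_code C" "prefix_code D" "C = {} \<longleftrightarrow> D = {}"
    "[card C = card D] (mod (CARD('a) - 1))" "card C \<le> card D"
  shows "\<exists>C'. prefix_code C' \<and> card C' = card D \<and> ev_same (cone C) (cone C')"
proof (cases "C = {}")
  case True
  then show ?thesis using assms by (intro exI[of _ C]) simp
next
  case False
  obtain m where "card D = card C + m * (CARD('a) - 1)"
    using assms(5,6) by (metis add.commute cong_le_nat cong_sym mult.commute)
  then show ?thesis using prefix_code_expand[OF assms(2) False, of m] by metis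
qed

text \<open>The intermediate element must have the range of \<phi> and the domain of \<psi> up to
  short words, so codes for these two ideals have to be made equal in size; \<phi> itself carries
  the rank of its domain to its range. Emptiness is compared separately, since the congruence does
  not see it: for k = 2 it always holds.\<close>

lemma green_D_Inv:
  fixes \<phi> \<psi> :: "'a::finite pfun"
  assumes k: "CARD('a) \<ge> 2" and inj: "inj_hom \<phi>" "inj_hom \<psi>"
    and rank: "has_rank (dom \<phi>) r" "has_rank (dom \<psi>) s"
  shows "green_D Inv (max_hom \<phi>) (max_hom \<psi>) \<longleftrightarrow>
    (dom \<phi> = {} \<longleftrightarrow> dom \<psi> = {}) \<and> [r = s] (mod (CARD('a) - 1))"
proof -
  have cone_empty: "cone C = {} \<longleftrightarrow> C = {}" for C :: "'a list set" by (auto simp: cone_def)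
  obtain A B where A: "prefix_code A" "prefix_code B" "dom \<phi> = cone A" "ran \<phi> = cone B" "card A = card B"
    using inj_hom_codes[OF inj(1)] .
  obtain C E where C: "prefix_code C" "prefix_code E" "dom \<psi> = cone C" "ran \<psi> = cone E" "card C = card E"
    using inj_hom_codes[OF inj(2)] .
  have AB: "A = {} \<longleftrightarrow> B = {}" using A(1,2,5) unfolding prefix_code_def by (metis card_eq_0_iff)
  have r: "[r = card B] (mod (CARD('a) - 1))"
    using has_rank_unique[OF rank(1)] has_rank_cone[OF A(1)] A(3,5) by simp
  have s: "[s = card C] (mod (CARD('a) - 1))"
    using has_rank_unique[OF rank(2)] has_rank_cone[OF C(1)] C(3) by simp
  have rs: "[r = s] (mod (CARD('a) - 1)) \<longleftrightarrow> [card C = card B] (mod (CARD('a) - 1))"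
    using r s cong_sym cong_trans by metis
  have emp: "(dom \<phi> = {} \<longleftrightarrow> dom \<psi> = {}) \<longleftrightarrow> (C = {} \<longleftrightarrow> B = {})"
    using A(3) C(3) AB cone_empty by auto
  show ?thesis unfolding emp rs
  proof
    assume "green_D Inv (max_hom \<phi>) (max_hom \<psi>)"
    then obtain \<sigma> where \<sigma>: "\<sigma> \<in> carrier Inv" "green_R Inv (max_hom \<phi>) \<sigma>" "green_L Inv \<sigma> (max_hom \<psi>)"
      by (auto simp: green_D_def)
    then have \<sigma>': "inj_hom \<sigma>" "max_hom \<sigma> = \<sigma>" by (auto simp: carrier_Inv)
    have 1: "ev_same (ran \<phi>) (ran \<sigma>)" using green_R_Inv[OF inj(1) \<sigma>'(1)] \<sigma>(2) \<sigma>'(2) by simp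
    have 2: "ev_same (dom \<sigma>) (dom \<psi>)" using green_L_Inv[OF \<sigma>'(1) inj(2)] \<sigma>(3) \<sigma>'(2) by simp
    obtain F G where F: "prefix_code F" "prefix_code G" "dom \<sigma> = cone F" "ran \<sigma> = cone G" "card F = card G"
      using inj_hom_codes[OF \<sigma>'(1)] .
    have "[card G = card B] (mod (CARD('a) - 1))"
      using has_rank_ev_same[OF 1] has_rank_cone F(2,4) A(2,4) has_rank_unique cong_sym by metis
    moreover have "[card C = card F] (mod (CARD('a) - 1))"
      using has_rank_ev_same[OF 2] has_rank_cone F(1,3) C(1,3) has_rank_unique cong_sym by metis
    ultimately have "[card C = card B] (mod (CARD('a) - 1))" using F(5) cong_trans by metis
    moreover have "F = {} \<longleftrightarrow> G = {}" using F(1,2,5) unfolding prefix_code_def by (metis card_eq_0_iff)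
    ultimately show "(C = {} \<longleftrightarrow> B = {}) \<and> [card C = card B] (mod (CARD('a) - 1))"
      using ev_same_cone_empty[of B G] ev_same_cone_empty[of F C] 1 2 F(3,4) A(4) C(3) by auto
  next
    assume a: "(C = {} \<longleftrightarrow> B = {}) \<and> [card C = card B] (mod (CARD('a) - 1))"
    have "\<exists>C' B'. prefix_code C' \<and> prefix_code B' \<and> card C' = card B' \<and>
        ev_same (cone C) (cone C') \<and> ev_same (cone B) (cone B')"
    proof (cases "card C \<le> card B")
      case True
      then show ?thesis using equal_card_codes[OF k C(1) A(2) _ _ True] a A(2) ev_same_refl by blast
    next
      case False
      then have "card B \<le> card C" by simp
      from equal_card_codes[OF k A(2) C(1) _ _ this] a C(1) cong_sym
      obtain B' where "prefix_code B'" "card B' = card C" "ev_same (cone B) (cone B')" by metis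
      then show ?thesis using C(1) ev_same_refl by metis
    qed
    then obtain C' B' where CB: "prefix_code C'" "prefix_code B'" "card C' = card B'"
        "ev_same (cone C) (cone C')" "ev_same (cone B) (cone B')" by blast
    obtain \<sigma> where \<sigma>: "inj_hom \<sigma>" "dom \<sigma> = cone C'" "ran \<sigma> = cone B'"
      using hom_of_codes[OF CB(1,2,3)] .
    have "green_R Inv (max_hom \<phi>) (max_hom \<sigma>)" "green_L Inv (max_hom \<sigma>) (max_hom \<psi>)"
      using green_R_Inv[OF inj(1) \<sigma>(1)] green_L_Inv[OF \<sigma>(1) inj(2)] \<sigma> A(4) C(3) CB(5)
        ev_same_sym[OF CB(4)]
      by auto
    then show "green_D Inv (max_hom \<phi>) (max_hom \<psi>)"
      using max_hom_carrier[OF \<sigma>(1)] unfolding green_D_def by blast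
  qed
qed

section \<open>Finitely many candidates for the domain of a product\<close>

definition inv_word :: "'a pfun list \<Rightarrow> 'a pfun list" where
  "inv_word u = rev (map pinv u)"

lemma comp_word_append: "comp_word (u @ v) = comp_word u \<circ>\<^sub>m comp_word v"
proof (induction u)
  case Nil
  show ?case by (rule map_eqI) (simp add: map_comp_Some_iff)
next
  case (Cons g u)
  then show ?case by (intro map_eqI) (auto simp: map_comp_Some_iff)
qed

lemma comp_word_inv:
  fixes u :: "'a::finite pfun list"
  assumes "\<forall>g\<in>set u. inj_hom g"
  shows "comp_word (inv_word u) = pinv (comp_word u)"
  using assms
proof (induction u)
  case Nil
  have "pinv (Some :: 'a pfun) = Some" by (rule map_eqI) (auto simp: pinv_iff)
  then show ?case by (simp add: inv_word_def)
next
  case (Cons g u)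
  then have "comp_word (inv_word (g # u)) = pinv (comp_word u) \<circ>\<^sub>m (pinv g \<circ>\<^sub>m Some)"
    by (simp add: inv_word_def comp_word_append)
  moreover have "pinv g \<circ>\<^sub>m Some = pinv g" by (rule map_eqI) (simp add: map_comp_Some_iff)
  ultimately show ?case using Cons.prems by (simp add: pinv_comp inj_hom_comp_word)
qed

lemma comp_word_inv_iff:
  fixes u :: "'a::finite pfun list"
  assumes "\<forall>g\<in>set u. inj_hom g"
  shows "comp_word (inv_word u) p = Some c \<longleftrightarrow> comp_word u c = Some p"
  by (simp add: comp_word_inv[OF assms] pinv_iff inj_hom_comp_word assms)

definition reading_bound :: "nat \<Rightarrow> 'a pfun \<Rightarrow> bool" where
  "reading_bound N g \<longleftrightarrow> (\<forall>w\<in>dom g. take N w \<in> dom g)"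

text \<open>Factors act from the right, so the suffixes of the product are what has been applied
  after each step. Stating the preimage through the inverse word lets a candidate be computed from
  its description \<open>(y, p)\<close>.\<close>

definition candidates :: "nat \<Rightarrow> 'a pfun list \<Rightarrow> 'a list set" where
  "candidates N u = {c. \<exists>y p. suffix y u \<and> length p \<le> N \<and> comp_word (inv_word y) p = Some c}"

lemma finite_candidates: "finite (candidates N (u :: 'a::finite pfun list))"
proof (rule finite_subset)
  show "candidates N u \<subseteq> (\<lambda>(y, p). the (comp_word (inv_word y) p)) `
      (set (suffixes u) \<times> {p. length p \<le> N})"
    by (force simp: candidates_def)
  show "finite ((\<lambda>(y, p). the (comp_word (inv_word y) p)) ` (set (suffixes u) \<times> {p. length p \<le> N}))"
    using finite_words_le by blast
qed

text \<open>A long word reaches, at each factor of the product, a word that is long enough to decide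
  whether the factor is defined, or keeps as much of its remaining tail as is needed for this.\<close>

lemma candidates_decide:
  fixes u :: "'a::finite pfun list"
  assumes "\<forall>g\<in>set u. inj_hom g \<and> reading_bound N g"
  shows "\<exists>M. \<forall>z. M \<le> length z \<longrightarrow> (\<exists>c\<in>candidates N u. prefix c z \<and>
    (c \<in> dom (comp_word u) \<or> (\<forall>x. c @ x \<notin> dom (comp_word u))))"
  using assms
proof (induction u)
  case Nil
  have "[] \<in> candidates N []"
    unfolding candidates_def by (auto simp: inv_word_def intro!: exI[of _ "[]"])
  then show ?case by (intro exI[of _ 0]) (auto intro!: bexI[of _ "[]"])
next
  case (Cons g y)
  have g: "inj_hom g" "reading_bound N g" and y: "\<forall>g\<in>set y. inj_hom g" using Cons.prems by auto
  let ?f = "comp_word y"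
  have f: "inj_hom ?f" using y by (rule inj_hom_comp_word)
  note app = ri_hom_append[OF inj_hom_ri_hom[OF f]]
  have decides_g: "v \<in> dom g \<or> (\<forall>x. v @ x \<notin> dom g)" if "N \<le> length v" for v
  proof (rule disjCI)
    assume "\<not> (\<forall>x. v @ x \<notin> dom g)"
    then obtain x where "take N (v @ x) \<in> dom g" using g(2) unfolding reading_bound_def by blast
    then have "take N v @ drop N v \<in> dom g"
      using ri_hom_dom_append[OF inj_hom_ri_hom[OF g(1)], of "take N v" "drop N v"] that by simp
    then show "v \<in> dom g" by simp
  qed
  have decides: "c \<in> dom (comp_word (g # y)) \<or> (\<forall>x. c @ x \<notin> dom (comp_word (g # y)))"
    if "?f c = Some v" "N \<le> length v" for c v
    using decides_g[OF that(2)] that(1) app[OF that(1)] by (auto simp: dom_def map_comp_Some_iff)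
  obtain M where M: "\<And>z. M \<le> length z \<Longrightarrow> \<exists>c\<in>candidates N y. prefix c z \<and>
      (c \<in> dom ?f \<or> (\<forall>x. c @ x \<notin> dom ?f))"
    using Cons by auto
  \<comment> \<open>Behind a candidate of \<open>y\<close>, a word of length at least
    \<open>M + K + N\<close> keeps at least \<open>N\<close> letters.\<close>
  define K where "K = Max (insert 0 (length ` candidates N y))"
  have K: "length c \<le> K" if "c \<in> candidates N y" for c
    unfolding K_def using that finite_candidates by (intro Max_ge) auto
  have sub: "candidates N y \<subseteq> candidates N (g # y)"
  proof
    fix c assume "c \<in> candidates N y"
    then obtain y' p where "suffix y' y" "length p \<le> N" "comp_word (inv_word y') p = Some c"
      by (auto simp: candidates_def)
    then show "c \<in> candidates N (g # y)" using suffix_ConsI[of y' y g] by (auto simp: candidates_def)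
  qed
  have "\<exists>c\<in>candidates N (g # y). prefix c z \<and> (c \<in> dom (comp_word (g # y)) \<or>
      (\<forall>x. c @ x \<notin> dom (comp_word (g # y))))" if z: "M + K + N \<le> length z" for z
  proof -
    obtain c where c: "c \<in> candidates N y" "prefix c z" "c \<in> dom ?f \<or> (\<forall>x. c @ x \<notin> dom ?f)"
      using M[of z] z by auto
    show ?thesis
    proof (cases "\<exists>v. ?f c = Some v")
      case False
      then have "\<forall>x. c @ x \<notin> dom (comp_word (g # y))"
        using c(3) by (auto simp: dom_def map_comp_Some_iff)
      then show ?thesis using c(1,2) sub by blast
    next
      case True
      then obtain v where v: "?f c = Some v" by blast
      obtain x where x: "z = c @ x" using c(2) by (auto simp: prefix_def)
      show ?thesis
      proof (cases "N \<le> length v")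
        case True
        then show ?thesis using decides[OF v] c(1,2) sub by blast
      next
        case False
        \<comment> \<open>Just enough letters are added to bring the image to length
          \<open>N\<close>. The longer word is then the preimage of a word of length
          \<open>N\<close> under the suffix \<open>y\<close>, hence again a candidate.\<close>
        define x1 where "x1 = take (N - length v) x"
        have "N \<le> length x" using z K[OF c(1)] x by simp
        then have len: "length (v @ x1) = N" using False by (simp add: x1_def)
        have fx: "?f (c @ x1) = Some (v @ x1)" using app[OF v] .
        then have "comp_word (inv_word y) (v @ x1) = Some (c @ x1)"
          using comp_word_inv_iff[OF y] by blast
        moreover have "suffix y (g # y)" by (simp add: suffix_ConsI)
        ultimately have "c @ x1 \<in> candidates N (g # y)" unfolding candidates_def using len by blast
        moreover have "prefix (c @ x1) z"
          unfolding x x1_def by (simp add: take_is_prefix)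
        ultimately show ?thesis using decides[OF fx] len by blast
      qed
    qed
  qed
  then show ?case by blast
qed

section \<open>Domains of products in terms of candidates\<close>

locale word_setting =
  fixes N :: nat and G :: "'a::finite pfun set"
  assumes inj: "g \<in> G \<Longrightarrow> inj_hom g" and bound: "g \<in> G \<Longrightarrow> reading_bound N g"
begin

abbreviation dom_word :: "'a pfun list \<Rightarrow> 'a list set" where
  "dom_word u \<equiv> dom (comp_word u)"

abbreviation cands :: "'a pfun list \<Rightarrow> 'a list set" where
  "cands \<equiv> candidates N"

lemma inj_hom_word: "u \<in> lists G \<Longrightarrow> inj_hom (comp_word u)"
  using inj by (intro inj_hom_comp_word) auto

lemma obtain_decision:
  assumes "u \<in> lists G"
  obtains M where "\<And>z. M \<le> length z \<Longrightarrow> (\<exists>c\<in>cands u. prefix c z \<and>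
    (c \<in> dom_word u \<or> (\<forall>x. c @ x \<notin> dom_word u)))"
proof -
  have "\<forall>g\<in>set u. inj_hom g \<and> reading_bound N g" using assms inj bound by auto
  from candidates_decide[OF this] obtain M where M: "\<forall>z. M \<le> length z \<longrightarrow>
    (\<exists>c\<in>cands u. prefix c z \<and>
    (c \<in> dom_word u \<or> (\<forall>x. c @ x \<notin> dom_word u)))" ..
  show ?thesis by (rule that[OF M[rule_format]])
qed

lemma dom_append: "u \<in> lists G \<Longrightarrow> w \<in> dom_word u \<Longrightarrow> w @ x \<in> dom_word u"
  using ri_hom_dom_append inj_hom_ri_hom inj_hom_word by blast

lemma dom_prefix: "u \<in> lists G \<Longrightarrow> w \<in> dom_word u \<Longrightarrow> prefix w z \<Longrightarrow> z \<in> dom_word u"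
  using dom_append by (metis prefixE)

text \<open>The candidate that decides a long domain word must lie in the domain, for the
  alternative excludes all its extensions.\<close>

lemma dom_candidate:
  assumes u: "u \<in> lists G"
  obtains M where "\<And>z. M \<le> length z \<Longrightarrow> z \<in> dom_word u \<longleftrightarrow>
    (\<exists>c\<in>cands u. prefix c z \<and> c \<in> dom_word u)"
proof -
  obtain M where M: "\<And>z. M \<le> length z \<Longrightarrow> (\<exists>c\<in>cands u. prefix c z \<and>
    (c \<in> dom_word u \<or> (\<forall>x. c @ x \<notin> dom_word u)))"
    using obtain_decision[OF u] by blast
  have "z \<in> dom_word u \<longleftrightarrow> (\<exists>c\<in>cands u. prefix c z \<and> c \<in> dom_word u)"
    if "M \<le> length z" for z
    using M[OF that] dom_prefix[OF u] unfolding prefix_def by blast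
  then show ?thesis using that by blast
qed

lemma dom_empty_iff:
  assumes u: "u \<in> lists G"
  shows "dom_word u = {} \<longleftrightarrow> \<not> (\<exists>c\<in>cands u. c \<in> dom_word u)"
proof
  assume a: "\<not> (\<exists>c\<in>cands u. c \<in> dom_word u)"
  obtain M where M: "\<And>z. M \<le> length z \<Longrightarrow> z \<in> dom_word u \<longleftrightarrow>
    (\<exists>c\<in>cands u. prefix c z \<and> c \<in> dom_word u)"
    using dom_candidate[OF u] by blast
  have "w \<notin> dom_word u" for w
    using dom_append[OF u, of w "replicate M undefined"] M[of "w @ replicate M undefined"] a by auto
  then show "dom_word u = {}" by blast
qed blast

text \<open>If a long \<open>z\<close> lies in the domain of \<open>u\<close> but not of
  \<open>v\<close>, then a candidate \<open>c\<close> of \<open>u\<close> in the domain and a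
  candidate \<open>c'\<close> of \<open>v\<close> without extension in the domain are both prefixes
  of \<open>z\<close>; the longer one is the witness, so candidates of both words occur. Conversely,
  padding a witness gives long words in the domain of \<open>u\<close> that have no candidate of
  \<open>v\<close> in the domain as a prefix.\<close>

lemma ev_subset_iff:
  assumes u: "u \<in> lists G" and v: "v \<in> lists G"
  shows "ev_subset (dom_word u) (dom_word v) \<longleftrightarrow>
    \<not> (\<exists>w\<in>cands u \<union> cands v. w \<in> dom_word u \<and>
       \<not> (\<exists>d\<in>cands v. d \<in> dom_word v \<and> (prefix w d \<or> prefix d w)))"
    (is "?sub \<longleftrightarrow> \<not> ?wit")
proof
  assume ?sub
  then obtain K where K: "\<And>w. K \<le> length w \<Longrightarrow> w \<in> dom_word u \<Longrightarrow> w \<in> dom_word v"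
    unfolding ev_subset_def by blast
  obtain M where M: "\<And>z. M \<le> length z \<Longrightarrow> z \<in> dom_word v \<longleftrightarrow>
    (\<exists>c\<in>cands v. prefix c z \<and> c \<in> dom_word v)"
    using dom_candidate[OF v] by blast
  show "\<not> ?wit"
  proof
    assume ?wit
    then obtain w where w: "w \<in> dom_word u"
      "\<not> (\<exists>d\<in>cands v. d \<in> dom_word v \<and> (prefix w d \<or> prefix d w))" by blast
    let ?z = "w @ replicate (K + M) undefined"
    have "?z \<in> dom_word v" using dom_append[OF u w(1)] by (intro K) auto
    then obtain d where "d \<in> cands v" "prefix d ?z" "d \<in> dom_word v"
      using M[of ?z] by auto
    moreover have "prefix w ?z" by simp
    ultimately show False using w(2) prefix_same_cases by blast
  qed
next
  assume a: "\<not> ?wit"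
  obtain M1 where M1: "\<And>z. M1 \<le> length z \<Longrightarrow> z \<in> dom_word u \<longleftrightarrow>
    (\<exists>c\<in>cands u. prefix c z \<and> c \<in> dom_word u)"
    using dom_candidate[OF u] by blast
  obtain M2 where M2: "\<And>z. M2 \<le> length z \<Longrightarrow> (\<exists>c\<in>cands v. prefix c z \<and>
    (c \<in> dom_word v \<or> (\<forall>x. c @ x \<notin> dom_word v)))"
    using obtain_decision[OF v] by blast
  have "z \<in> dom_word v" if z: "M1 + M2 \<le> length z" "z \<in> dom_word u" for z
  proof (rule ccontr)
    assume nz: "z \<notin> dom_word v"
    obtain c where c: "c \<in> cands u" "prefix c z" "c \<in> dom_word u"
      using M1[of z] z by auto
    obtain c' where c': "c' \<in> cands v" "prefix c' z"
        "c' \<in> dom_word v \<or> (\<forall>x. c' @ x \<notin> dom_word v)"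
      using M2[of z] z(1) by auto
    have dead: "\<And>x. c' @ x \<notin> dom_word v" using c'(2,3) nz dom_prefix[OF v] by blast
    obtain w where w: "w \<in> cands u \<union> cands v" "prefix c w" "prefix c' w"
    proof (cases "prefix c c'")
      case True
      then show ?thesis using that[of c'] c'(1) by simp
    next
      case False
      then have "prefix c' c" using prefix_same_cases[OF c(2) c'(2)] by blast
      then show ?thesis using that[of c] c(1) by simp
    qed
    have "w \<in> dom_word u" using dom_prefix[OF u c(3) w(2)] .
    with a w(1) obtain d where d: "d \<in> dom_word v" "prefix w d \<or> prefix d w" by blast
    from d(2) have "\<exists>z. prefix c' z \<and> z \<in> dom_word v"
    proof
      assume "prefix w d"
      then show ?thesis using w(3) d(1) prefix_order.trans by blast
    next
      assume "prefix d w"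
      then show ?thesis using w(3) dom_prefix[OF v d(1)] by blast
    qed
    then show False using dead by (auto simp: prefix_def)
  qed
  then show ?sub unfolding ev_subset_def by blast
qed

text \<open>Minimality is expressed by prefix tests alone, the form in which it is decided. The code
  generates the domain only up to short words, which is enough for the rank.\<close>

definition code_of :: "'a pfun list \<Rightarrow> 'a list set" where
  "code_of u = {c \<in> cands u. c \<in> dom_word u \<and>
     \<not> (\<exists>d\<in>cands u. d \<in> dom_word u \<and> prefix d c \<and> \<not> prefix c d)}"

lemma prefix_code_code_of: "prefix_code (code_of u)"
  unfolding prefix_code_def code_of_def using finite_candidates[of N u] prefix_order.antisym by auto

lemma has_rank_code_of:
  assumes u: "u \<in> lists G"
  shows "has_rank (dom_word u) (card (code_of u))"
proof -
  obtain M where M: "\<And>z. M \<le> length z \<Longrightarrow> z \<in> dom_word u \<longleftrightarrow>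
    (\<exists>c\<in>cands u. prefix c z \<and> c \<in> dom_word u)"
    using dom_candidate[OF u] by blast
  have ex: "\<exists>c\<in>code_of u. prefix c w" if "w \<in> cands u" "w \<in> dom_word u" for w
    using that
  proof (induction "length w" arbitrary: w rule: less_induct)
    case less
    show ?case
    proof (cases "w \<in> code_of u")
      case False
      then obtain d where d: "d \<in> cands u" "d \<in> dom_word u" "prefix d w" "\<not> prefix w d"
        using less(2,3) by (auto simp: code_of_def)
      have "d \<noteq> w" using d(4) by auto
      then have "length d < length w" using d(3) by (auto simp: prefix_def)
      then show ?thesis using less(1) d(1,2,3) prefix_order.trans by blast
    qed auto
  qed
  have "z \<in> cone (code_of u)" if z: "M \<le> length z" "z \<in> dom_word u" for z
  proof -
    obtain w where "w \<in> cands u" "prefix w z" "w \<in> dom_word u" using M[OF z(1)] z(2) by blast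
    then show ?thesis using ex unfolding in_cone by (meson prefix_order.trans)
  qed
  moreover have "z \<in> dom_word u" if "z \<in> cone (code_of u)" for z
    using that dom_prefix[OF u] unfolding in_cone code_of_def by blast
  ultimately have "ev_same (cone (code_of u)) (dom_word u)"
    unfolding ev_same_def ev_subset_def by blast
  then show ?thesis using has_rank_ev_same has_rank_cone[OF prefix_code_code_of] by blast
qed

text \<open>The proper suffixes of a nonempty \<open>y\<close> are the suffixes of
  \<open>tl y\<close>; the guard \<open>y \<noteq> []\<close> is there because
  \<open>tl [] = []\<close>.\<close>

definition first_description :: "'a pfun list \<Rightarrow> 'a list \<Rightarrow> 'a list \<Rightarrow> bool" where
  "first_description y p c \<longleftrightarrow> comp_word (inv_word y) p = Some c \<and>
     \<not> (\<exists>y' p'. suffix y' (tl y) \<and> y \<noteq> [] \<and> length p' \<le> N \<and> comp_word (inv_word y') p' = Some c)"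

text \<open>Suffixes of \<open>u\<close> are linearly ordered, so each code word has a unique
  shortest describing suffix, and injectivity then fixes \<open>p\<close>. Code words can thus be
  counted without comparing them pairwise.\<close>

lemma card_code_of:
  assumes u: "u \<in> lists G"
  shows "card (code_of u) = card {(y, p). suffix y u \<and> length p \<le> N \<and>
    (\<exists>c\<in>code_of u. first_description y p c)}"
    (is "_ = card ?S")
proof -
  define f where "f = (\<lambda>(y :: 'a pfun list, p). the (comp_word (inv_word y) p))"
  have strict: "suffix y' (tl y) \<and> y \<noteq> [] \<longleftrightarrow> strict_suffix y' y" for y y' :: "'a pfun list"
    by (cases y) (auto simp: strict_suffix_def suffix_Cons dest: suffix_length_le)
  have "inj_on f ?S"
  proof (rule inj_onI)
    fix a b assume ab: "a \<in> ?S" "b \<in> ?S" "f a = f b"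
    obtain y p y' p' where e: "a = (y, p)" "b = (y', p')" by (metis surj_pair)
    from ab(1) e obtain c where c: "suffix y u" "length p \<le> N" "comp_word (inv_word y) p = Some c"
      "\<not> (\<exists>y' p'. strict_suffix y' y \<and> length p' \<le> N \<and> comp_word (inv_word y') p' = Some c)"
      unfolding first_description_def strict[symmetric] by auto
    from ab(2) e obtain d where d: "suffix y' u" "length p' \<le> N" "comp_word (inv_word y') p' = Some d"
      "\<not> (\<exists>y p. strict_suffix y y' \<and> length p \<le> N \<and> comp_word (inv_word y) p = Some d)"
      unfolding first_description_def strict[symmetric] by auto
    have cd: "c = d" using ab(3) e c(3) d(3) by (simp add: f_def)
    have "y = y'"
    proof (rule ccontr)
      assume "y \<noteq> y'"
      then have "strict_suffix y y' \<or> strict_suffix y' y"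
        using suffix_same_cases[OF c(1) d(1)] by (auto simp: strict_suffix_def)
      then show False using c d cd by blast
    qed
    moreover have "p = p'"
    proof -
      have y: "\<forall>g\<in>set y. inj_hom g" using c(1) u inj by (auto dest: set_mono_suffix)
      then show ?thesis using c(3) d(3) cd \<open>y = y'\<close> comp_word_inv_iff[OF y] by (metis option.inject)
    qed
    ultimately show "a = b" using e by simp
  qed
  moreover have "f ` ?S = code_of u"
  proof
    show "f ` ?S \<subseteq> code_of u" by (auto simp: f_def first_description_def)
    show "code_of u \<subseteq> f ` ?S"
    proof
      fix c assume c: "c \<in> code_of u"
      let ?P = "\<lambda>y. suffix y u \<and> (\<exists>p. length p \<le> N \<and> comp_word (inv_word y) p = Some c)"
      have "\<exists>y. ?P y" using c by (auto simp: code_of_def candidates_def)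
      then obtain y where y: "?P y" "\<And>y'. ?P y' \<Longrightarrow> length y \<le> length y'"
        using ex_has_least_nat[of ?P _ length] by blast
      then obtain p where p: "length p \<le> N" "comp_word (inv_word y) p = Some c" by blast
      have "\<not> (\<exists>y' p'. strict_suffix y' y \<and> length p' \<le> N \<and> comp_word (inv_word y') p' = Some c)"
      proof
        assume "\<exists>y' p'. strict_suffix y' y \<and> length p' \<le> N \<and> comp_word (inv_word y') p' = Some c"
        then obtain y' p' where y': "strict_suffix y' y" "length p' \<le> N" "comp_word (inv_word y') p' = Some c"
          by blast
        then have "?P y'" using y(1) by (meson strict_suffix_def suffix_order.trans)
        moreover have "length y' < length y" using y'(1) by (simp add: suffix_length_less)
        ultimately show False using y(2) by fastforce
      qed
      then have "(y, p) \<in> ?S" using c p y(1) unfolding first_description_def strict[symmetric] by auto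
      moreover have "f (y, p) = c" using p by (simp add: f_def)
      ultimately show "c \<in> f ` ?S" by force
    qed
  qed
  ultimately show ?thesis using card_image[of f ?S] by (simp only:)
qed

end

section \<open>Prefixes, splitting at a separator and residues in polynomial time\<close>

context alphabet
begin

lemma polytime_if_const:
  "(b \<Longrightarrow> polytime n f) \<Longrightarrow> (\<not> b \<Longrightarrow> polytime n g) \<Longrightarrow> polytime n (\<lambda>xs. if b then f xs else g xs)"
  by (cases b) simp_all

lemma polytime_tl:
  assumes "polytime n e"
  shows "polytime n (\<lambda>xs. tl (e xs))"
proof -
  have "polytime n (\<lambda>xs. case e xs of [] \<Rightarrow> [] | a # l \<Rightarrow> (l # xs) ! 0)"
    by (rule polytime_case[where h = "\<lambda>_ ys. ys ! 0", OF assms polytime_nil polytime_nth]) simp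
  then show ?thesis by (rule polytime_cong) (simp split: list.split)
qed

text \<open>The leading \<open>tok\<close> tells success with an empty remainder from failure, which
  is the empty word.\<close>

definition strip :: "'c list \<Rightarrow> 'c list \<Rightarrow> 'c list" where
  "strip x y = (if prefix x y then tok # drop (length x) y else [])"

text \<open>The letters of \<open>x\<close> are cut off the front of \<open>y\<close> one by one, a
  mismatch giving the empty word from then on. As \<open>rec_list\<close> begins at the end of its
  argument, the recursion runs on the reversal of \<open>x\<close>.\<close>

lemma polytime_strip:
  assumes x: "polytime n ex" and y: "polytime n ey"
  shows "polytime n (\<lambda>xs. strip (ex xs) (ey xs))"
proof -
  define st where "st a r = (case r of [] \<Rightarrow> [] | t # r' \<Rightarrow>
      (case r' of [] \<Rightarrow> [] | b # r'' \<Rightarrow> if b = a then tok # r'' else []))" for a and r :: "'c list"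
  have st: "polytime (Suc (Suc n)) (\<lambda>ys. st a (ys ! 1))" if "a \<in> \<Sigma>" for a
  proof -
    have "polytime m (\<lambda>ys. case ys ! i of [] \<Rightarrow> [] | b # r'' \<Rightarrow>
        (\<lambda>ws. if b = a then tok # ws ! 0 else []) (r'' # ys))" if "i < m" for i m
      using tok that by (intro polytime_case polytime_nth polytime_nil polytime_if_const polytime_cons) auto
    from polytime_case[where e = "\<lambda>ys. ys ! 1" and n = "Suc (Suc n)", OF polytime_nth polytime_nil this[of 0]]
    show ?thesis unfolding st_def nth_Cons_0 by simp
  qed
  have rec: "rec_list (tok # y) (\<lambda>a l r. st a ((l # r # xs) ! 1)) (rev x) = strip x y" for x y and xs :: "'c list list"
  proof (induction x rule: rev_induct)
    case (snoc a x)
    show ?case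
    proof (cases "prefix x y")
      case True
      then obtain z where z: "y = x @ z" by (auto simp: prefix_def)
      show ?thesis using snoc by (cases z) (auto simp: z st_def strip_def)
    next
      case False
      then have "\<not> prefix (x @ [a]) y" using append_prefixD by blast
      then show ?thesis using snoc False by (simp add: st_def strip_def)
    qed
  qed (simp add: strip_def)
  obtain q where q: "\<And>xs. args n xs \<Longrightarrow> length (ey xs) \<le> poly q (total_length xs)"
    using polytime_bound[OF y] by metis
  have "polytime n (\<lambda>xs. rec_list (tok # ey xs) (\<lambda>a l r. st a ((l # r # xs) ! 1)) (rev (ex xs)))"
  proof (rule polytime_rec[OF polytime_cons[OF y tok] st polytime_rev[OF x], where q = "q + 1"])
    fix xs and l :: "'c list" assume "args n xs"
    from order_trans[OF q[OF this] poly_nat_mono[of "total_length xs" "total_length xs + length l" q]]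
    show "length (rec_list (tok # ey xs) (\<lambda>a l r. st a ((l # r # xs) ! 1)) l)
       \<le> poly (q + 1) (total_length xs + length l)"
      using rec[of "ey xs" xs "rev l"] by (simp add: strip_def le_diff_conv trans_le_add1)
  qed
  then show ?thesis unfolding rec .
qed

lemma decidable_prefix:
  assumes "polytime n ex" "polytime n ey"
  shows "decidable n (\<lambda>xs. prefix (ex xs) (ey xs))"
  using decidable_nonempty[OF polytime_strip[OF assms]] by (rule decidable_cong) (simp add: strip_def)

lemma decidable_eq:
  assumes "polytime n ex" "polytime n ey"
  shows "decidable n (\<lambda>xs. ex xs = ey xs)"
  using decidable_conj[OF decidable_prefix[OF assms] decidable_prefix[OF assms(2,1)]]
  by (rule decidable_cong) (auto intro: prefix_order.antisym)

primrec rewrite_head :: "('c list \<times> 'c list) list \<Rightarrow> 'c list \<Rightarrow> 'c list" where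
  "rewrite_head [] r = []"
| "rewrite_head (e # tb) r =
     (if prefix (fst e) r then snd e @ drop (length (fst e)) r else rewrite_head tb r)"

lemma polytime_rewrite_head:
  assumes "\<And>e. e \<in> set tb \<Longrightarrow> set (fst e) \<subseteq> \<Sigma> \<and> set (snd e) \<subseteq> \<Sigma>" "polytime n f"
  shows "polytime n (\<lambda>xs. rewrite_head tb (f xs))"
  using assms(1)
proof (induction tb)
  case Nil
  then show ?case by (simp add: polytime_nil)
next
  case (Cons e tb)
  have e: "polytime n (\<lambda>_. fst e)" "polytime n (\<lambda>_. snd e)" using Cons.prems[of e] by (simp_all add: polytime_const)
  have "polytime n (\<lambda>xs. if prefix (fst e) (f xs) then snd e @ tl (strip (fst e) (f xs))
      else rewrite_head tb (f xs))"
    using Cons e assms(2)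
    by (intro polytime_if decidable_prefix polytime_append polytime_tl polytime_strip) auto
  then show ?case by (rule polytime_cong) (simp add: strip_def)
qed

lemma length_rewrite_head:
  "length (rewrite_head tb r) \<le> length r + (\<Sum>e\<leftarrow>tb. length (snd e))"
  by (induction tb) auto

lemma decidable_tok_in_set:
  assumes "polytime n e"
  shows "decidable n (\<lambda>xs. tok \<in> set (e xs))"
proof -
  have rec: "rec_list [] (\<lambda>a l r. if a = tok then [tok] else (l # r # xs) ! 1) z =
      (if tok \<in> set z then [tok] else [])" for z and xs :: "'c list list"
    by (induction z) auto
  have "polytime n (\<lambda>xs. rec_list [] (\<lambda>a l r. if a = tok then [tok] else (l # r # xs) ! 1) (e xs))"
    by (rule polytime_rec[OF polytime_nil _ assms, where q = 1 and h = "\<lambda>a ys. if a = tok then [tok] else ys ! 1"])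
      (unfold rec, auto intro!: polytime_if_const polytime_const polytime_nth tok)
  then show ?thesis unfolding rec decidable_def .
qed

definition before_tok :: "'c list \<Rightarrow> 'c list" where
  "before_tok z = takeWhile (\<lambda>a. a \<noteq> tok) z"

definition after_tok :: "'c list \<Rightarrow> 'c list" where
  "after_tok z = tl (dropWhile (\<lambda>a. a \<noteq> tok) z)"

lemma polytime_before_tok:
  assumes "polytime n e"
  shows "polytime n (\<lambda>xs. before_tok (e xs))"
proof -
  have rec: "rec_list [] (\<lambda>a l r. if a = tok then [] else a # (l # r # xs) ! 1) z = before_tok z"
    for z and xs :: "'c list list"
    by (induction z) (auto simp: before_tok_def)
  have "polytime n (\<lambda>xs. rec_list [] (\<lambda>a l r. if a = tok then [] else a # (l # r # xs) ! 1) (e xs))"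
    by (rule polytime_rec[OF polytime_nil _ assms, where q = "[:0, 1:]" and
          h = "\<lambda>a ys. if a = tok then [] else a # ys ! 1"])
      (unfold rec, auto intro!: polytime_if_const polytime_nil polytime_cons polytime_nth
        simp: before_tok_def length_takeWhile_le trans_le_add2)
  then show ?thesis unfolding rec .
qed

lemma polytime_after_tok:
  assumes "polytime n e"
  shows "polytime n (\<lambda>xs. after_tok (e xs))"
proof -
  have rec: "rec_list [] (\<lambda>a l r. if a = tok then (l # r # xs) ! 0 else (l # r # xs) ! 1) z = after_tok z"
    for z and xs :: "'c list list"
    by (induction z) (auto simp: after_tok_def)
  have len: "length (after_tok z) \<le> length z" for z
    using length_dropWhile_le[of "\<lambda>a. a \<noteq> tok" z] by (simp add: after_tok_def)
  have "polytime n (\<lambda>xs. rec_list [] (\<lambda>a l r. if a = tok then (l # r # xs) ! 0 else (l # r # xs) ! 1) (e xs))"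
    by (rule polytime_rec[OF polytime_nil _ assms, where q = "[:0, 1:]" and
          h = "\<lambda>a ys. if a = tok then ys ! 0 else ys ! 1"])
      (unfold rec, auto intro!: polytime_if_const polytime_nth simp: len trans_le_add2)
  then show ?thesis unfolding rec .
qed

definition residue :: "nat \<Rightarrow> 'c list \<Rightarrow> 'c list" where
  "residue m z = replicate (length z mod m) tok"

lemma polytime_residue:
  assumes "0 < m" "polytime n e"
  shows "polytime n (\<lambda>xs. residue m (e xs))"
proof -
  \<comment> \<open>A unary counter that falls back to the empty word on reaching the constant
    \<open>m\<close>.\<close>
  let ?h = "\<lambda>a ys. if tok # ys ! 1 = replicate m tok then [] else tok # ys ! 1"
  have rec: "rec_list [] (\<lambda>a l r. ?h a (l # r # xs)) z = residue m z" for z and xs :: "'c list list"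
  proof (induction z)
    case (Cons a z)
    have eq: "tok # replicate j tok = replicate m tok \<longleftrightarrow> Suc j = m" for j
      by (metis length_Cons length_replicate replicate_Suc)
    show ?case using Cons assms(1) by (auto simp: residue_def eq mod_Suc)
  qed (simp add: residue_def)
  have "polytime n (\<lambda>xs. rec_list [] (\<lambda>a l r. ?h a (l # r # xs)) (e xs))"
  proof (rule polytime_rec[OF polytime_nil _ assms(2), where q = "[:m:]" and h = ?h])
    show "polytime (Suc (Suc n)) (?h a)" for a
      using tok by (intro polytime_if decidable_eq polytime_cons polytime_const polytime_nil polytime_nth)
        (auto simp: set_replicate_conv_if)
    show "length (rec_list [] (\<lambda>a l r. ?h a (l # r # xs)) l) \<le> poly [:m:] (total_length xs + length l)"
      for xs and l :: "'c list"
      unfolding rec using assms(1) by (simp add: residue_def less_imp_le)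
  qed
  then show ?thesis unfolding rec .
qed

end


section \<open>Deciding Green's relations\<close>

type_synonym 'a sym = "'a pfun option + 'a"

locale green_decision = word_setting N G for N :: nat and G :: "'a::finite pfun set" +
  assumes finite_G: "finite G" and pinv_G: "g \<in> G \<Longrightarrow> pinv g \<in> G"
begin

definition symbols :: "'a sym set" where
  "symbols = Inl ` insert None (Some ` G) \<union> range Inr"

sublocale alphabet symbols "Inl None"
  by unfold_locales (simp_all add: symbols_def finite_G)

abbreviation mark :: "'a sym" where
  "mark \<equiv> Inl None"

text \<open>The mark distinguishes the empty word from an undefined value, so definedness is
  nonemptiness of the string.\<close>

definition enc :: "'a list option \<Rightarrow> 'a sym list" where
  "enc o' = (case o' of None \<Rightarrow> [] | Some w \<Rightarrow> mark # map Inr w)"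

lemma enc_simps [simp]: "enc None = []" "enc (Some w) = mark # map Inr w"
  by (simp_all add: enc_def)

definition gen_word :: "'a pfun list \<Rightarrow> 'a sym list" where
  "gen_word u = map (\<lambda>g. Inl (Some g)) u"

lemma gen_word_simps [simp]: "gen_word [] = []" "gen_word (g # u) = Inl (Some g) # gen_word u"
  by (simp_all add: gen_word_def)

text \<open>By \<open>reading_bound\<close>, entries for domain words of length at most
  \<open>N\<close> suffice. Their order in the chosen list is immaterial.\<close>

definition table :: "'a pfun \<Rightarrow> ('a sym list \<times> 'a sym list) list" where
  "table g = map (\<lambda>c. (mark # map Inr c, mark # map Inr (the (g c))))
     (SOME cs. set cs = {c \<in> dom g. length c \<le> N})"

lemma set_table:
  "set (table g) = (\<lambda>c. (mark # map Inr c, mark # map Inr (the (g c)))) ` {c \<in> dom g. length c \<le> N}"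
proof -
  have "finite {c \<in> dom g. length c \<le> N}" by (rule finite_subset[OF _ finite_words_le[of N]]) auto
  then have "\<exists>cs. set cs = {c \<in> dom g. length c \<le> N}" by (rule finite_list)
  from someI_ex[OF this] show ?thesis unfolding table_def by simp
qed

lemma prefix_map_Inr: "prefix (map Inr c) (map Inr w :: 'a sym list) \<longleftrightarrow> prefix c w"
proof
  assume "prefix (map Inr c) (map Inr w :: 'a sym list)"
  then have "take (length c) (map Inr w :: 'a sym list) = map Inr c"
    by (auto simp: prefix_def)
  then have "map Inr (take (length c) w) = (map Inr c :: 'a sym list)" by (simp add: take_map)
  then have "take (length c) w = c" by (simp add: inj_map_eq_map)
  then show "prefix c w" by (metis take_is_prefix)
qed (rule map_mono_prefix)

lemma rewrite_head_None: "(\<And>e. e \<in> set tb \<Longrightarrow> \<not> prefix (fst e) r) \<Longrightarrow> rewrite_head tb r = []"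
  by (induction tb) auto

lemma rewrite_head_Some:
  "(\<And>e. e \<in> set tb \<Longrightarrow> prefix (fst e) r \<Longrightarrow> snd e @ drop (length (fst e)) r = x) \<Longrightarrow>
   \<exists>e\<in>set tb. prefix (fst e) r \<Longrightarrow> rewrite_head tb r = x"
  by (induction tb) auto

text \<open>By the homomorphism property every matching entry yields the same value, and if
  \<open>g w\<close> is defined, the entry for \<open>take N w\<close> matches.\<close>

lemma rewrite_head_table:
  assumes "g \<in> G"
  shows "rewrite_head (table g) (enc o') = enc (Option.bind o' g)"
proof (cases o')
  case None
  then show ?thesis by (intro rewrite_head_None[of _ "enc o'", THEN trans]) (auto simp: set_table)
next
  case (Some w)
  note app = ri_hom_append[OF inj_hom_ri_hom[OF inj[OF assms]]]
  show ?thesis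
  proof (cases "g w")
    case None
    have "rewrite_head (table g) (enc o') = []"
    proof (rule rewrite_head_None)
      fix e assume "e \<in> set (table g)"
      then obtain c v where "e = (mark # map Inr c, mark # map Inr v)" "g c = Some v"
        by (auto simp: set_table)
      moreover have "\<not> prefix c w" using app[OF calculation(2)] None by (auto simp: prefix_def)
      ultimately show "\<not> prefix (fst e) (enc o')" by (simp add: Some prefix_map_Inr)
    qed
    then show ?thesis by (simp add: Some None)
  next
    fix v assume v: "g w = Some v"
    have "rewrite_head (table g) (enc o') = enc (Some v)"
    proof (rule rewrite_head_Some)
      fix e assume e: "e \<in> set (table g)" "prefix (fst e) (enc o')"
      then obtain c d where c: "e = (mark # map Inr c, mark # map Inr d)" "g c = Some d"
        by (auto simp: set_table)
      then obtain x where x: "w = c @ x" using e(2) by (auto simp: Some prefix_map_Inr prefix_def[of c])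
      then have "v = d @ x" using app[OF c(2), of x] v by simp
      then show "snd e @ drop (length (fst e)) (enc o') = enc (Some v)"
        using c x by (simp add: Some)
    next
      have "take N w \<in> dom g" using bound[OF assms] v by (auto simp: reading_bound_def)
      then have "(mark # map Inr (take N w), mark # map Inr (the (g (take N w)))) \<in> set (table g)"
        unfolding set_table by (intro imageI) simp
      moreover have "prefix (map Inr (take N w)) (map Inr w :: 'a sym list)"
        by (simp add: prefix_map_Inr take_is_prefix)
      ultimately show "\<exists>e\<in>set (table g). prefix (fst e) (enc o')"
        by (intro bexI) (auto simp: Some)
    qed
    then show ?thesis by (simp add: Some v)
  qed
qed

definition apply_letter :: "'a sym \<Rightarrow> 'a sym list \<Rightarrow> 'a sym list" where
  "apply_letter a r = (case a of Inl (Some g) \<Rightarrow> rewrite_head (table g) r | _ \<Rightarrow> r)"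

definition act :: "'a sym list \<Rightarrow> 'a sym list \<Rightarrow> 'a sym list" where
  "act U r = foldr apply_letter U r"

lemma act_gen_word:
  assumes "u \<in> lists G"
  shows "act (gen_word u) (enc o') = enc (Option.bind o' (comp_word u))"
  using assms
proof (induction u)
  case Nil
  then show ?case by (simp add: act_def)
next
  case (Cons g u)
  have "Option.bind (Option.bind o' (comp_word u)) g = Option.bind o' (g \<circ>\<^sub>m comp_word u)"
    by (cases o') (auto simp: map_comp_def split: option.split)
  then show ?case using Cons rewrite_head_table[of g "Option.bind o' (comp_word u)"]
    by (auto simp: act_def apply_letter_def)
qed

lemma rec_list_foldr: "rec_list r (\<lambda>a l acc. f a acc) U = foldr f U r"
  by (induction U) simp_all

text \<open>Each symbol lengthens a word by at most \<open>K\<close>, a sum over all tables and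
  hence one constant for all generators. So the bound demanded by the recursion is linear in the
  length of the acting string.\<close>

lemma polytime_act:
  assumes U: "polytime n eU" and r: "polytime n er"
  shows "polytime n (\<lambda>xs. act (eU xs) (er xs))"
proof -
  define K where "K = (\<Sum>g\<in>G. \<Sum>e\<leftarrow>table g. length (snd e))"
  have len1: "length (apply_letter a r) \<le> length r + K" if a: "a \<in> symbols" for a r
  proof (cases "\<exists>g. a = Inl (Some g)")
    case True
    then obtain g where g: "a = Inl (Some g)" "g \<in> G" using a by (auto simp: symbols_def)
    have "(\<Sum>e\<leftarrow>table g. length (snd e)) \<le> K"
      unfolding K_def using g(2) finite_G by (intro member_le_sum) auto
    then show ?thesis using length_rewrite_head[of "table g" r] g(1) by (simp add: apply_letter_def)
  qed (auto simp: apply_letter_def split: sum.split option.split)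
  have len: "length (act U r) \<le> length r + K * length U" if "set U \<subseteq> symbols" for U r
    using that
  proof (induction U)
    case (Cons a U)
    then show ?case using len1[of a "act U r"] by (auto simp: act_def)
  qed (simp add: act_def)
  have rec: "rec_list r (\<lambda>a l acc. apply_letter a ((l # acc # xs) ! 1)) U = act U r"
    for r U and xs :: "'a sym list list"
    by (simp add: rec_list_foldr act_def)
  obtain q where q: "\<And>xs. args n xs \<Longrightarrow> length (er xs) \<le> poly q (total_length xs)"
    using polytime_bound[OF r] by metis
  have "polytime n (\<lambda>xs. rec_list (er xs) (\<lambda>a l acc. apply_letter a ((l # acc # xs) ! 1)) (eU xs))"
  proof (rule polytime_rec[OF r _ U, where q = "q + [:0, K:]" and h = "\<lambda>a ys. apply_letter a (ys ! 1)"])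
    fix a assume a: "a \<in> symbols"
    have nth: "polytime (Suc (Suc n)) (\<lambda>ys. ys ! 1)" by (rule polytime_nth) simp
    show "polytime (Suc (Suc n)) (\<lambda>ys. apply_letter a (ys ! 1))"
    proof (cases "\<exists>g. a = Inl (Some g)")
      case True
      then obtain g where "a = Inl (Some g)" by blast
      moreover have "polytime (Suc (Suc n)) (\<lambda>ys. rewrite_head (table g) (ys ! 1))"
        by (rule polytime_rewrite_head[OF _ nth]) (auto simp: set_table symbols_def)
      ultimately show ?thesis by (simp add: apply_letter_def)
    next
      case False
      then have "apply_letter a = (\<lambda>r. r)"
        by (auto simp: apply_letter_def fun_eq_iff split: sum.split option.split)
      then show ?thesis using nth by simp
    qed
  next
    fix xs and l :: "'a sym list" assume a: "args n xs" "set l \<subseteq> symbols"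
    from order_trans[OF q[OF a(1)] poly_nat_mono[of "total_length xs" "total_length xs + length l" q]]
    show "length (rec_list (er xs) (\<lambda>a l acc. apply_letter a ((l # acc # xs) ! 1)) l)
       \<le> poly (q + [:0, K:]) (total_length xs + length l)"
      unfolding rec using len[OF a(2), of "er xs"] by (simp add: algebra_simps)
  qed
  then show ?thesis unfolding rec .
qed

definition inv_letter :: "'a sym \<Rightarrow> 'a sym" where
  "inv_letter a = (case a of Inl (Some g) \<Rightarrow> Inl (Some (pinv g)) | _ \<Rightarrow> a)"

definition inv_syms :: "'a sym list \<Rightarrow> 'a sym list" where
  "inv_syms U = rev (map inv_letter U)"

lemma inv_syms_gen_word: "inv_syms (gen_word u) = gen_word (inv_word u)"
  by (simp add: inv_syms_def gen_word_def inv_word_def inv_letter_def rev_map)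

lemma polytime_inv_syms:
  assumes "polytime n e"
  shows "polytime n (\<lambda>xs. inv_syms (e xs))"
proof -
  have rec: "rec_list [] (\<lambda>a l r. (l # r # xs) ! 1 @ [inv_letter a]) U = inv_syms U"
    for U and xs :: "'a sym list list"
    by (induction U) (simp_all add: inv_syms_def)
  have "inv_letter a \<in> symbols" if "a \<in> symbols" for a
    using that pinv_G by (auto simp: inv_letter_def symbols_def split: sum.split option.split)
  then have "polytime n (\<lambda>xs. rec_list [] (\<lambda>a l r. (l # r # xs) ! 1 @ [inv_letter a]) (e xs))"
    by (intro polytime_rec[OF polytime_nil _ assms, where q = "[:0, 1:]" and
          h = "\<lambda>a ys. ys ! 1 @ [inv_letter a]"])
      (unfold rec, auto intro!: polytime_append polytime_nth polytime_const simp: inv_syms_def)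
  then show ?thesis unfolding rec .
qed

definition short_words :: "'a list list" where
  "short_words = (SOME ps. set ps = {p. length p \<le> N} \<and> distinct ps)"

lemma short_words: "set short_words = {p. length p \<le> N}" "distinct short_words"
proof -
  have "\<exists>ps. set ps = {p :: 'a list. length p \<le> N} \<and> distinct ps"
    by (rule finite_distinct_list[OF finite_words_le])
  from someI_ex[OF this]
  show "set short_words = {p. length p \<le> N}" "distinct short_words" by (simp_all add: short_words_def)
qed

definition pull :: "'a sym list \<Rightarrow> 'a list \<Rightarrow> 'a sym list" where
  "pull Y p = act (inv_syms Y) (enc (Some p))"

lemma lists_inv_word: "u \<in> lists G \<Longrightarrow> inv_word u \<in> lists G"
  using pinv_G by (auto simp: inv_word_def)

lemma pull_gen_word:
  "y \<in> lists G \<Longrightarrow> pull (gen_word y) p = enc (comp_word (inv_word y) p)"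
  unfolding pull_def inv_syms_gen_word by (subst act_gen_word) (simp_all add: lists_inv_word)

lemma enc_eq_Nil [simp]: "enc o' = [] \<longleftrightarrow> o' = None"
  by (cases o') auto

lemma polytime_pull:
  assumes "polytime n e"
  shows "polytime n (\<lambda>xs. pull (e xs) p)"
  unfolding pull_def
  by (intro polytime_act polytime_inv_syms assms polytime_const) (auto simp: symbols_def)

text \<open>The quantifier over candidates for arbitrary strings, reduced to a search over suffixes
  and over the fixed finite list of short words.\<close>

definition some_candidate :: "'a sym list \<Rightarrow> ('a sym list \<Rightarrow> bool) \<Rightarrow> bool" where
  "some_candidate U Q \<longleftrightarrow>
     (\<exists>Y. suffix Y U \<and> (\<exists>p\<in>set short_words. pull Y p \<noteq> [] \<and> Q (pull Y p)))"

lemma suffix_gen_word: "suffix Y (gen_word u) \<longleftrightarrow> (\<exists>y. Y = gen_word y \<and> suffix y u)"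
  by (auto simp: suffix_def gen_word_def map_eq_append_conv)

lemma some_candidate_gen_word:
  assumes u: "u \<in> lists G"
  shows "some_candidate (gen_word u) Q \<longleftrightarrow> (\<exists>c\<in>cands u. Q (enc (Some c)))"
proof -
  have y: "y \<in> lists G" if "suffix y u" for y using that u by (auto dest: set_mono_suffix)
  have "some_candidate (gen_word u) Q \<longleftrightarrow> (\<exists>y. suffix y u \<and> (\<exists>p. length p \<le> N \<and>
      pull (gen_word y) p \<noteq> [] \<and> Q (pull (gen_word y) p)))"
    unfolding some_candidate_def suffix_gen_word short_words(1) by blast
  also have "\<dots> \<longleftrightarrow> (\<exists>y. suffix y u \<and> (\<exists>p. length p \<le> N \<and>
      (\<exists>c. comp_word (inv_word y) p = Some c \<and> Q (enc (Some c)))))"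
    by (intro ex_cong1 conj_cong refl) (auto simp: pull_gen_word[OF y])
  also have "\<dots> \<longleftrightarrow> (\<exists>c\<in>cands u. Q (enc (Some c)))"
    unfolding candidates_def by blast
  finally show ?thesis .
qed

lemma decidable_some_candidate:
  assumes e: "polytime n e" and Q: "decidable (Suc n) Q"
  shows "decidable n (\<lambda>xs. some_candidate (e xs) (\<lambda>c. Q (c # xs)))"
proof -
  let ?is = "[1..<Suc n]"
  have "decidable (Suc n) (\<lambda>ys. \<exists>p\<in>set short_words. pull (ys ! 0) p \<noteq> [] \<and>
      Q (pull (ys ! 0) p # map ((!) ys) ?is))"
    using Q by (intro decidable_bex_list decidable_conj decidable_nonempty polytime_pull
        decidable_bind polytime_nth) auto
  from decidable_ex_suffix[OF e this] show ?thesis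
    proof (rule decidable_cong)
    fix xs assume "args n xs"
    then have "length xs = n" by (simp add: args_def)
    then show "(\<exists>y. suffix y (e xs) \<and> (\<exists>p\<in>set short_words. pull ((y # xs) ! 0) p \<noteq> [] \<and>
        Q (pull ((y # xs) ! 0) p # map ((!) (y # xs)) ?is))) = some_candidate (e xs) (\<lambda>c. Q (c # xs))"
      using map_nth_shift[of _ xs] unfolding some_candidate_def by simp
  qed
qed

lemma act_neq_Nil:
  "u \<in> lists G \<Longrightarrow> act (gen_word u) (enc (Some c)) \<noteq> [] \<longleftrightarrow> c \<in> dom_word u"
  using act_gen_word[of u "Some c"] by (auto simp del: enc_simps)

lemma prefix_enc: "prefix (enc (Some w)) (enc (Some d)) \<longleftrightarrow> prefix w d"
  by (simp add: prefix_map_Inr)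

lemma enc_eq_iff: "enc (Some w) = enc (Some d) \<longleftrightarrow> w = d"
  by (simp add: inj_map_eq_map)

section \<open>The tests for zero, for inclusion of domains and for equal rank\<close>

definition nonzero :: "'a sym list \<Rightarrow> bool" where
  "nonzero U \<longleftrightarrow> some_candidate U (\<lambda>c. act U c \<noteq> [])"

lemma nonzero_gen_word: "u \<in> lists G \<Longrightarrow> nonzero (gen_word u) \<longleftrightarrow> dom_word u \<noteq> {}"
  by (simp only: nonzero_def some_candidate_gen_word act_neq_Nil dom_empty_iff not_not)

lemma decidable_nonzero:
  assumes "polytime n e"
  shows "decidable n (\<lambda>xs. nonzero (e xs))"
proof -
  have "decidable (Suc n) (\<lambda>ys. act (e (tl ys)) (ys ! 0) \<noteq> [])"
    using assms by (intro decidable_nonempty polytime_act polytime_weaken polytime_nth) auto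
  from decidable_some_candidate[OF assms this] show ?thesis by (simp add: nonzero_def)
qed

text \<open>The parameter \<open>X\<close> lets the candidates of the two words in
  \<open>ev_subset_iff\<close> be searched separately.\<close>

definition witness :: "'a sym list \<Rightarrow> 'a sym list \<Rightarrow> 'a sym list \<Rightarrow> bool" where
  "witness X U V \<longleftrightarrow> some_candidate X (\<lambda>w. act U w \<noteq> [] \<and>
     \<not> some_candidate V (\<lambda>d. act V d \<noteq> [] \<and> (prefix w d \<or> prefix d w)))"

definition dom_subset :: "'a sym list \<Rightarrow> 'a sym list \<Rightarrow> bool" where
  "dom_subset U V \<longleftrightarrow> \<not> witness U U V \<and> \<not> witness V U V"

lemma dom_subset_gen_word:
  assumes "u \<in> lists G" "v \<in> lists G"
  shows "dom_subset (gen_word u) (gen_word v) \<longleftrightarrow> ev_subset (dom_word u) (dom_word v)"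
  unfolding ev_subset_iff[OF assms] dom_subset_def witness_def
  using assms by (simp add: some_candidate_gen_word act_neq_Nil prefix_enc bex_Un del: enc_simps)

lemma decidable_witness:
  assumes X: "polytime n eX" and U: "polytime n eU" and V: "polytime n eV"
  shows "decidable n (\<lambda>xs. witness (eX xs) (eU xs) (eV xs))"
proof -
  \<comment> \<open>The entries of \<open>zs\<close> are the inner candidate, the outer candidate
    and then the original arguments.\<close>
  have "decidable (Suc (Suc n)) (\<lambda>zs. act (eV (tl (tl zs))) (zs ! 0) \<noteq> [] \<and>
      (prefix (zs ! 1) (zs ! 0) \<or> prefix (zs ! 0) (zs ! 1)))"
    using V by (intro decidable_conj decidable_disj decidable_prefix decidable_nonempty polytime_act
        polytime_weaken2 polytime_nth) auto
  from decidable_some_candidate[OF polytime_weaken[OF V] this]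
  have "decidable (Suc n) (\<lambda>ys. act (eU (tl ys)) (ys ! 0) \<noteq> [] \<and>
      \<not> some_candidate (eV (tl ys)) (\<lambda>d. act (eV (tl (tl (d # ys)))) ((d # ys) ! 0) \<noteq> [] \<and>
      (prefix ((d # ys) ! 1) ((d # ys) ! 0) \<or> prefix ((d # ys) ! 0) ((d # ys) ! 1))))"
    using U by (intro decidable_conj decidable_not decidable_nonempty polytime_act
        polytime_weaken polytime_nth) auto
  from decidable_some_candidate[OF X this] show ?thesis by (simp add: witness_def)
qed

lemma decidable_dom_subset:
  "polytime n eU \<Longrightarrow> polytime n eV \<Longrightarrow> decidable n (\<lambda>xs. dom_subset (eU xs) (eV xs))"
  unfolding dom_subset_def by (intro decidable_conj decidable_not decidable_witness)

definition in_code :: "'a sym list \<Rightarrow> 'a sym list \<Rightarrow> bool" where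
  "in_code U c \<longleftrightarrow> act U c \<noteq> [] \<and>
     \<not> some_candidate U (\<lambda>d. act U d \<noteq> [] \<and> prefix d c \<and> \<not> prefix c d)"

lemma decidable_in_code:
  assumes U: "polytime n eU" and c: "polytime n ec"
  shows "decidable n (\<lambda>xs. in_code (eU xs) (ec xs))"
proof -
  have "decidable (Suc n) (\<lambda>ys. act (eU (tl ys)) (ys ! 0) \<noteq> [] \<and> prefix (ys ! 0) (ec (tl ys)) \<and>
      \<not> prefix (ec (tl ys)) (ys ! 0))"
    using U c by (intro decidable_conj decidable_not decidable_prefix decidable_nonempty polytime_act
        polytime_weaken polytime_nth) auto
  from decidable_some_candidate[OF U this]
  have "decidable n (\<lambda>xs. some_candidate (eU xs)
      (\<lambda>d. act (eU xs) d \<noteq> [] \<and> prefix d (ec xs) \<and> \<not> prefix (ec xs) d))" by simp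
  then show ?thesis
    unfolding in_code_def using U c
    by (intro decidable_conj decidable_not decidable_nonempty polytime_act)
qed

text \<open>A code word with several descriptions is counted at the shortest suffix describing it; for
  a given suffix the description is unique by injectivity.\<close>

definition counted :: "'a sym list \<Rightarrow> 'a sym list \<Rightarrow> 'a list \<Rightarrow> bool" where
  "counted U Y p \<longleftrightarrow> pull Y p \<noteq> [] \<and> in_code U (pull Y p) \<and>
     \<not> (Y \<noteq> [] \<and> some_candidate (tl Y) (\<lambda>d. d = pull Y p))"

lemma decidable_counted:
  assumes U: "polytime n eU" and Y: "polytime n eY"
  shows "decidable n (\<lambda>xs. counted (eU xs) (eY xs) p)"
proof -
  have "decidable (Suc n) (\<lambda>ys. ys ! 0 = pull (eY (tl ys)) p)"
    using Y by (intro decidable_eq polytime_pull polytime_weaken polytime_nth) auto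
  from decidable_some_candidate[OF polytime_tl[OF Y] this]
  have "decidable n (\<lambda>xs. some_candidate (tl (eY xs)) (\<lambda>d. d = pull (eY xs) p))" by simp
  then show ?thesis
    unfolding counted_def using U Y
    by (intro decidable_conj decidable_not decidable_nonempty decidable_in_code polytime_pull)
qed

text \<open>The count is in unary, with at most \<open>length short_words\<close> marks for each
  suffix.\<close>

definition count_word :: "'a sym list \<Rightarrow> 'a sym list" where
  "count_word U = concat (map (\<lambda>Y. concat (map (\<lambda>p. if counted U Y p then [mark] else []) short_words))
     (rev (suffixes U)))"

lemma polytime_concat_map:
  "(\<And>p. polytime n (f p)) \<Longrightarrow> polytime n (\<lambda>xs. concat (map (\<lambda>p. f p xs) ps))"
  by (induction ps) (auto intro: polytime_nil polytime_append)

lemma polytime_count_word: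
  assumes "polytime n e"
  shows "polytime n (\<lambda>xs. count_word (e xs))"
proof -
  let ?f = "\<lambda>ys. concat (map (\<lambda>p. if counted (e (tl ys)) (ys ! 0) p then [mark] else []) short_words)"
  have "polytime (Suc n) ?f"
    using assms by (intro polytime_concat_map decidable_counted[unfolded decidable_def]
        polytime_weaken polytime_nth) auto
  moreover have "length (concat (map (\<lambda>p. if P p then [mark] else []) ps)) \<le> length ps"
    for P and ps :: "'a list list"
    by (induction ps) auto
  ultimately have "polytime n (\<lambda>xs. concat (map (\<lambda>y. ?f (y # xs)) (rev (suffixes (e xs)))))"
    by (intro polytime_count_suffixes[where K = "length short_words"] assms)
  then show ?thesis by (simp add: count_word_def)
qed

lemma in_code_enc:
  assumes "u \<in> lists G"
  shows "in_code (gen_word u) (enc (Some c)) \<longleftrightarrow> c \<in> dom_word u \<and>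
    \<not> (\<exists>d\<in>cands u. d \<in> dom_word u \<and> prefix d c \<and> \<not> prefix c d)"
  unfolding in_code_def using assms
  by (simp add: some_candidate_gen_word act_neq_Nil prefix_enc del: enc_simps)

lemma counted_gen_word:
  assumes u: "u \<in> lists G" and y: "suffix y u" and p: "length p \<le> N"
  shows "counted (gen_word u) (gen_word y) p \<longleftrightarrow>
    (\<exists>c\<in>code_of u. first_description y p c)"
proof -
  have yG: "y \<in> lists G" using y u by (auto dest: set_mono_suffix)
  then have tl: "tl y \<in> lists G" by (cases y) auto
  have tl_gen: "tl (gen_word y) = gen_word (tl y)" "gen_word y = [] \<longleftrightarrow> y = []"
    by (simp_all add: gen_word_def map_tl)
  show ?thesis
  proof (cases "comp_word (inv_word y) p")
    case None
    then show ?thesis by (simp add: counted_def pull_gen_word[OF yG] first_description_def)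
  next
    case (Some c)
    then have "c \<in> cands u" using y p by (auto simp: candidates_def)
    then have "in_code (gen_word u) (enc (Some c)) \<longleftrightarrow> c \<in> code_of u"
      by (simp add: in_code_enc[OF u] code_of_def del: enc_simps)
    moreover have "some_candidate (tl (gen_word y)) (\<lambda>d. d = enc (Some c)) \<longleftrightarrow>
        (\<exists>y' p'. suffix y' (tl y) \<and> length p' \<le> N \<and> comp_word (inv_word y') p' = Some c)"
      unfolding tl_gen(1) some_candidate_gen_word[OF tl] enc_eq_iff by (auto simp: candidates_def)
    ultimately show ?thesis
      unfolding counted_def first_description_def pull_gen_word[OF yG] Some tl_gen(2) enc_eq_Nil by auto
  qed
qed

lemma length_concat_if:
  "length (concat (map (\<lambda>Y. concat (map (\<lambda>p. if P Y p then [mark] else []) ps)) Ys)) =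
    (\<Sum>Y\<leftarrow>Ys. \<Sum>p\<leftarrow>ps. of_bool (P Y p))"
proof -
  have "length (concat (map (\<lambda>p. if P Y p then [mark] else []) ps)) = (\<Sum>p\<leftarrow>ps. of_bool (P Y p))" for Y
    by (induction ps) auto
  then show ?thesis by (induction Ys) auto
qed

lemma length_count_word:
  assumes u: "u \<in> lists G"
  shows "length (count_word (gen_word u)) = card (code_of u)"
proof -
  let ?U = "gen_word u"
  let ?Y = "{y. suffix y u}" and ?P = "{p :: 'a list. length p \<le> N}"
  let ?c = "\<lambda>y p. counted ?U (gen_word y) p"
  have fin: "finite ?Y" "finite ?P"
    using finite_words_le[of N] by (simp_all add: set_suffixes_eq[symmetric])
  have sufs: "{Y. suffix Y ?U} = gen_word ` ?Y" by (auto simp: suffix_gen_word)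
  have "length (count_word ?U) = (\<Sum>Y\<leftarrow>suffixes ?U. \<Sum>p\<leftarrow>short_words. of_bool (counted ?U Y p))"
    unfolding count_word_def length_concat_if by (simp only: rev_map[symmetric] sum_list_rev)
  also have "\<dots> = (\<Sum>Y\<in>{Y. suffix Y ?U}. \<Sum>p\<in>?P. of_bool (counted ?U Y p))"
    by (simp add: sum_list_distinct_conv_sum_set short_words set_suffixes_eq distinct_suffixes)
  also have "\<dots> = (\<Sum>y\<in>?Y. \<Sum>p\<in>?P. of_bool (?c y p))"
    unfolding sufs by (subst sum.reindex) (auto simp: inj_on_def gen_word_def inj_map_eq_map)
  also have "\<dots> = (\<Sum>(y, p)\<in>?Y \<times> ?P. of_bool (?c y p))"
    by (rule sum.cartesian_product)
  also have "\<dots> = card ((?Y \<times> ?P) \<inter> {z. ?c (fst z) (snd z)})"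
    unfolding case_prod_unfold
    by (intro sum_of_bool_eq[where 'a = nat, unfolded of_nat_id] finite_cartesian_product fin)
  also have "(?Y \<times> ?P) \<inter> {z. ?c (fst z) (snd z)} = {(y, p). suffix y u \<and> length p \<le> N \<and>
    (\<exists>c\<in>code_of u. first_description y p c)}"
    (is "_ = ?S")
  proof (rule Set.set_eqI)
    fix z
    show "z \<in> (?Y \<times> ?P) \<inter> {z. ?c (fst z) (snd z)} \<longleftrightarrow> z \<in> ?S"
      by (cases z) (simp only: Int_iff mem_Sigma_iff mem_Collect_eq prod.case fst_conv snd_conv
          conj_assoc, intro conj_cong refl counted_gen_word[OF u])
  qed
  also have "card \<dots> = card (code_of u)" by (rule card_code_of[OF u, symmetric])
  finally show ?thesis .
qed

definition rank_cong :: "'a sym list \<Rightarrow> 'a sym list \<Rightarrow> bool" where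
  "rank_cong U V \<longleftrightarrow> (nonzero U \<longleftrightarrow> nonzero V) \<and>
     residue (CARD('a) - 1) (count_word U) = residue (CARD('a) - 1) (count_word V)"

lemma decidable_rank_cong:
  assumes "CARD('a) \<ge> 2" "polytime n eU" "polytime n eV"
  shows "decidable n (\<lambda>xs. rank_cong (eU xs) (eV xs))"
proof -
  have "decidable n (\<lambda>xs. (if nonzero (eU xs) then nonzero (eV xs) else \<not> nonzero (eV xs)) \<and>
      residue (CARD('a) - 1) (count_word (eU xs)) = residue (CARD('a) - 1) (count_word (eV xs)))"
    using assms by (intro decidable_conj decidable_if decidable_not decidable_nonzero decidable_eq
        polytime_residue polytime_count_word) auto
  then show ?thesis by (rule decidable_cong) (auto simp: rank_cong_def)
qed

lemma rank_cong_gen_word: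
  assumes "CARD('a) \<ge> 2" "u \<in> lists G" "v \<in> lists G"
  shows "rank_cong (gen_word u) (gen_word v) \<longleftrightarrow>
    green_D Inv (max_hom (comp_word u)) (max_hom (comp_word v))"
proof -
  have "residue m x = residue m y \<longleftrightarrow> [length x = length y] (mod m)" for m x y
    by (auto simp: residue_def cong_def)
  then show ?thesis
    unfolding rank_cong_def nonzero_gen_word[OF assms(2)] nonzero_gen_word[OF assms(3)]
      green_D_Inv[OF assms(1) inj_hom_word[OF assms(2)] inj_hom_word[OF assms(3)]
        has_rank_code_of[OF assms(2)] has_rank_code_of[OF assms(3)]]
      length_count_word[OF assms(2), symmetric] length_count_word[OF assms(3), symmetric]
    by simp
qed

lemma dom_subset_inv_gen_word:
  assumes "u \<in> lists G" "v \<in> lists G"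
  shows "dom_subset (inv_syms (gen_word u)) (inv_syms (gen_word v)) \<longleftrightarrow>
    green_le_R Inv (max_hom (comp_word u)) (max_hom (comp_word v))"
proof -
  have "comp_word (inv_word w) = pinv (comp_word w)" if "w \<in> lists G" for w
    using that inj by (intro comp_word_inv) auto
  then show ?thesis
    using assms by (simp add: inv_syms_gen_word dom_subset_gen_word lists_inv_word green_le_R_Inv
        green_le_L_Inv inj_hom_word inj_hom_pinv)
qed

text \<open>\<open>in_P\<close> quantifies over all strings, so inputs with no separator or with
  several must be rejected; the first two conjuncts of \<open>?P\<close> say that there is exactly
  one.\<close>

lemma word_problem_in_P_if_decidable:
  assumes \<Gamma>: "\<Gamma> \<subseteq> G" "\<Gamma> \<subseteq> carrier Inv"
    and dec: "\<And>n e f. polytime n e \<Longrightarrow> polytime n f \<Longrightarrow> decidable n (\<lambda>xs. Q (e xs) (f xs))"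
    and Q: "\<And>u v. u \<in> lists G \<Longrightarrow> v \<in> lists G \<Longrightarrow> Q (gen_word u) (gen_word v) \<longleftrightarrow>
      rel (max_hom (comp_word u)) (max_hom (comp_word v))"
  shows "word_problem_in_P Inv \<Gamma> rel"
  unfolding word_problem_in_P_def
proof (rule in_P_if_decidable)
  let ?P = "\<lambda>z. mark \<in> set z \<and> mark \<notin> set (after_tok z) \<and> Q (before_tok z) (after_tok z)"
  show "alphabet symbols mark" by unfold_locales
  have nth: "polytime 1 (\<lambda>xs. xs ! 0)" by (rule polytime_nth) simp
  show "decidable 1 (\<lambda>xs. ?P (xs ! 0))"
    by (intro decidable_conj decidable_not decidable_tok_in_set dec polytime_before_tok
        polytime_after_tok nth)
  show "inj_on Inl (insert None (Some ` \<Gamma>))" by (auto simp: inj_on_def)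
  show "Inl ` insert None (Some ` \<Gamma>) \<subseteq> symbols" using \<Gamma>(1) by (auto simp: symbols_def)
  show "word_problem_lang Inv \<Gamma> rel \<subseteq> lists (insert None (Some ` \<Gamma>))"
    by (auto simp: word_problem_lang_def word_pair_def)
  fix w :: "'a pfun option list" assume w: "w \<in> lists (insert None (Some ` \<Gamma>))"
  have vals: "Q (gen_word u) (gen_word v) \<longleftrightarrow> rel (word_value Inv u) (word_value Inv v)"
    if "u \<in> lists \<Gamma>" "v \<in> lists \<Gamma>" for u v
  proof -
    have "u \<in> lists (carrier Inv)" "v \<in> lists (carrier Inv)" "u \<in> lists G" "v \<in> lists G"
      using that \<Gamma> by auto
    then show ?thesis using Q by (simp add: word_value_Inv)
  qed
  have gen: "map Inl (map Some u) = gen_word u" for u by (simp add: gen_word_def)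
  have mark: "mark \<notin> set (gen_word u)" for u by (auto simp: gen_word_def)
  have split: "before_tok (gen_word u @ mark # z) = gen_word u"
      "after_tok (gen_word u @ mark # z) = z" for u z
    using mark[of u] by (auto simp: before_tok_def after_tok_def takeWhile_append2 dropWhile_append2
        takeWhile_append dropWhile_append)
  have "?P (map Inl w) \<longleftrightarrow> w \<in> word_problem_lang Inv \<Gamma> rel"
  proof
    assume P: "?P (map Inl w)"
    then have "None \<in> set w" by auto
    then obtain w1 w2 where ws: "w = w1 @ None # w2" "None \<notin> set w1" using split_list_first by metis
    have some: "\<exists>u\<in>lists \<Gamma>. x = map Some u" if "x \<in> lists (insert None (Some ` \<Gamma>))" "None \<notin> set x" for x
      using that
    proof (induction x)
      case (Cons a x)
      then obtain g u where "a = Some g" "g \<in> \<Gamma>" "u \<in> lists \<Gamma>" "x = map Some u" by auto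
      then show ?case by (intro bexI[of _ "g # u"]) auto
    qed simp
    obtain u where u: "u \<in> lists \<Gamma>" "w1 = map Some u" using some[of w1] w ws by auto
    have z: "map Inl w = gen_word u @ mark # map Inl w2" using ws(1) u(2) gen by simp
    then have "None \<notin> set w2" using P split by auto
    then obtain v where v: "v \<in> lists \<Gamma>" "w2 = map Some v" using some[of w2] w ws by auto
    have "Q (gen_word u) (gen_word v)" using P unfolding z split v(2) gen by simp
    then show "w \<in> word_problem_lang Inv \<Gamma> rel"
      using vals[OF u(1) v(1)] u v ws(1) unfolding word_problem_lang_def word_pair_def by auto
  next
    assume "w \<in> word_problem_lang Inv \<Gamma> rel"
    then obtain u v where uv: "w = word_pair u v" "u \<in> lists \<Gamma>" "v \<in> lists \<Gamma>"
      "rel (word_value Inv u) (word_value Inv v)" by (auto simp: word_problem_lang_def)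
    have z: "map Inl w = gen_word u @ mark # gen_word v"
      unfolding uv(1) word_pair_def by (simp add: gen_word_def)
    show "?P (map Inl w)" unfolding z split using vals[OF uv(2,3)] uv(4) mark by simp
  qed
  then show "?P ([map Inl w] ! 0) \<longleftrightarrow> w \<in> word_problem_lang Inv \<Gamma> rel" by simp
qed

end

theorem proposition7p2:
  fixes \<Gamma> :: "'a::finite pfun set"
  assumes "CARD('a) \<ge> 2"
    and "finite \<Gamma>"
    and "generates Inv \<Gamma>"
  shows "word_problem_in_P Inv \<Gamma> (green_le_J Inv)
    \<and> word_problem_in_P Inv \<Gamma> (green_D Inv)
    \<and> word_problem_in_P Inv \<Gamma> (green_le_R Inv)
    \<and> word_problem_in_P Inv \<Gamma> (green_le_L Inv)"
proof -
  have carrier: "\<Gamma> \<subseteq> carrier Inv" using assms(3) unfolding generates_def by blast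
  \<comment> \<open>Inverses of generators become letters with tables of their own, so that ranges
    and candidates are computed by words over \<open>G\<close>. As inversion is an involution, one
    round closes the set.\<close>
  define G where "G = \<Gamma> \<union> pinv ` \<Gamma>"
  have inj: "inj_hom g" if "g \<in> G" for g
    using that carrier by (auto simp: G_def carrier_Inv intro: inj_hom_pinv)
  have pinv: "pinv g \<in> G" if "g \<in> G" for g
  proof -
    have "pinv (pinv h) = h" if "h \<in> \<Gamma>" for h
      using that carrier by (intro pinv_pinv) (auto simp: carrier_Inv)
    then show ?thesis using that by (auto simp: G_def)
  qed
  have fin: "finite G" using assms(2) by (simp add: G_def)
  have "\<exists>M. \<forall>w n. w \<in> dom g \<longrightarrow> M \<le> n \<longrightarrow> take n w \<in> dom g" if "g \<in> G" for g
    using ri_hom_take[OF inj_hom_ri_hom[OF inj[OF that]]] by metis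
  then obtain M where M: "\<And>g w n. g \<in> G \<Longrightarrow> w \<in> dom g \<Longrightarrow> M g \<le> n \<Longrightarrow> take n w \<in> dom g"
    by metis
  \<comment> \<open>The sum is a common upper bound for the finitely many look-aheads
    \<open>M g\<close>.\<close>
  define N where "N = (\<Sum>g\<in>G. M g)"
  have "M g \<le> N" if "g \<in> G" for g
    unfolding N_def using that fin by (intro member_le_sum) auto
  then have "reading_bound N g" if "g \<in> G" for g
    using M that by (auto simp: reading_bound_def)
  then interpret green_decision N G
    using inj pinv fin by unfold_locales
  have sub: "\<Gamma> \<subseteq> G" by (simp add: G_def)
  note in_P = word_problem_in_P_if_decidable[OF sub carrier]
  have J: "word_problem_in_P Inv \<Gamma> (green_le_J Inv)"
    by (rule in_P[where Q = "\<lambda>U V. \<not> nonzero U \<or> nonzero V"])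
      (intro decidable_disj decidable_not decidable_nonzero, assumption+,
        simp add: nonzero_gen_word green_le_J_Inv inj_hom_word)
  have D: "word_problem_in_P Inv \<Gamma> (green_D Inv)"
    by (rule in_P[where Q = rank_cong, OF decidable_rank_cong[OF assms(1)] rank_cong_gen_word[OF assms(1)]])
  have R: "word_problem_in_P Inv \<Gamma> (green_le_R Inv)"
    by (rule in_P[where Q = "\<lambda>U V. dom_subset (inv_syms U) (inv_syms V)"])
      (intro decidable_dom_subset polytime_inv_syms, assumption+, rule dom_subset_inv_gen_word)
  have L: "word_problem_in_P Inv \<Gamma> (green_le_L Inv)"
    by (rule in_P[where Q = dom_subset, OF decidable_dom_subset])
      (simp_all add: dom_subset_gen_word green_le_L_Inv inj_hom_word)
  show ?thesis using J D R L by blast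
qed

end
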